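(* Let $m\in\mathbb{N}$, let $f_1,\ldots,f_m,g_1,\ldots,g_m:[0,1]\to\mathbb{R}$ with $f_1',\ldots,f_m',g_1',\ldots,g_m'\in BV$, and let $F=F(I(f_1),\ldots,I(f_m))\in\mathcal{WA}$ and $G=G(I(g_1),\ldots,I(g_m))\in\mathcal{WA}$ be Wick-analytic functionals. Then $$\lim_{n\to\infty}n^2\,\mathbb{E}\big[(F-\widehat{F}^n)(G-\widehat{G}^n)\big]=\frac1{12}\sum_{i,j=1}^m\langle f_i',g_j'\rangle\,\mathbb{E}\big[F_{x_i}G_{x_j}\big].$$
   Context: Setting: $(W_t)_{t\in[0,1]}$ is a Brownian motion on $(\Omega,\mathcal{F},P)$, where $\mathcal{F}$ is generated by $W$ and completed by null sets. $L^2=L^2([0,1];\mathbb{R})$ has norm $\|\cdot\|$ and inner product $\langle\cdot,\cdot\rangle$; $L^2(\Omega)=L^2(\Omega,\mathcal{F},P)$. For $f\in L^2$, $I(f)=\int_0^1 f(s)\,dW_s$ is the Wiener integral. "$f'\in BV$" means: $f\in L^2$ is differentiable on $[0,1]$ and $f':[0,1]\to\mathbb{R}$ is of bounded variation. Optimal approximation: for $X\in L^2(\Omega)$, $\widehat{X}^n:=\mathbb{E}[X\mid W_{1/n},W_{2/n},\ldots,W_1]$. Wick exponential: $e^{\diamond I(g)}:=\exp(I(g)-\|g\|^2/2)$, $g\in L^2$. Wick product: $X\diamond Y$ is the element of $L^2(\Omega)$ (when it exists) with $\mathbb{E}[(X\diamond Y)e^{\diamond I(g)}]=\mathbb{E}[Xe^{\diamond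 I(g)}]\,\mathbb{E}[Ye^{\diamond I(g)}]$ for all $g\in L^2$ (these values determine an element of $L^2(\Omega)$). $X^{\diamond k}$ is the $k$-fold Wick power, $X^{\diamond0}=1$; one has $I(f)^{\diamond k}=h^k_{\|f\|^2}(I(f))$ with $h^k_{\|f\|^2}$ the monic Hermite polynomial of degree $k$ with variance parameter $\|f\|^2$. Wick-analytic functionals: the class $\mathcal{WA}\subset L^2(\Omega)$ consists of all $F(I(f_1),\ldots,I(f_K))=\big(\sum_{k\ge0}a_{1,k}I(f_1)^{\diamond k}\big)\diamond\cdots\diamond\big(\sum_{k\ge0}a_{K,k}I(f_K)^{\diamond k}\big)$ with $K\in\mathbb{N}$, $f_1,\ldots,f_K\in L^2$, and real coefficients with $\sup\{\sqrt[k]{k!\,|a_{i,k}|}:i\le K,k\ge1\}<\infty$. Derivatives: $F_{x_k}:=\frac{\partial}{\partial x_k}F$ is the partial derivative with respect to the $k$-th argument, evaluated at $(I(f_1),\ldots,I(f_m))$. By the derivative rule for Hermite polynomials it is obtained by replacing, in the Wick product defining $F$, the $k$-th factor $\sum_{l\ge0}a_{k,l}I(f_k)^{\diamond l}$ by $\sum_{l\ge0}(l+1)a_{k,l+1}I(f_k)^{\diamond l}$; it is again in $\mathcal{WA}$. Likewise for $G_{x_j}$. *)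

theory Defs
  imports "HOL-Probability.Probability"
begin

text \<open>
  Elements of \<open>L\<^sup>2\<close> spaces are represented by functions, i.e. by representatives of their classes
  modulo almost-everywhere equality. Objects that are only determined up to null sets (Wiener
  integrals, Wick products, \<open>L\<^sup>2\<close> limits of series) are chosen with Hilbert's \<open>SOME\<close>; everything
  below depends on the chosen representatives only through integrals, \<open>L\<^sup>2\<close> limits and conditional
  expectations. Functions on \<open>[0,1]\<close> are total functions on the reals whose values outside
  \<open>{0..1}\<close> are irrelevant.
\<close>

definition L2_space :: "'a measure \<Rightarrow> ('a \<Rightarrow> real) set" where
  "L2_space M = {X \<in> borel_measurable M. integrable M (\<lambda>x. (X x)\<^sup>2)}"

definition L2_tendsto :: "'a measure \<Rightarrow> (nat \<Rightarrow> 'a \<Rightarrow> real) \<Rightarrow> ('a \<Rightarrow> real) \<Rightarrow> bool" where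
  "L2_tendsto M Xs X \<longleftrightarrow> (\<forall>n. Xs n \<in> L2_space M) \<and> X \<in> L2_space M \<and>
     (\<lambda>n. \<integral>x. (Xs n x - X x)\<^sup>2 \<partial>M) \<longlonglongrightarrow> 0"

abbreviation unit_interval_measure :: "real measure" where
  "unit_interval_measure \<equiv> lebesgue_on {0..1}"

abbreviation L2_01 :: "(real \<Rightarrow> real) set" where
  "L2_01 \<equiv> L2_space unit_interval_measure"

definition inner_01 :: "(real \<Rightarrow> real) \<Rightarrow> (real \<Rightarrow> real) \<Rightarrow> real" where
  "inner_01 f g = (\<integral>s. f s * g s \<partial>unit_interval_measure)"

definition bounded_variation_01 :: "(real \<Rightarrow> real) \<Rightarrow> bool" where
  "bounded_variation_01 h \<longleftrightarrow>
     (\<exists>B. \<forall>n (t :: nat \<Rightarrow> real). 0 \<le> t 0 \<longrightarrow> t n \<le> 1 \<longrightarrow> (\<forall>i<n. t i \<le> t (Suc i)) \<longrightarrow>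
        (\<Sum>i<n. \<bar>h (t (Suc i)) - h (t i)\<bar>) \<le> B)"

text \<open>\<open>f'\<close> is the (at the end points one-sided) derivative of \<open>f\<close> on \<open>[0,1]\<close>, and it is in \<open>BV\<close>.\<close>

definition has_BV_derivative :: "(real \<Rightarrow> real) \<Rightarrow> (real \<Rightarrow> real) \<Rightarrow> bool" where
  "has_BV_derivative f f' \<longleftrightarrow> f \<in> L2_01 \<and>
     (\<forall>x\<in>{0..1}. (f has_real_derivative f' x) (at x within {0..1})) \<and>
     bounded_variation_01 f'"

definition sigma_gen_by :: "'a measure \<Rightarrow> (real \<Rightarrow> 'a \<Rightarrow> real) \<Rightarrow> real set \<Rightarrow> 'a measure" where
  "sigma_gen_by M W T = sigma (space M) (\<Union>t\<in>T. {W t -` A \<inter> space M | A. A \<in> sets borel})"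

text \<open>
  Standard Brownian motion on \<open>[0,1]\<close>; the last conjunct says that the \<open>\<sigma>\<close>-algebra of the
  probability space is generated by the Brownian motion and completed by null sets.
\<close>

definition brownian_motion :: "'a measure \<Rightarrow> (real \<Rightarrow> 'a \<Rightarrow> real) \<Rightarrow> bool" where
  "brownian_motion M W \<longleftrightarrow> prob_space M \<and>
     (\<forall>t\<in>{0..1}. W t \<in> borel_measurable M) \<and>
     (AE \<omega> in M. W 0 \<omega> = 0) \<and>
     (AE \<omega> in M. continuous_on {0..1} (\<lambda>t. W t \<omega>)) \<and>
     (\<forall>s t. 0 \<le> s \<longrightarrow> s < t \<longrightarrow> t \<le> 1 \<longrightarrow>
        distributed M lborel (\<lambda>\<omega>. W t \<omega> - W s \<omega>) (normal_density 0 (sqrt (t - s)))) \<and>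
     (\<forall>n (t :: nat \<Rightarrow> real). 0 \<le> t 0 \<longrightarrow> t n \<le> 1 \<longrightarrow> (\<forall>i<n. t i \<le> t (Suc i)) \<longrightarrow>
        prob_space.indep_vars M (\<lambda>_. borel) (\<lambda>i \<omega>. W (t (Suc i)) \<omega> - W (t i) \<omega>) {..<n}) \<and>
     sets M = sets (completion (restr_to_subalg M (sigma_gen_by M W {0..1})))"

text \<open>
  The list \<open>[(c\<^sub>1, a\<^sub>1, b\<^sub>1), \<dots>]\<close> encodes the step function with value \<open>c\<^sub>i\<close> on \<open>(a\<^sub>i, b\<^sub>i]\<close>
  (values add up where the intervals overlap). The Wiener integral is the \<open>L\<^sup>2\<close> extension of the
  elementary integral of step functions.
\<close>

definition is_step :: "(real \<times> real \<times> real) list \<Rightarrow> bool" where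
  "is_step ps \<longleftrightarrow> (\<forall>(c, a, b)\<in>set ps. 0 \<le> a \<and> a \<le> b \<and> b \<le> 1)"

definition step_fun :: "(real \<times> real \<times> real) list \<Rightarrow> real \<Rightarrow> real" where
  "step_fun ps s = (\<Sum>(c, a, b)\<leftarrow>ps. c * indicator {a<..b} s)"

definition step_integral ::
    "(real \<Rightarrow> 'a \<Rightarrow> real) \<Rightarrow> (real \<times> real \<times> real) list \<Rightarrow> 'a \<Rightarrow> real" where
  "step_integral W ps \<omega> = (\<Sum>(c, a, b)\<leftarrow>ps. c * (W b \<omega> - W a \<omega>))"

definition wiener_integral ::
    "'a measure \<Rightarrow> (real \<Rightarrow> 'a \<Rightarrow> real) \<Rightarrow> (real \<Rightarrow> real) \<Rightarrow> 'a \<Rightarrow> real" where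
  "wiener_integral M W f = (SOME X. \<exists>p. (\<forall>n. is_step (p n)) \<and>
     L2_tendsto unit_interval_measure (\<lambda>n. step_fun (p n)) f \<and>
     L2_tendsto M (\<lambda>n. step_integral W (p n)) X)"

definition wick_exp ::
    "'a measure \<Rightarrow> (real \<Rightarrow> 'a \<Rightarrow> real) \<Rightarrow> (real \<Rightarrow> real) \<Rightarrow> 'a \<Rightarrow> real" where
  "wick_exp M W g \<omega> = exp (wiener_integral M W g \<omega> - inner_01 g g / 2)"

definition is_wick_prod ::
    "'a measure \<Rightarrow> (real \<Rightarrow> 'a \<Rightarrow> real) \<Rightarrow> ('a \<Rightarrow> real) \<Rightarrow> ('a \<Rightarrow> real) \<Rightarrow> ('a \<Rightarrow> real) \<Rightarrow> bool" where
  "is_wick_prod M W X Y Z \<longleftrightarrow> Z \<in> L2_space M \<and>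
     (\<forall>g\<in>L2_01. (\<integral>\<omega>. Z \<omega> * wick_exp M W g \<omega> \<partial>M) =
        (\<integral>\<omega>. X \<omega> * wick_exp M W g \<omega> \<partial>M) * (\<integral>\<omega>. Y \<omega> * wick_exp M W g \<omega> \<partial>M))"

definition wick_prod ::
    "'a measure \<Rightarrow> (real \<Rightarrow> 'a \<Rightarrow> real) \<Rightarrow> ('a \<Rightarrow> real) \<Rightarrow> ('a \<Rightarrow> real) \<Rightarrow> 'a \<Rightarrow> real" where
  "wick_prod M W X Y = (SOME Z. is_wick_prod M W X Y Z)"

primrec wick_power ::
    "'a measure \<Rightarrow> (real \<Rightarrow> 'a \<Rightarrow> real) \<Rightarrow> ('a \<Rightarrow> real) \<Rightarrow> nat \<Rightarrow> 'a \<Rightarrow> real" where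
  "wick_power M W X 0 = (\<lambda>_. 1)"
| "wick_power M W X (Suc k) = wick_prod M W (wick_power M W X k) X"

text \<open>\<open>X 1 \<diamond> \<cdots> \<diamond> X K\<close>\<close>

primrec wick_prod_upto ::
    "'a measure \<Rightarrow> (real \<Rightarrow> 'a \<Rightarrow> real) \<Rightarrow> (nat \<Rightarrow> 'a \<Rightarrow> real) \<Rightarrow> nat \<Rightarrow> 'a \<Rightarrow> real" where
  "wick_prod_upto M W X 0 = (\<lambda>_. 1)"
| "wick_prod_upto M W X (Suc K) = wick_prod M W (wick_prod_upto M W X K) (X (Suc K))"

text \<open>The sum \<open>\<Sum>k. c k \<cdot> I(f)\<^sup>\<diamond>\<^sup>k\<close>, the series converging in \<open>L\<^sup>2\<close>.\<close>

definition wick_series ::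
    "'a measure \<Rightarrow> (real \<Rightarrow> 'a \<Rightarrow> real) \<Rightarrow> (nat \<Rightarrow> real) \<Rightarrow> (real \<Rightarrow> real) \<Rightarrow> 'a \<Rightarrow> real" where
  "wick_series M W c f = (SOME X. L2_tendsto M
     (\<lambda>n \<omega>. \<Sum>k<n. c k * wick_power M W (wiener_integral M W f) k \<omega>) X)"

text \<open>
  A Wick-analytic functional is given by \<open>K\<close> functions \<open>f 1, \<dots>, f K\<close> in \<open>L\<^sup>2\<close> and coefficients
  \<open>a i k\<close> subject to the following growth condition.
\<close>

definition wick_analytic_coeffs :: "nat \<Rightarrow> (nat \<Rightarrow> nat \<Rightarrow> real) \<Rightarrow> bool" where
  "wick_analytic_coeffs K a \<longleftrightarrow>
     bdd_above {root k (fact k * \<bar>a i k\<bar>) | i k. i \<in> {1..K} \<and> 1 \<le> k}"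

definition wick_analytic ::
    "'a measure \<Rightarrow> (real \<Rightarrow> 'a \<Rightarrow> real) \<Rightarrow> nat \<Rightarrow> (nat \<Rightarrow> nat \<Rightarrow> real) \<Rightarrow> (nat \<Rightarrow> real \<Rightarrow> real)
      \<Rightarrow> 'a \<Rightarrow> real" where
  "wick_analytic M W K a f = wick_prod_upto M W (\<lambda>i. wick_series M W (a i) (f i)) K"

text \<open>
  The partial derivative with respect to the \<open>j\<close>-th argument differentiates the \<open>j\<close>-th factor
  termwise, using that the derivative of \<open>x\<^sup>\<diamond>\<^sup>(\<^sup>l\<^sup>+\<^sup>1\<^sup>)\<close> is \<open>(l + 1) x\<^sup>\<diamond>\<^sup>l\<close> (derivative rule for Hermite
  polynomials).
\<close>

definition wick_analytic_partial ::
    "'a measure \<Rightarrow> (real \<Rightarrow> 'a \<Rightarrow> real) \<Rightarrow> nat \<Rightarrow> (nat \<Rightarrow> nat \<Rightarrow> real) \<Rightarrow> (nat \<Rightarrow> real \<Rightarrow> real)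
      \<Rightarrow> nat \<Rightarrow> 'a \<Rightarrow> real" where
  "wick_analytic_partial M W K a f j =
     wick_analytic M W K (a(j := (\<lambda>l. real (l + 1) * a j (l + 1)))) f"

text \<open>\<open>E[X | W(1/n), W(2/n), \<dots>, W(1)]\<close>\<close>

definition grid_approx ::
    "'a measure \<Rightarrow> (real \<Rightarrow> 'a \<Rightarrow> real) \<Rightarrow> nat \<Rightarrow> ('a \<Rightarrow> real) \<Rightarrow> 'a \<Rightarrow> real" where
  "grid_approx M W n X =
     real_cond_exp M (sigma_gen_by M W ((\<lambda>k. real k / real n) ` {1..n})) X"

end

theory Submission
  imports Defs "HOL-Complex_Analysis.Complex_Analysis"
begin

text \<open>
  A Wick-analytic functional is a mixture of complex Wick exponentials. By the growth condition on
  the coefficients, the Borel transform \<open>B\<^sub>i(z) = \<Sum>k. a i k k! z\<^sup>-\<^sup>k\<close> converges on a circle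
  \<open>|z| = R\<close>, and averaging \<open>B\<^sub>i(z) exp (z x)\<close> over the circle gives \<open>\<Sum>k. a i k x\<^sup>k\<close>. Hence the average
  of \<open>\<Prod>\<^sub>i B\<^sub>i(z\<^sub>i)\<close> times the Wick exponential of \<open>\<Sum>\<^sub>i z\<^sub>i I(f\<^sub>i)\<close> over a torus has the S-transform
  that defines \<open>F\<close>; as S-transforms determine elements of \<open>L\<^sup>2\<close>, the average is \<open>F\<close>.
  Multiplying the weight by \<open>z\<^sub>j\<close> gives \<open>F\<^sub>x\<^sub>j\<close>, and replacing each \<open>f\<^sub>i\<close> by its average \<open>f\<^sub>i\<^sup>n\<close>
  over the cells of the grid gives the conditional expectation. Since
  \<open>E (exp\<^sup>\<diamond> I(u) exp\<^sup>\<diamond> I(v)) = exp \<langle>u, v\<rangle>\<close>, the error is the average of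
  \<open>exp (\<Sum>\<^sub>i\<^sub>j z\<^sub>i w\<^sub>j \<langle>f\<^sub>i, g\<^sub>j\<rangle>) - exp (\<Sum>\<^sub>i\<^sub>j z\<^sub>i w\<^sub>j \<langle>f\<^sub>i\<^sup>n, g\<^sub>j\<^sup>n\<rangle>)\<close> over two tori, and the
  limit follows by dominated convergence from
  \<open>n\<^sup>2 (\<langle>f, g\<rangle> - \<langle>f\<^sup>n, g\<^sup>n\<rangle>) \<longlonglongrightarrow> \<langle>f', g'\<rangle> / 12\<close>, which is a computation on each cell.
\<close>

subsection \<open>Uniqueness of Laplace transforms\<close>

text \<open>The Wick operations are picked by \<open>SOME\<close>, and an S-transform identifies an
  element of L^2 without producing one. Mixtures close this gap: they are explicit functions
  dominated by finitely many exponentials of Wiener integrals, hence in L^2. They witness that Wick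
  products and powers exist, control the tails of the Wick series, and are measurable for the grid
  once the f_i are averaged. The growth condition says k! |a i k| \<le> C^k, so every large radius
  works and one R serves both F and G. On a circle the weights are bounded, which justifies the
  exchanges of integrals. Averaging is an orthogonal projection, so only two of the four
  expectations in the error differ. The first-order expansion of the exponential brings down \<Sum>
  z_i w_j \<langle>f_i', g_j'\<rangle> / 12, and z_i, w_j turn the weights of F, G into those of the
  partial derivatives. The 1/12 is the variance of the uniform distribution on the unit interval: f
  and g are nearly affine on a cell, and their covariance there is the error. Bounded variation
  bounds the sum over the cells of the oscillations of the derivatives, uniformly in n.\<close>

lemma exp_abs_le: "exp (c * \<bar>x\<bar>) \<le> exp (c * x) + exp (- c * (x::real))"
  by (cases "x \<ge> 0") (auto simp: abs_if intro: add_increasing add_increasing2)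

lemma UN_ball_0_UNIV: "(\<Union>r. ball (0::complex) r) = UNIV"
  by (auto intro: gt_ex)

text \<open>The function exp (c |X|) |Y| is integrable for every c and dominates the partial sums of
  the exponential series. Integrating termwise gives one power series that converges in the whole
  plane. Holomorphy serves analytic continuation; the coefficients later yield a derivative at
  0.\<close>

lemma
  fixes X :: "'a \<Rightarrow> real" and Y :: "'a \<Rightarrow> complex"
  assumes [measurable]: "X \<in> borel_measurable M" "Y \<in> borel_measurable M"
    and int: "\<And>c::real. integrable M (\<lambda>\<omega>. exp (c * X \<omega>) *\<^sub>R Y \<omega>)"
  shows laplace_sums: "\<And>z. (\<lambda>i. (\<integral>\<omega>. of_real (X \<omega>) ^ i / fact i * Y \<omega> \<partial>M) * z ^ i)
      sums (\<integral>\<omega>. exp (z * of_real (X \<omega>)) * Y \<omega> \<partial>M)"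
    and holomorphic_laplace: "(\<lambda>z. \<integral>\<omega>. exp (z * of_real (X \<omega>)) * Y \<omega> \<partial>M) holomorphic_on UNIV"
proof -
  have dom: "integrable M (\<lambda>\<omega>. exp (c * \<bar>X \<omega>\<bar>) * norm (Y \<omega>))" for c
  proof (rule Bochner_Integration.integrable_bound)
    show "integrable M (\<lambda>\<omega>. norm (exp (c * X \<omega>) *\<^sub>R Y \<omega>) + norm (exp ((- c) * X \<omega>) *\<^sub>R Y \<omega>))"
      by (intro Bochner_Integration.integrable_add integrable_norm int)
    show "AE \<omega> in M. norm (exp (c * \<bar>X \<omega>\<bar>) * norm (Y \<omega>))
        \<le> norm (norm (exp (c * X \<omega>) *\<^sub>R Y \<omega>) + norm (exp ((- c) * X \<omega>) *\<^sub>R Y \<omega>))"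
      using exp_abs_le[of c] mult_right_mono[OF exp_abs_le[of c]]
      by (intro AE_I2) (auto simp: abs_mult distrib_right[symmetric])
  qed measurable
  have int_exp: "integrable M (\<lambda>\<omega>. exp (z * of_real (X \<omega>)) * Y \<omega>)" for z
  proof (rule Bochner_Integration.integrable_bound[OF dom[of "norm z"]])
    show "AE \<omega> in M. norm (exp (z * of_real (X \<omega>)) * Y \<omega>)
        \<le> norm (exp (norm z * \<bar>X \<omega>\<bar>) * norm (Y \<omega>))"
    proof (rule AE_I2)
      fix \<omega>
      have "norm (exp (z * of_real (X \<omega>))) \<le> exp (norm (z * of_real (X \<omega>)))"
        by (rule norm_exp)
      then show "norm (exp (z * of_real (X \<omega>)) * Y \<omega>) \<le> norm (exp (norm z * \<bar>X \<omega>\<bar>) * norm (Y \<omega>))"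
        by (simp add: norm_mult abs_mult mult_right_mono)
    qed
  qed measurable
  show sums: "(\<lambda>i. (\<integral>\<omega>. of_real (X \<omega>) ^ i / fact i * Y \<omega> \<partial>M) * z ^ i)
      sums (\<integral>\<omega>. exp (z * of_real (X \<omega>)) * Y \<omega> \<partial>M)" for z
  proof -
    define f where "f = (\<lambda>i \<omega>. (z * of_real (X \<omega>)) ^ i / fact i * Y \<omega>)"
    have [measurable]: "f i \<in> borel_measurable M" for i unfolding f_def by measurable
    have nf: "norm (f i \<omega>) = (norm z * \<bar>X \<omega>\<bar>) ^ i / fact i * norm (Y \<omega>)" for i \<omega>
      by (simp add: f_def norm_mult norm_divide norm_power)
    have snf: "(\<lambda>i. norm (f i \<omega>)) sums (exp (norm z * \<bar>X \<omega>\<bar>) * norm (Y \<omega>))" for \<omega>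
      unfolding nf using exp_converges[of "norm z * \<bar>X \<omega>\<bar>"]
      by (intro sums_mult2) (simp add: divide_inverse mult.commute)
    have le: "(\<Sum>i<n. norm (f i \<omega>)) \<le> exp (norm z * \<bar>X \<omega>\<bar>) * norm (Y \<omega>)" for n \<omega>
      using snf[of \<omega>] by (metis norm_ge_zero sum_le_suminf sums_iff finite_lessThan)
    have le1: "norm (f i \<omega>) \<le> exp (norm z * \<bar>X \<omega>\<bar>) * norm (Y \<omega>)" for i \<omega>
    proof -
      have "norm (f i \<omega>) \<le> (\<Sum>i<Suc i. norm (f i \<omega>))" by (simp add: sum_nonneg)
      then show ?thesis using le[where n="Suc i" and \<omega>=\<omega>] by linarith
    qed
    have intf: "integrable M (f i)" for i
      by (rule Bochner_Integration.integrable_bound[OF dom[of "norm z"]])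
        (use le1[of i] in \<open>auto simp: abs_mult\<close>)
    have "(\<lambda>i. integral\<^sup>L M (f i)) sums (\<integral>\<omega>. (\<Sum>i. f i \<omega>) \<partial>M)"
    proof (rule sums_integral[OF intf])
      show "AE \<omega> in M. summable (\<lambda>i. norm (f i \<omega>))" using snf by (auto simp: sums_iff)
      show "summable (\<lambda>i. \<integral>\<omega>. norm (f i \<omega>) \<partial>M)"
      proof (rule summableI_nonneg_bounded)
        fix n
        have "(\<Sum>i<n. \<integral>\<omega>. norm (f i \<omega>) \<partial>M) = (\<integral>\<omega>. (\<Sum>i<n. norm (f i \<omega>)) \<partial>M)"
          by (subst Bochner_Integration.integral_sum) (auto intro: integrable_norm intf)
        also have "\<dots> \<le> (\<integral>\<omega>. exp (norm z * \<bar>X \<omega>\<bar>) * norm (Y \<omega>) \<partial>M)"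
          by (intro integral_mono Bochner_Integration.integrable_sum integrable_norm intf dom le)
        finally show "(\<Sum>i<n. \<integral>\<omega>. norm (f i \<omega>) \<partial>M) \<le> \<dots>" .
      qed auto
    qed
    moreover have "(\<Sum>i. f i \<omega>) = exp (z * of_real (X \<omega>)) * Y \<omega>" for \<omega>
      unfolding f_def using exp_converges[of "z * of_real (X \<omega>)"]
      by (intro sums_unique[symmetric] sums_mult2) (simp add: scaleR_conv_of_real divide_inverse
        mult.commute)
    moreover have "integral\<^sup>L M (f i) = (\<integral>\<omega>. of_real (X \<omega>) ^ i / fact i * Y \<omega> \<partial>M) * z ^ i" for i
      unfolding f_def
      by (subst integral_mult_left_zero[symmetric]) (simp add: power_mult_distrib mult_ac)
    ultimately show ?thesis by simp
  qed
  have "(\<lambda>z. \<integral>\<omega>. exp (z * of_real (X \<omega>)) * Y \<omega> \<partial>M) holomorphic_on ball 0 r" for r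
    by (rule power_series_holomorphic[where a="\<lambda>i. \<integral>\<omega>. of_real (X \<omega>) ^ i / fact i * Y \<omega> \<partial>M"])
       (simp only: diff_0_right sums)
  then show "(\<lambda>z. \<integral>\<omega>. exp (z * of_real (X \<omega>)) * Y \<omega> \<partial>M) holomorphic_on UNIV"
    using holomorphic_on_UN_open[where I=UNIV and A="\<lambda>r. ball 0 r"] by (simp add: UN_ball_0_UNIV)
qed

lemma entire_eq_on_Reals:
  assumes "f holomorphic_on UNIV" "g holomorphic_on UNIV" "\<And>x::real. f (of_real x) = g (of_real x)"
  shows "f z = g z"
proof -
  have "f z - g z = 0"
  proof (rule analytic_continuation[where f="\<lambda>z. f z - g z" and w=z and S=UNIV and U=\<real> and \<xi>=0])
    show "(\<lambda>z. f z - g z) holomorphic_on UNIV" using assms by (intro holomorphic_intros)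
    show "(0::complex) islimpt \<real>"
    proof (rule islimpt_sequential[THEN iffD2], intro exI conjI allI)
      show "(\<lambda>n. of_real (1 / real (Suc n)) :: complex) \<longlonglongrightarrow> 0"
        using lim_inverse_n' LIMSEQ_Suc by (intro tendsto_of_real[where a=0, simplified]) blast
    qed (auto simp del: of_nat_Suc)
  qed (use assms(3) in \<open>auto elim!: Reals_cases\<close>)
  then show ?thesis by simp
qed

text \<open>By analytic continuation the Fourier transforms of the images under \<open>X\<close> of the measures with
  densities \<open>max 0 Y\<close> and \<open>max 0 (- Y)\<close> agree.\<close>

lemma laplace_unique:
  fixes X Y :: "'a \<Rightarrow> real"
  assumes [measurable]: "X \<in> borel_measurable M" "Y \<in> borel_measurable M" "A \<in> sets borel"
    and int: "\<And>c::real. integrable M (\<lambda>\<omega>. exp (c * X \<omega>) * Y \<omega>)"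
    and zero: "\<And>c::real. (\<integral>\<omega>. exp (c * X \<omega>) * Y \<omega> \<partial>M) = 0"
  shows "(\<integral>\<omega>. indicator A (X \<omega>) * Y \<omega> \<partial>M) = 0"
proof -
  have int': "integrable M (\<lambda>\<omega>. exp (c * X \<omega>) *\<^sub>R complex_of_real (Y \<omega>))" for c
    using int[of c] unfolding scaleR_conv_of_real of_real_mult[symmetric]
      by (rule integrable_of_real)
  have phi0: "(\<integral>\<omega>. exp (z * of_real (X \<omega>)) * of_real (Y \<omega>) \<partial>M) = 0" for z :: complex
  proof (rule entire_eq_on_Reals[where g="\<lambda>_. 0" and z=z and f="\<lambda>z. \<integral>\<omega>. exp (z * of_real (X \<omega>))
    * of_real (Y \<omega>) \<partial>M"])
    show "(\<lambda>z. \<integral>\<omega>. exp (z * of_real (X \<omega>)) * of_real (Y \<omega>) \<partial>M) holomorphic_on UNIV"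
      by (rule holomorphic_laplace) (use int' in auto)
    fix x :: real
    have "(\<integral>\<omega>. exp (of_real x * of_real (X \<omega>)) * of_real (Y \<omega>) \<partial>M)
       = (\<integral>\<omega>. complex_of_real (exp (x * X \<omega>) * Y \<omega>) \<partial>M)"
      by (simp add: exp_of_real[symmetric])
    then show "(\<integral>\<omega>. exp (of_real x * of_real (X \<omega>)) * of_real (Y \<omega>) \<partial>M) = (0::complex)"
      using zero[of x] by (simp only: integral_complex_of_real of_real_0)
  qed auto
  define Yp where "Yp = (\<lambda>\<omega>. max 0 (Y \<omega>))"
  define Yn where "Yn = (\<lambda>\<omega>. max 0 (- Y \<omega>))"
  have [measurable]: "Yp \<in> borel_measurable M" "Yn \<in> borel_measurable M"
    unfolding Yp_def Yn_def by measurable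
  have Yeq: "Y \<omega> = Yp \<omega> - Yn \<omega>" for \<omega> by (auto simp: Yp_def Yn_def)
  have nn: "Yp \<omega> \<ge> 0" "Yn \<omega> \<ge> 0" for \<omega> by (auto simp: Yp_def Yn_def)
  have intY: "integrable M Y" using int[of 0] by simp
  have ip: "integrable M Yp" "integrable M Yn"
    unfolding Yp_def Yn_def using intY by (auto intro: integrable_max)
  define c where "c = integral\<^sup>L M Yp"
  have "integral\<^sup>L M Y = 0" using zero[of 0] by simp
  moreover have "integral\<^sup>L M Y = (\<integral>\<omega>. Yp \<omega> - Yn \<omega> \<partial>M)"
    by (rule Bochner_Integration.integral_cong) (simp_all add: Yeq)
  ultimately have c': "c = integral\<^sup>L M Yn" unfolding c_def using ip by simp
  show ?thesis
  \<comment> \<open>\<open>Levy_uniqueness\<close> compares probability distributions, so both parts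
    are divided by their common mass \<open>c\<close>. If that mass is 0, then \<open>Y\<close>
    vanishes almost everywhere.\<close>
  proof (cases "c = 0")
    case True
    then have "AE \<omega> in M. Yp \<omega> = 0" "AE \<omega> in M. Yn \<omega> = 0"
      using integral_nonneg_eq_0_iff_AE[OF ip(1) AE_I2[OF nn(1)]]
        integral_nonneg_eq_0_iff_AE[OF ip(2) AE_I2[OF nn(2)]] c_def c' by simp_all
    then have "AE \<omega> in M. indicator A (X \<omega>) * Y \<omega> = 0"
      by eventually_elim (simp add: Yeq)
    then show ?thesis by (rule integral_eq_zero_AE)
  next
    case False
    moreover have "c \<ge> 0" unfolding c_def using nn by (intro Bochner_Integration.integral_nonneg)
    ultimately have c: "c > 0" by simp
    define \<mu> where "\<mu> = (\<lambda>Z. distr (density M (\<lambda>\<omega>. ennreal (Z \<omega> / c))) borel X)"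
    { fix Z assume Z: "Z = Yp \<or> Z = Yn"
      then have [measurable]: "Z \<in> borel_measurable M" and iZ: "integrable M Z"
          and nZ: "\<And>\<omega>. Z \<omega> \<ge> 0"
        and cZ: "integral\<^sup>L M Z = c" using nn ip c' c_def by auto
      have "emeasure (density M (\<lambda>\<omega>. ennreal (Z \<omega> / c))) (space M) = (\<integral>\<^sup>+\<omega>. ennreal (Z \<omega> / c) \<partial>M)"
        by (subst emeasure_density) (auto intro!: nn_integral_cong)
      also have "\<dots> = ennreal (\<integral>\<omega>. Z \<omega> / c \<partial>M)"
        using iZ nZ c by (intro nn_integral_eq_integral) auto
      also have "\<dots> = 1" using cZ c iZ by simp
      finally have "prob_space (density M (\<lambda>\<omega>. ennreal (Z \<omega> / c)))"
        by (intro prob_spaceI) simp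
      then have rd: "real_distribution (\<mu> Z)"
        unfolding \<mu>_def by (intro prob_space.real_distribution_distr) simp_all
      have ch: "char (\<mu> Z) t = (\<integral>\<omega>. exp (\<i> * of_real t * of_real (X \<omega>)) * of_real (Z \<omega>) \<partial>M) / c"
          for t
      proof -
        have "char (\<mu> Z) t = (\<integral>\<omega>. iexp (t * X \<omega>) \<partial>density M (\<lambda>\<omega>. ennreal (Z \<omega> / c)))"
          unfolding char_def \<mu>_def by (subst integral_distr) simp_all
        also have "\<dots> = (\<integral>\<omega>. (Z \<omega> / c) *\<^sub>R iexp (t * X \<omega>) \<partial>M)"
          using nZ c by (subst integral_density) auto
        also have "\<dots> = (\<integral>\<omega>. exp (\<i> * of_real t * of_real (X \<omega>)) * of_real (Z \<omega>) / c \<partial>M)"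
          by (intro Bochner_Integration.integral_cong) (auto simp: scaleR_conv_of_real mult_ac)
        finally show ?thesis by simp
      qed
      have em: "measure (\<mu> Z) A = (\<integral>\<omega>. indicator A (X \<omega>) * Z \<omega> \<partial>M) / c"
      proof -
        have "measure (\<mu> Z) A = (\<integral>x. indicator A x \<partial>\<mu> Z)"
          by (simp add: \<mu>_def)
        also have "\<dots> = (\<integral>\<omega>. indicator A (X \<omega>) \<partial>density M (\<lambda>\<omega>. ennreal (Z \<omega> / c)))"
          unfolding \<mu>_def by (subst integral_distr) simp_all
        also have "\<dots> = (\<integral>\<omega>. (Z \<omega> / c) *\<^sub>R indicator A (X \<omega>) \<partial>M)"
          using nZ c by (subst integral_density) auto
        also have "\<dots> = (\<integral>\<omega>. indicator A (X \<omega>) * Z \<omega> / c \<partial>M)"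
          by (intro Bochner_Integration.integral_cong) auto
        finally show ?thesis by simp
      qed
      have i1: "integrable M (\<lambda>\<omega>. indicator A (X \<omega>) * Z \<omega>)"
        by (rule Bochner_Integration.integrable_bound[OF iZ]) (auto simp: indicator_def)
      have i2: "integrable M (\<lambda>\<omega>. exp (\<i> * of_real t * of_real (X \<omega>)) * of_real (Z \<omega>))"
          for t :: real
        by (rule Bochner_Integration.integrable_bound[OF iZ]) (auto simp: norm_mult)
      note rd ch em i1 i2 }
    note * = this
    have "char (\<mu> Yp) t = char (\<mu> Yn) t" for t
    proof -
      have "(\<integral>\<omega>. exp (\<i> * of_real t * of_real (X \<omega>)) * of_real (Yp \<omega>) \<partial>M)
          - (\<integral>\<omega>. exp (\<i> * of_real t * of_real (X \<omega>)) * of_real (Yn \<omega>) \<partial>M)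
          = (\<integral>\<omega>. exp (\<i> * of_real t * of_real (X \<omega>)) * of_real (Y \<omega>) \<partial>M)"
        unfolding Yeq by (subst Bochner_Integration.integral_diff[symmetric])
          (use *(5) in \<open>auto simp: algebra_simps\<close>)
      then show ?thesis using phi0[of "\<i> * of_real t"] *(2)[of Yp] *(2)[of Yn] by simp
    qed
    then have "\<mu> Yp = \<mu> Yn" using *(1) by (intro Levy_uniqueness ext) auto
    then have eq: "(\<integral>\<omega>. indicator A (X \<omega>) * Yp \<omega> \<partial>M) = (\<integral>\<omega>. indicator A (X \<omega>) * Yn \<omega> \<partial>M)"
      using *(3)[of Yp] *(3)[of Yn] c by (simp add: divide_simps)
    have "(\<integral>\<omega>. indicator A (X \<omega>) * Y \<omega> \<partial>M) = (\<integral>\<omega>. indicator A (X \<omega>) * Yp \<omega> - indicator A (X \<omega>)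
        * Yn \<omega> \<partial>M)"
      unfolding Yeq by (simp add: algebra_simps)
    also have "\<dots> = 0" using eq *(4)[of Yp] *(4)[of Yn] by simp
    finally show ?thesis .
  qed
qed

text \<open>Coordinates are treated one at a time. With the coefficients of the others fixed, their
  exponential counts as part of the density, and the one-variable result replaces the exponential in
  \<open>V j\<close> by an indicator. That indicator is then absorbed into \<open>Y\<close>, which
  is why the induction needs \<open>Y\<close> arbitrary.\<close>

lemma laplace_unique_finite:
  fixes V :: "'i \<Rightarrow> 'a \<Rightarrow> real" and Y :: "'a \<Rightarrow> real"
  assumes "finite S" "\<And>s. s \<in> S \<Longrightarrow> V s \<in> borel_measurable M" "Y \<in> borel_measurable M"
    "\<And>s. s \<in> S \<Longrightarrow> A s \<in> sets borel"
    and "\<And>c. integrable M (\<lambda>\<omega>. exp (\<Sum>s\<in>S. c s * V s \<omega>) * Y \<omega>)"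
    and "\<And>c. (\<integral>\<omega>. exp (\<Sum>s\<in>S. c s * V s \<omega>) * Y \<omega> \<partial>M) = 0"
  shows "(\<integral>\<omega>. (\<Prod>s\<in>S. indicator (A s) (V s \<omega>)) * Y \<omega> \<partial>M) = 0"
  using assms
proof (induction S arbitrary: Y)
  case empty
  then show ?case by simp
next
  case (insert j S)
  have [measurable]: "s \<in> S \<Longrightarrow> V s \<in> borel_measurable M" "V j \<in> borel_measurable M"
      "A j \<in> sets borel"
     "Y \<in> borel_measurable M" for s using insert by auto
  have upd: "(\<Sum>s\<in>insert j S. (c(j := d)) s * V s \<omega>) = d * V j \<omega> + (\<Sum>s\<in>S. c s * V s \<omega>)" for c d \<omega>
    using insert.hyps by (auto intro!: sum.cong)
  define Y1 where "Y1 = (\<lambda>\<omega>. indicator (A j) (V j \<omega>) * Y \<omega>)"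
  have [measurable]: "Y1 \<in> borel_measurable M" unfolding Y1_def by measurable
  have "(\<integral>\<omega>. (\<Prod>s\<in>S. indicator (A s) (V s \<omega>)) * Y1 \<omega> \<partial>M) = 0"
  proof (rule insert.IH)
    fix c
    have 1: "integrable M (\<lambda>\<omega>. exp (d * V j \<omega>) * (exp (\<Sum>s\<in>S. c s * V s \<omega>) * Y \<omega>))" for d
      using insert.prems(4)[of "c(j := d)"] unfolding upd by (simp add: exp_add mult_ac)
    show "integrable M (\<lambda>\<omega>. exp (\<Sum>s\<in>S. c s * V s \<omega>) * Y1 \<omega>)"
      using 1[of 0] unfolding Y1_def
      by (rule Bochner_Integration.integrable_bound) (auto simp: indicator_def)
    have "(\<integral>\<omega>. indicator (A j) (V j \<omega>) * (exp (\<Sum>s\<in>S. c s * V s \<omega>) * Y \<omega>) \<partial>M) = 0"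
    proof (rule laplace_unique[OF _ _ _ 1])
      fix d
      show "(\<integral>\<omega>. exp (d * V j \<omega>) * (exp (\<Sum>s\<in>S. c s * V s \<omega>) * Y \<omega>) \<partial>M) = 0"
        using insert.prems(5)[of "c(j := d)"] unfolding upd by (simp add: exp_add mult_ac)
    qed measurable
    then show "(\<integral>\<omega>. exp (\<Sum>s\<in>S. c s * V s \<omega>) * Y1 \<omega> \<partial>M) = 0"
      by (simp add: Y1_def mult_ac)
  qed (use insert in auto)
  then show ?case using insert.hyps by (simp add: Y1_def mult_ac)
qed

section \<open>The sigma-algebra generated by a process\<close>

lemma space_sigma_gen_by [simp]: "space (sigma_gen_by M W T) = space M"
  unfolding sigma_gen_by_def by (rule space_measure_of) auto

lemma sets_sigma_gen_by:
  "sets (sigma_gen_by M W T)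
    = sigma_sets (space M) (\<Union>t\<in>T. {W t -` A \<inter> space M | A. A \<in> sets borel})"
  unfolding sigma_gen_by_def by (rule sets_measure_of) auto

lemma subalgebra_sigma_gen_by:
  assumes "\<And>t. t \<in> T \<Longrightarrow> W t \<in> borel_measurable M"
  shows "subalgebra M (sigma_gen_by M W T)"
  unfolding subalgebra_def sets_sigma_gen_by
  using assms by (auto intro!: sets.sigma_sets_subset simp: measurable_sets)

lemma measurable_sigma_gen_by: "t \<in> T \<Longrightarrow> W t \<in> borel_measurable (sigma_gen_by M W T)"
  by (rule measurableI) (auto simp: sets_sigma_gen_by intro!: sigma_sets.Basic)

text \<open>Cylinder sets over finitely many indices are an intersection-stable generator, and on
  them \<open>laplace_unique_finite\<close> applies. The sets over which \<open>Y\<close> integrates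
  to 0 are closed under complements, because S = {} makes the integral over the whole space vanish,
  and under countable disjoint unions.\<close>

lemma laplace_unique_sigma:
  fixes Y :: "'a \<Rightarrow> real"
  assumes W: "\<And>t. t \<in> T \<Longrightarrow> W t \<in> borel_measurable M" and Y: "integrable M Y"
    and int: "\<And>S c. finite S \<Longrightarrow> S \<subseteq> T \<Longrightarrow> integrable M (\<lambda>\<omega>. exp (\<Sum>s\<in>S. c s * W s \<omega>) * Y \<omega>)"
    and zero: "\<And>S c. finite S \<Longrightarrow> S \<subseteq> T \<Longrightarrow> (\<integral>\<omega>. exp (\<Sum>s\<in>S. c s * W s \<omega>) * Y \<omega> \<partial>M) = 0"
    and E: "E \<in> sets (sigma_gen_by M W T)"
  shows "(\<integral>\<omega>\<in>E. Y \<omega> \<partial>M) = 0"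
proof -
  define G where "G = {{\<omega>\<in>space M. \<forall>s\<in>S. W s \<omega> \<in> A s} | S A. finite S \<and> S \<subseteq> T
      \<and> (\<forall>s. A s \<in> sets (borel::real measure))}"
  have GM: "G \<subseteq> sets M"
  proof
    fix B assume "B \<in> G"
    then obtain S A where B: "B = {\<omega>\<in>space M. \<forall>s\<in>S. W s \<omega> \<in> A s}" "finite S" "S \<subseteq> T"
        "\<And>s. A s \<in> sets borel"
      unfolding G_def by auto
    have "{\<omega>\<in>space M. W s \<omega> \<in> A s} \<in> sets M" if "s \<in> S" for s
      using measurable_sets[OF W[of s] B(4)[of s]] B(3) that
        by (auto simp: vimage_def Int_def conj_commute)
    then show "B \<in> sets M" unfolding B(1) using B(2) by (intro sets.sets_Collect_finite_All) auto
  qed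
  have GP: "G \<subseteq> Pow (space M)" by (auto simp: G_def)
  have stable: "Int_stable G"
  proof (rule Int_stableI)
    fix B B' assume "B \<in> G" "B' \<in> G"
    then obtain S A S' A' where B: "B = {\<omega>\<in>space M. \<forall>s\<in>S. W s \<omega> \<in> A s}" "finite S" "S \<subseteq> T"
        "\<And>s. A s \<in> sets borel"
      and B': "B' = {\<omega>\<in>space M. \<forall>s\<in>S'. W s \<omega> \<in> A' s}" "finite S'" "S' \<subseteq> T" "\<And>s. A' s \<in> sets borel"
      unfolding G_def by auto
    \<comment> \<open>Both conditions are written over the common index set, with
      \<open>UNIV\<close> as the condition for an index missing from one of them.\<close>
    have "B \<inter> B' = {\<omega>\<in>space M. \<forall>s\<in>S \<union> S'. W s \<omega> \<in> (if s \<in> S then A s else UNIV) \<inter> (if s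
        \<in> S' then A' s else UNIV)}"
      unfolding B(1) B'(1) by auto
    then show "B \<inter> B' \<in> G" unfolding G_def using B(2-4) B'(2-4)
      by (intro CollectI exI[of _ "S \<union> S'"] exI[of _
        "\<lambda>s. (if s \<in> S then A s else UNIV) \<inter> (if s \<in> S' then A' s else UNIV)"]) auto
  qed
  have "E \<in> sigma_sets (space M) G"
  proof -
    have "(\<Union>t\<in>T. {W t -` A \<inter> space M | A. A \<in> sets borel}) \<subseteq> G"
    proof safe
      fix t A assume "t \<in> T" "A \<in> sets (borel::real measure)"
      then show "W t -` A \<inter> space M \<in> G" unfolding G_def
        by (intro CollectI exI[of _ "{t}"] exI[of _ "\<lambda>_. A"]) auto
    qed
    then show ?thesis using E sigma_sets_mono'[of _ G "space M"] unfolding sets_sigma_gen_by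
        by blast
  qed
  have sM: "sigma_sets (space M) G \<subseteq> sets M" using GM by (rule sets.sigma_sets_subset)
  have setint: "B \<in> sets M \<Longrightarrow> set_integrable M B Y" for B
    unfolding set_integrable_def using Y integrable_mult_indicator by blast
  show ?thesis
    using stable GP \<open>E \<in> sigma_sets (space M) G\<close>
  proof (induction rule: sigma_sets_induct_disjoint)
    case (basic B)
    then obtain S A where B: "B = {\<omega>\<in>space M. \<forall>s\<in>S. W s \<omega> \<in> A s}" "finite S" "S \<subseteq> T"
        "\<And>s. A s \<in> sets borel"
      unfolding G_def by auto
    have "(\<integral>\<omega>. (\<Prod>s\<in>S. indicator (A s) (W s \<omega>)) * Y \<omega> \<partial>M) = 0"
      using B W Y int zero by (intro laplace_unique_finite) auto
    moreover have "(\<Prod>s\<in>S. indicator (A s) (W s \<omega>)) = (indicator B \<omega> :: real)" if "\<omega> \<in> space M" for \<omega>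
      using that B(2) by (auto simp: B(1) indicator_def)
    ultimately show ?case unfolding set_lebesgue_integral_def
      by (simp cong: Bochner_Integration.integral_cong)
  next
    case empty
    show ?case by (simp add: set_lebesgue_integral_def)
  next
    case (compl B)
    have B: "B \<in> sets M" using compl sM by auto
    have "(\<integral>\<omega>\<in>space M. Y \<omega> \<partial>M) = (\<integral>\<omega>\<in>B. Y \<omega> \<partial>M) + (\<integral>\<omega>\<in>space M - B. Y \<omega> \<partial>M)"
      using B setint sets.sets_into_space[OF B]
      by (subst set_integral_Un[symmetric]) (auto simp: Un_absorb1)
    moreover have "(\<integral>\<omega>\<in>space M. Y \<omega> \<partial>M) = 0" using zero[of "{}"] Y by (simp add: set_integral_space)
    ultimately show ?case using compl by simp
  next
    case (union B)
    have B: "B i \<in> sets M" for i using union sM by auto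
    have "(\<integral>\<omega>\<in>(\<Union>i. B i). Y \<omega> \<partial>M) = (\<Sum>i. \<integral>\<omega>\<in>B i. Y \<omega> \<partial>M)"
      using B union by (intro lebesgue_integral_countable_add setint)
        (auto simp: disjoint_family_on_def)
    then show ?case using union by simp
  qed
qed

text \<open>Since M is a completion, each measurable set is a set of \<open>N\<close> up to a null
  set. Hence the integrals over {Y > 0} and {Y < 0} vanish too, although these sets need not belong
  to \<open>N\<close>.\<close>

lemma AE_zero_of_set_integral_zero:
  fixes Y :: "'a \<Rightarrow> real"
  assumes Y: "integrable M Y" and N: "subalgebra M N"
    and sets: "sets M = sets (completion (restr_to_subalg M N))"
    and zero: "\<And>E. E \<in> sets N \<Longrightarrow> (\<integral>\<omega>\<in>E. Y \<omega> \<partial>M) = 0"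
  shows "AE \<omega> in M. Y \<omega> = 0"
proof -
  have [measurable]: "Y \<in> borel_measurable M" using Y by auto
  have zero': "(\<integral>\<omega>\<in>E. Y \<omega> \<partial>M) = 0" if E: "E \<in> sets M" for E
  proof -
    from E obtain S P P' where S: "E = S \<union> P" "P \<subseteq> P'" "P' \<in> null_sets (restr_to_subalg M N)"
      "S \<in> sets (restr_to_subalg M N)"
      unfolding sets sets_completion by (rule completionE)
    have P': "P' \<in> null_sets M" using null_sets_restr_to_subalg[OF N] S(3) by auto
    have SN: "S \<in> sets N" using S(4) by (simp add: sets_restr_to_subalg[OF N])
    then have SM: "S \<in> sets M" using N by (auto simp: subalgebra_def)
    have "AE \<omega> in M. \<omega> \<notin> P'" using P' by (rule AE_not_in)
    then have "AE \<omega> in M. indicator E \<omega> *\<^sub>R Y \<omega> = indicator S \<omega> *\<^sub>R Y \<omega>"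
      by eventually_elim (use S in \<open>auto simp: indicator_def\<close>)
    then have "(\<integral>\<omega>\<in>E. Y \<omega> \<partial>M) = (\<integral>\<omega>\<in>S. Y \<omega> \<partial>M)"
      unfolding set_lebesgue_integral_def using E SM by (intro integral_cong_AE) auto
    then show ?thesis using zero[OF SN] by simp
  qed
  have half: "AE \<omega> in M. max 0 (Z \<omega>) = 0" if "Z = Y \<or> Z = (\<lambda>\<omega>. - Y \<omega>)" for Z
  proof -
    have [measurable]: "Z \<in> borel_measurable M" and iZ: "integrable M Z" using that Y by auto
    have E: "{\<omega>\<in>space M. Z \<omega> > 0} \<in> sets M" by measurable
    have "(\<integral>\<omega>\<in>{\<omega>\<in>space M. Z \<omega> > 0}. Z \<omega> \<partial>M) = 0"
      using that zero'[OF E] by (auto simp: set_lebesgue_integral_def)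
    moreover have "(\<integral>\<omega>\<in>{\<omega>\<in>space M. Z \<omega> > 0}. Z \<omega> \<partial>M) = (\<integral>\<omega>. max 0 (Z \<omega>) \<partial>M)"
      unfolding set_lebesgue_integral_def
        by (intro Bochner_Integration.integral_cong) (auto simp: indicator_def)
    ultimately show ?thesis
      using integral_nonneg_eq_0_iff_AE[of M "\<lambda>\<omega>. max 0 (Z \<omega>)"] iZ by (auto intro: integrable_max)
  qed
  have "AE \<omega> in M. max 0 (Y \<omega>) = 0" "AE \<omega> in M. max 0 (- Y \<omega>) = 0"
    using half by auto
  then show ?thesis by eventually_elim (auto simp: max_def split: if_splits)
qed

subsection \<open>Square integrable functions\<close>

lemma L2_spaceD: "X \<in> L2_space M \<Longrightarrow> X \<in> borel_measurable M"
    "X \<in> L2_space M \<Longrightarrow> integrable M (\<lambda>x. (X x)\<^sup>2)"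
  by (auto simp: L2_space_def)

lemma L2_mult_integrable:
  assumes "X \<in> L2_space M" "Y \<in> L2_space M"
  shows "integrable M (\<lambda>x. X x * Y x)"
proof (rule Bochner_Integration.integrable_bound)
  note [measurable] = L2_spaceD(1)[OF assms(1)] L2_spaceD(1)[OF assms(2)]
  show "integrable M (\<lambda>x. (X x)\<^sup>2 + (Y x)\<^sup>2)" using assms by (auto simp: L2_space_def)
  show "(\<lambda>x. X x * Y x) \<in> borel_measurable M" by measurable
  have "\<bar>x * y\<bar> \<le> x\<^sup>2 + y\<^sup>2" for x y :: real
    using sum_squares_bound[of "\<bar>x\<bar>" "\<bar>y\<bar>"] mult_nonneg_nonneg[of "\<bar>x\<bar>" "\<bar>y\<bar>"]
    by (simp only: power2_abs abs_mult) linarith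
  then show "AE x in M. norm (X x * Y x) \<le> norm ((X x)\<^sup>2 + (Y x)\<^sup>2)" by simp
qed

lemma L2_space_lin:
  assumes "X \<in> L2_space M" "Y \<in> L2_space M"
  shows "(\<lambda>x. a * X x + b * Y x) \<in> L2_space M"
proof -
  note [measurable] = L2_spaceD(1)[OF assms(1)] L2_spaceD(1)[OF assms(2)]
  have "integrable M (\<lambda>x. a\<^sup>2 * (X x)\<^sup>2 + 2 * a * b * (X x * Y x) + b\<^sup>2 * (Y x)\<^sup>2)"
    using assms L2_mult_integrable[OF assms] by (auto simp: L2_space_def)
  then have "integrable M (\<lambda>x. (a * X x + b * Y x)\<^sup>2)"
    by (simp add: power2_eq_square algebra_simps)
  then show ?thesis by (auto simp: L2_space_def)
qed

lemma L2_space_diff: "X \<in> L2_space M \<Longrightarrow> Y \<in> L2_space M \<Longrightarrow> (\<lambda>x. X x - Y x) \<in> L2_space M"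
  using L2_space_lin[of X M Y 1 "-1"] by simp

lemma L2_space_zero: "(\<lambda>x. 0) \<in> L2_space M"
  by (simp add: L2_space_def)

lemma L2_space_cmult: "X \<in> L2_space M \<Longrightarrow> (\<lambda>x. a * X x) \<in> L2_space M"
  using L2_space_lin[of X M X a 0] by simp

lemma L2_space_sum:
  assumes "\<And>i. i \<in> A \<Longrightarrow> X i \<in> L2_space M"
  shows "(\<lambda>x. \<Sum>i\<in>A. c i * X i x) \<in> L2_space M"
  using assms
proof (induction A rule: infinite_finite_induct)
  case (insert j A)
  then show ?case using L2_space_lin[of "X j" M "\<lambda>x. \<Sum>i\<in>A. c i * X i x" "c j" 1] by simp
qed (simp_all add: L2_space_zero)

lemma L2_space_bounded:
  assumes "finite_measure M" "X \<in> borel_measurable M" "\<And>x. x \<in> space M \<Longrightarrow> \<bar>X x\<bar> \<le> B"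
  shows "X \<in> L2_space M"
proof -
  interpret finite_measure M by fact
  have "(X x)\<^sup>2 \<le> B\<^sup>2" if "x \<in> space M" for x using assms(3)[OF that]
      by (simp add: abs_le_square_iff[symmetric])
  then have "integrable M (\<lambda>x. (X x)\<^sup>2)"
    using assms(2) by (intro integrable_const_bound[where B="B\<^sup>2"]) auto
  then show ?thesis using assms(2) by (simp add: L2_space_def)
qed

lemma L2_integral_power2_lin_le:
  assumes "X \<in> L2_space M" "Y \<in> L2_space M"
  shows "(\<integral>x. (a * X x + b * Y x)\<^sup>2 \<partial>M) \<le> 2 * a\<^sup>2 * (\<integral>x. (X x)\<^sup>2 \<partial>M) + 2 * b\<^sup>2 * (\<integral>x. (Y x)\<^sup>2 \<partial>M)"
proof -
  have "(\<integral>x. (a * X x + b * Y x)\<^sup>2 \<partial>M) \<le> (\<integral>x. 2 * a\<^sup>2 * (X x)\<^sup>2 + 2 * b\<^sup>2 * (Y x)\<^sup>2 \<partial>M)"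
  proof (rule integral_mono)
    fix x
    show "(a * X x + b * Y x)\<^sup>2 \<le> 2 * a\<^sup>2 * (X x)\<^sup>2 + 2 * b\<^sup>2 * (Y x)\<^sup>2"
      using sum_squares_bound[of "a * X x" "b * Y x"] by (simp add: power2_sum power_mult_distrib)
  qed (use assms L2_space_lin[OF assms] in \<open>auto simp: L2_space_def\<close>)
  also have "\<dots> = 2 * a\<^sup>2 * (\<integral>x. (X x)\<^sup>2 \<partial>M) + 2 * b\<^sup>2 * (\<integral>x. (Y x)\<^sup>2 \<partial>M)"
    using assms by (simp add: L2_space_def)
  finally show ?thesis .
qed

lemma L2_tendsto_lin:
  assumes "L2_tendsto M Xs X" "L2_tendsto M Ys Y"
  shows "L2_tendsto M (\<lambda>n x. a * Xs n x + b * Ys n x) (\<lambda>x. a * X x + b * Y x)"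
  unfolding L2_tendsto_def
proof (intro conjI allI L2_space_lin)
  have L: "(\<lambda>x. Xs n x - X x) \<in> L2_space M" "(\<lambda>x. Ys n x - Y x) \<in> L2_space M" for n
    using assms by (auto simp: L2_tendsto_def intro!: L2_space_diff)
  show "(\<lambda>n. \<integral>x. (a * Xs n x + b * Ys n x - (a * X x + b * Y x))\<^sup>2 \<partial>M) \<longlonglongrightarrow> 0"
  proof (rule tendsto_sandwich[where f="\<lambda>_. 0"])
    show "\<forall>\<^sub>F n in sequentially. (\<integral>x. (a * Xs n x + b * Ys n x - (a * X x + b * Y x))\<^sup>2 \<partial>M)
       \<le> 2 * a\<^sup>2 * (\<integral>x. (Xs n x - X x)\<^sup>2 \<partial>M) + 2 * b\<^sup>2 * (\<integral>x. (Ys n x - Y x)\<^sup>2 \<partial>M)"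
      using L2_integral_power2_lin_le[OF L, of a _ b]
        by (intro always_eventually allI) (simp add: algebra_simps)
    have "(\<lambda>n. 2 * a\<^sup>2 * (\<integral>x. (Xs n x - X x)\<^sup>2 \<partial>M) + 2 * b\<^sup>2 * (\<integral>x. (Ys n x - Y x)\<^sup>2 \<partial>M))
        \<longlonglongrightarrow> 2 * a\<^sup>2 * 0 + 2 * b\<^sup>2 * 0"
      using assms unfolding L2_tendsto_def by (intro tendsto_intros) auto
    then show "(\<lambda>n. 2 * a\<^sup>2 * (\<integral>x. (Xs n x - X x)\<^sup>2 \<partial>M) + 2 * b\<^sup>2 * (\<integral>x. (Ys n x - Y x)\<^sup>2 \<partial>M)) \<longlonglongrightarrow> 0"
        by simp
  qed auto
qed (use assms in \<open>auto simp: L2_tendsto_def\<close>)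

lemma L2_Cauchy_Schwarz:
  assumes "X \<in> L2_space M" "Y \<in> L2_space M"
  shows "\<bar>\<integral>x. X x * Y x \<partial>M\<bar> \<le> sqrt ((\<integral>x. (X x)\<^sup>2 \<partial>M) * (\<integral>x. (Y x)\<^sup>2 \<partial>M))"
proof -
  define A B C where "A = (\<integral>x. (X x)\<^sup>2 \<partial>M)" and "B = (\<integral>x. X x * Y x \<partial>M)" and "C = (\<integral>x. (Y x)\<^sup>2 \<partial>M)"
  have q: "A + 2 * t * B + t\<^sup>2 * C \<ge> 0" for t
  proof -
    have "0 \<le> (\<integral>x. (X x + t * Y x)\<^sup>2 \<partial>M)" by (intro Bochner_Integration.integral_nonneg) simp
    also have "\<dots> = (\<integral>x. (X x)\<^sup>2 + 2 * t * (X x * Y x) + t\<^sup>2 * (Y x)\<^sup>2 \<partial>M)"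
      by (intro Bochner_Integration.integral_cong) (auto simp: power2_eq_square algebra_simps)
    also have "\<dots> = A + 2 * t * B + t\<^sup>2 * C"
      unfolding A_def B_def C_def using assms L2_mult_integrable[OF assms]
        by (simp add: L2_space_def)
    finally show ?thesis .
  qed
  have C0: "C \<ge> 0" unfolding C_def by (intro Bochner_Integration.integral_nonneg) simp
  have "B\<^sup>2 \<le> A * C"
  proof (cases "C = 0")
    case True
    have "B = 0"
    proof (rule ccontr)
      assume "B \<noteq> 0"
      \<comment> \<open>With C = 0 the quadratic is affine in t, and at this t it takes the value
        -1.\<close>
      then show False using q[of "- (A + 1) / (2 * B)"] True by (simp add: field_simps)
    qed
    then show ?thesis using True by simp
  next
    case False
    then show ?thesis using q[of "- B / C"] C0 by (simp add: field_simps power2_eq_square)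
  qed
  then have "sqrt (B\<^sup>2) \<le> sqrt (A * C)" by (rule real_sqrt_le_mono)
  then show ?thesis by (simp add: A_def B_def C_def)
qed

lemma L2_tendsto_integral_mult:
  assumes "L2_tendsto M Xs X" "L2_tendsto M Ys Y"
  shows "(\<lambda>n. \<integral>x. Xs n x * Ys n x \<partial>M) \<longlonglongrightarrow> (\<integral>x. X x * Y x \<partial>M)"
proof -
  have L: "X \<in> L2_space M" "Y \<in> L2_space M" "\<And>n. Xs n \<in> L2_space M" "\<And>n. Ys n \<in> L2_space M"
    using assms by (auto simp: L2_tendsto_def)
  define a b where "a = (\<lambda>n. \<integral>x. (Xs n x - X x)\<^sup>2 \<partial>M)" and "b = (\<lambda>n. \<integral>x. (Ys n x - Y x)\<^sup>2 \<partial>M)"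
  have ab: "a \<longlonglongrightarrow> 0" "b \<longlonglongrightarrow> 0" using assms by (auto simp: L2_tendsto_def a_def b_def)
  define A B where "A = (\<integral>x. (X x)\<^sup>2 \<partial>M)" and "B = (\<integral>x. (Y x)\<^sup>2 \<partial>M)"
  have "(\<lambda>n. (\<integral>x. Xs n x * Ys n x \<partial>M) - (\<integral>x. X x * Y x \<partial>M)) \<longlonglongrightarrow> 0"
  proof (rule Lim_null_comparison)
    show "\<forall>\<^sub>F n in sequentially. norm ((\<integral>x. Xs n x * Ys n x \<partial>M) - (\<integral>x. X x * Y x \<partial>M))
        \<le> sqrt (a n * b n) + sqrt (A * b n) + sqrt (a n * B)"
    proof (intro always_eventually allI)
      fix n
      note D = L2_space_diff[OF L(3)[of n] L(1)] L2_space_diff[OF L(4)[of n] L(2)]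
      have "(\<integral>x. Xs n x * Ys n x \<partial>M) - (\<integral>x. X x * Y x \<partial>M) = (\<integral>x. Xs n x * Ys n x - X x * Y x \<partial>M)"
        using L by (intro Bochner_Integration.integral_diff[symmetric] L2_mult_integrable) auto
      also have "\<dots> = (\<integral>x. (Xs n x - X x) * (Ys n x - Y x) + X x * (Ys n x - Y x) + (Xs n x - X x)
          * Y x \<partial>M)"
        by (intro Bochner_Integration.integral_cong) (auto simp: algebra_simps)
      also have "\<dots> = (\<integral>x. (Xs n x - X x) * (Ys n x - Y x) \<partial>M) + (\<integral>x. X x * (Ys n x - Y x) \<partial>M)
          + (\<integral>x. (Xs n x - X x) * Y x \<partial>M)"
        using L2_mult_integrable[OF D] L2_mult_integrable[OF L(1) D(2)]
          L2_mult_integrable[OF D(1) L(2)] by simp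
      finally show "norm ((\<integral>x. Xs n x * Ys n x \<partial>M) - (\<integral>x. X x * Y x \<partial>M))
          \<le> sqrt (a n * b n) + sqrt (A * b n) + sqrt (a n * B)"
        using L2_Cauchy_Schwarz[OF D] L2_Cauchy_Schwarz[OF L(1) D(2)]
          L2_Cauchy_Schwarz[OF D(1) L(2)]
        unfolding a_def b_def A_def B_def real_norm_def by linarith
    qed
    have "(\<lambda>n. sqrt (a n * b n) + sqrt (A * b n) + sqrt (a n * B))
        \<longlonglongrightarrow> sqrt (0 * 0) + sqrt (A * 0) + sqrt (0 * B)"
      by (intro tendsto_intros ab)
    then show "(\<lambda>n. sqrt (a n * b n) + sqrt (A * b n) + sqrt (a n * B)) \<longlonglongrightarrow> 0" by simp
  qed
  then show ?thesis by (simp add: LIM_zero_iff)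
qed

lemma L2_tendsto_const: "X \<in> L2_space M \<Longrightarrow> L2_tendsto M (\<lambda>_. X) X"
  by (simp add: L2_tendsto_def)

lemma L2_zero_AE:
  assumes "X \<in> L2_space M" "(\<integral>x. (X x)\<^sup>2 \<partial>M) = 0"
  shows "AE x in M. X x = 0"
  using integral_nonneg_eq_0_iff_AE[OF L2_spaceD(2)[OF assms(1)]] assms(2) by simp

lemma L2_tendsto_AE_unique:
  assumes "L2_tendsto M Xs X" "L2_tendsto M Xs X'"
  shows "AE x in M. X x = X' x"
proof -
  from L2_tendsto_lin[OF assms, of 1 "-1"]
  have *: "(\<lambda>x. X x - X' x) \<in> L2_space M" "(\<lambda>n. \<integral>x. (X x - X' x)\<^sup>2 \<partial>M) \<longlonglongrightarrow> 0"
    by (auto simp: L2_tendsto_def power2_commute)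
  then have "(\<integral>x. (X x - X' x)\<^sup>2 \<partial>M) = 0" by (simp add: LIMSEQ_const_iff)
  with *(1) have "AE x in M. X x - X' x = 0" by (rule L2_zero_AE)
  then show ?thesis by simp
qed

lemma L2_tendsto_AE_cong:
  assumes "L2_tendsto M Xs X" "AE x in M. X x = X' x" "X' \<in> borel_measurable M"
  shows "L2_tendsto M Xs X'"
proof -
  have L: "X \<in> L2_space M" "\<And>n. Xs n \<in> L2_space M" using assms by (auto simp: L2_tendsto_def)
  note [measurable] = L2_spaceD(1)[OF L(1)] L2_spaceD(1)[OF L(2)] assms(3)
  have "integrable M (\<lambda>x. (X' x)\<^sup>2)"
    using L2_spaceD(2)[OF L(1)]
      by (rule Bochner_Integration.integrable_cong_AE_imp) (use assms(2) in auto)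
  moreover have "(\<integral>x. (Xs n x - X' x)\<^sup>2 \<partial>M) = (\<integral>x. (Xs n x - X x)\<^sup>2 \<partial>M)" for n
    by (intro integral_cong_AE) (use assms(2) in auto)
  ultimately show ?thesis using assms by (simp add: L2_tendsto_def L2_space_def)
qed

text \<open>A subsequence with L^2 increments at most 2^(-k) has summable L^1 increments, so it
  converges almost everywhere. Fatou's lemma then carries the Cauchy estimate over to the limit.
  This is the source of the Wiener integrals.\<close>

lemma (in prob_space) Riesz_Fischer:
  assumes L: "\<And>n. Xs n \<in> L2_space M"
    and Cauchy: "\<And>e::real. e > 0 \<Longrightarrow> \<exists>N. \<forall>m\<ge>N. \<forall>n\<ge>N. (\<integral>x. (Xs m x - Xs n x)\<^sup>2 \<partial>M) < e"
  shows "\<exists>X. L2_tendsto M Xs X"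
proof -
  have [measurable]: "Xs n \<in> borel_measurable M" for n using L by (rule L2_spaceD)
  have DL: "(\<lambda>x. Xs m x - Xs n x) \<in> L2_space M" for m n by (intro L2_space_diff L)
  have "\<exists>N. \<forall>m\<ge>N. \<forall>n\<ge>N. (\<integral>x. (Xs m x - Xs n x)\<^sup>2 \<partial>M) < (1/4)^k" for k :: nat
    by (rule Cauchy) simp
  then obtain N where N: "\<And>k m n. m \<ge> N k \<Longrightarrow> n \<ge> N k \<Longrightarrow> (\<integral>x. (Xs m x - Xs n x)\<^sup>2 \<partial>M) < (1/4)^k"
      by metis
  \<comment> \<open>Strictly increasing with \<open>r k\<close> at least \<open>N k\<close>, so that
    \<open>r k\<close> and \<open>r (Suc k)\<close> both lie in the range where the bound (1/4)^k
    holds.\<close>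
  define r where "r = rec_nat (N 0) (\<lambda>k r. max (Suc r) (N (Suc k)))"
  have r0: "r 0 = N 0" and rS: "r (Suc k) = max (Suc (r k)) (N (Suc k))" for k by (auto simp: r_def)
  have r: "strict_mono r" by (rule strict_monoI_Suc) (simp add: rS)
  have rN: "N k \<le> r k" for k by (cases k) (auto simp: r0 rS)
  define D where "D = (\<lambda>k x. Xs (r (Suc k)) x - Xs (r k) x)"
  have [measurable]: "D k \<in> borel_measurable M" for k unfolding D_def by measurable
  have D2: "(\<integral>x. (D k x)\<^sup>2 \<partial>M) \<le> (1/4)^k" for k
    unfolding D_def using N[of k "r (Suc k)" "r k"] rN[of k] strict_monoD[OF r, of k "Suc k"]
      by (simp add: less_imp_le)
  have iD: "integrable M (\<lambda>x. \<bar>D k x\<bar>)" for k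
    using L2_mult_integrable[OF DL, of "\<lambda>_. 1" "r (Suc k)" "r k"]
      L2_space_bounded[OF finite_measure_axioms, of "\<lambda>_. 1" 1]
    by (simp add: D_def)
  have D1: "(\<integral>x. \<bar>D k x\<bar> \<partial>M) \<le> (1/2)^k" for k
  proof -
    \<comment> \<open>Arithmetic-geometric mean inequality with weight 2^k: as the second moment is
      at most 4^(-k), both summands are then of size 2^(-k).\<close>
    have "(\<integral>x. \<bar>D k x\<bar> \<partial>M) \<le> (\<integral>x. (2^k * (D k x)\<^sup>2 + (1/2)^k) / 2 \<partial>M)"
    proof (rule integral_mono[OF iD])
      show "integrable M (\<lambda>x. (2^k * (D k x)\<^sup>2 + (1/2)^k) / 2)" using DL
          by (auto simp: D_def L2_space_def)
      fix x
      define h :: real where "h = 2^k"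
      have h: "h > 0" "(1/2)^k = 1 / h" by (auto simp: h_def power_one_over)
      have "0 \<le> (h * \<bar>D k x\<bar> - 1)\<^sup>2" by simp
      also have "\<dots> = h * (h * (D k x)\<^sup>2) + 1 - h * (2 * \<bar>D k x\<bar>)"
        by (simp only: power2_diff power_mult_distrib power2_abs)
          (simp add: power2_eq_square algebra_simps)
      finally have "h * (2 * \<bar>D k x\<bar>) \<le> h * (h * (D k x)\<^sup>2 + 1 / h)" using h
          by (simp add: distrib_left)
      then have "2 * \<bar>D k x\<bar> \<le> h * (D k x)\<^sup>2 + 1 / h" using h(1) by simp
      then show "\<bar>D k x\<bar> \<le> (2^k * (D k x)\<^sup>2 + (1/2)^k) / 2" by (simp add: h(2) flip: h_def)
    qed
    also have "\<dots> = (2^k * (\<integral>x. (D k x)\<^sup>2 \<partial>M) + (1/2)^k) / 2"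
      using DL[of "r (Suc k)" "r k"] by (simp add: D_def L2_space_def prob_space)
    also have "\<dots> \<le> (2^k * (1/4)^k + (1/2)^k) / 2"
      using D2[of k] by (intro divide_right_mono add_right_mono mult_left_mono) auto
    also have "(2::real)^k * (1/4)^k = (1/2)^k" by (simp add: power_mult_distrib[symmetric])
    finally show ?thesis by simp
  qed
  have "(\<integral>\<^sup>+x. (\<Sum>k. ennreal \<bar>D k x\<bar>) \<partial>M) = (\<Sum>k. \<integral>\<^sup>+x. ennreal \<bar>D k x\<bar> \<partial>M)"
    by (rule nn_integral_suminf) measurable
  also have "\<dots> \<le> (\<Sum>k. ennreal ((1/2)^k))"
    using D1 iD by (intro suminf_le) (auto simp: nn_integral_eq_integral ennreal_leI)
  also have "\<dots> = ennreal (\<Sum>k. (1/2)^k)"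
    by (intro suminf_ennreal2) (auto simp: summable_geometric)
  also have "\<dots> < \<infinity>" by simp
  finally have fin: "AE x in M. (\<Sum>k. ennreal \<bar>D k x\<bar>) \<noteq> \<infinity>"
    by (intro nn_integral_PInf_AE) auto
  have conv: "AE x in M. convergent (\<lambda>k. Xs (r k) x)"
    using fin
  proof eventually_elim
    case (elim x)
    then have "summable (\<lambda>k. \<bar>D k x\<bar>)" by (intro summable_suminf_not_top) auto
    then have "summable (\<lambda>k. D k x)" by (rule summable_rabs_cancel)
    then have "convergent (\<lambda>n. \<Sum>k<n. D k x)" by (simp add: summable_iff_convergent)
    moreover have "(\<Sum>k<n. D k x) = Xs (r n) x - Xs (r 0) x" for n
      unfolding D_def by (rule sum_lessThan_telescope)
    ultimately have "convergent (\<lambda>n. Xs (r n) x - Xs (r 0) x + Xs (r 0) x)"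
      by (intro convergent_add convergent_const) simp
    then show ?case by simp
  qed
  \<comment> \<open>\<open>lim\<close> is measurable and defined everywhere; on the null set where
    the subsequence diverges its value is arbitrary.\<close>
  define X where "X = (\<lambda>x. lim (\<lambda>k. Xs (r k) x))"
  have [measurable]: "X \<in> borel_measurable M" unfolding X_def by measurable
  have bound: "(\<integral>\<^sup>+x. ennreal ((Xs n x - X x)\<^sup>2) \<partial>M) \<le> ennreal e"
    if n: "\<And>m. m \<ge> N \<Longrightarrow> (\<integral>x. (Xs n x - Xs m x)\<^sup>2 \<partial>M) < e" for n e N
  proof -
    have "(\<integral>\<^sup>+x. ennreal ((Xs n x - X x)\<^sup>2) \<partial>M)
        = (\<integral>\<^sup>+x. liminf (\<lambda>k. ennreal ((Xs n x - Xs (r k) x)\<^sup>2)) \<partial>M)"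
    proof (rule nn_integral_cong_AE)
      show "AE x in M. ennreal ((Xs n x - X x)\<^sup>2) = liminf (\<lambda>k. ennreal ((Xs n x - Xs (r k) x)\<^sup>2))"
        using conv
      proof eventually_elim
        case (elim x)
        then have "(\<lambda>k. Xs (r k) x) \<longlonglongrightarrow> X x" unfolding X_def by (simp add: convergent_LIMSEQ_iff)
        then have "(\<lambda>k. ennreal ((Xs n x - Xs (r k) x)\<^sup>2)) \<longlonglongrightarrow> ennreal ((Xs n x - X x)\<^sup>2)"
          by (intro tendsto_intros)
        then show ?case by (intro lim_imp_Liminf[symmetric]) auto
      qed
    qed
    also have "\<dots> \<le> liminf (\<lambda>k. \<integral>\<^sup>+x. ennreal ((Xs n x - Xs (r k) x)\<^sup>2) \<partial>M)"
      by (rule nn_integral_liminf) measurable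
    also have "\<dots> \<le> ennreal e"
    proof (rule Liminf_le)
      show "\<forall>\<^sub>F k in sequentially. (\<integral>\<^sup>+x. ennreal ((Xs n x - Xs (r k) x)\<^sup>2) \<partial>M) \<le> ennreal e"
      proof (rule eventually_sequentiallyI[of N])
        fix k assume "N \<le> k"
        then have "r k \<ge> N" using seq_suble[OF r, of k] by linarith
        then have "(\<integral>x. (Xs n x - Xs (r k) x)\<^sup>2 \<partial>M) \<le> e" using n by (simp add: less_imp_le)
        then show "(\<integral>\<^sup>+x. ennreal ((Xs n x - Xs (r k) x)\<^sup>2) \<partial>M) \<le> ennreal e"
          using DL[of n "r k"] by (subst nn_integral_eq_integral)
            (auto simp: L2_space_def intro: ennreal_leI)
      qed
    qed simp
    finally show ?thesis .
  qed
  have XnL: "(\<lambda>x. Xs n x - X x) \<in> L2_space M \<and> (\<integral>x. (Xs n x - X x)\<^sup>2 \<partial>M) \<le> e"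
    if n: "\<And>m. m \<ge> N \<Longrightarrow> (\<integral>x. (Xs n x - Xs m x)\<^sup>2 \<partial>M) < e" and e: "e > 0" for n e N
  proof
    have i: "integrable M (\<lambda>x. (Xs n x - X x)\<^sup>2)"
      by (rule integrableI_bounded) (use bound[OF n] le_less_trans in \<open>auto simp:
        less_top[symmetric] top_unique\<close>)
    then show "(\<lambda>x. Xs n x - X x) \<in> L2_space M" by (simp add: L2_space_def)
    have "ennreal (\<integral>x. (Xs n x - X x)\<^sup>2 \<partial>M) \<le> ennreal e"
      using bound[OF n] i by (subst nn_integral_eq_integral[symmetric]) auto
    then show "(\<integral>x. (Xs n x - X x)\<^sup>2 \<partial>M) \<le> e" using e by (simp add: ennreal_le_iff)
  qed
  have "X \<in> L2_space M"
  proof -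
    have "(\<lambda>x. Xs (N 0) x - X x) \<in> L2_space M" using XnL[of "N 0" "N 0" 1] N[of 0 "N 0"] by auto
    from L2_space_diff[OF L[of "N 0"] this] show ?thesis by simp
  qed
  moreover have "(\<lambda>n. \<integral>x. (Xs n x - X x)\<^sup>2 \<partial>M) \<longlonglongrightarrow> 0"
  proof (rule LIMSEQ_I)
    fix e :: real assume "e > 0"
    then obtain N' where N': "\<forall>m\<ge>N'. \<forall>n\<ge>N'. (\<integral>x. (Xs m x - Xs n x)\<^sup>2 \<partial>M) < e / 2"
        using Cauchy[of "e/2"] by auto
    have "norm ((\<integral>x. (Xs n x - X x)\<^sup>2 \<partial>M) - 0) < e" if "n \<ge> N'" for n
      using XnL[of N' n "e/2"] N' that \<open>e > 0\<close> by force
    then show "\<exists>no. \<forall>n\<ge>no. norm ((\<integral>x. (Xs n x - X x)\<^sup>2 \<partial>M) - 0) < e" by auto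
  qed
  ultimately show ?thesis using L by (auto simp: L2_tendsto_def)
qed

subsection \<open>Centered Gaussian random variables\<close>

lemma norm_integral_le:
  fixes f :: "'a \<Rightarrow> 'b::{banach, second_countable_topology}"
  assumes "integrable M f" "integrable M g" "\<And>x. x \<in> space M \<Longrightarrow> norm (f x) \<le> g x"
  shows "norm (\<integral>x. f x \<partial>M) \<le> (\<integral>x. g x \<partial>M)"
proof -
  have "norm (\<integral>x. f x \<partial>M) \<le> (\<integral>x. norm (f x) \<partial>M)" by (rule integral_norm_bound)
  also have "\<dots> \<le> (\<integral>x. g x \<partial>M)" using assms by (intro integral_mono integrable_norm)
  finally show ?thesis .
qed

text \<open>Encoded through the characteristic function rather than a density, so that the
  degenerate case v = 0 is included and the notion passes directly to independent sums and to L^2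
  limits.\<close>

definition centered_gaussian :: "'a measure \<Rightarrow> ('a \<Rightarrow> real) \<Rightarrow> real \<Rightarrow> bool" where
  "centered_gaussian M X v \<longleftrightarrow> X \<in> borel_measurable M \<and>
     (\<forall>u. char (distr M borel X) u = of_real (exp (- u\<^sup>2 * v / 2)))"

lemma char_distr:
  "X \<in> borel_measurable M \<Longrightarrow> char (distr M borel X) u = (\<integral>\<omega>. iexp (u * X \<omega>) \<partial>M)"
  unfolding char_def by (subst integral_distr) simp_all

lemma centered_gaussian_scale:
  assumes "centered_gaussian M X v"
  shows "centered_gaussian M (\<lambda>\<omega>. c * X \<omega>) (c\<^sup>2 * v)"
proof -
  have X [measurable]: "X \<in> borel_measurable M" using assms by (simp add: centered_gaussian_def)
  have "char (distr M borel (\<lambda>\<omega>. c * X \<omega>)) u = char (distr M borel X) (u * c)" for u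
    by (simp add: char_distr mult.assoc)
  then show ?thesis using assms by (auto simp: centered_gaussian_def power_mult_distrib mult_ac)
qed

lemma (in prob_space) centered_gaussian_normal:
  assumes X: "distributed M lborel X (normal_density 0 \<sigma>)" and "\<sigma> > 0"
  shows "centered_gaussian M X (\<sigma>\<^sup>2)"
proof -
  have [measurable]: "X \<in> borel_measurable M" using distributed_measurable[OF X] by simp
  have "distributed M lborel (\<lambda>\<omega>. (X \<omega> - 0) / \<sigma>) std_normal_density"
    using X normal_standard_normal_convert[OF assms(2), of X 0] by simp
  then have "distr M lborel (\<lambda>\<omega>. X \<omega> / \<sigma>) = std_normal_distribution"
    by (simp add: distributed_distr_eq_density)
  then have d: "distr M borel (\<lambda>\<omega>. X \<omega> / \<sigma>) = std_normal_distribution"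
    by (metis distr_cong sets_lborel)
  have "centered_gaussian M (\<lambda>\<omega>. X \<omega> / \<sigma>) 1"
    unfolding centered_gaussian_def d char_std_normal_distribution by auto
  from centered_gaussian_scale[OF this, of \<sigma>] assms(2) show ?thesis by simp
qed

lemma (in prob_space) centered_gaussian_sum:
  assumes "indep_vars (\<lambda>_. borel) X A" "\<And>i. i \<in> A \<Longrightarrow> centered_gaussian M (X i) (v i)"
  shows "centered_gaussian M (\<lambda>\<omega>. \<Sum>i\<in>A. X i \<omega>) (\<Sum>i\<in>A. v i)"
  unfolding centered_gaussian_def
proof (intro conjI allI)
  show "(\<lambda>\<omega>. \<Sum>i\<in>A. X i \<omega>) \<in> borel_measurable M"
    using assms(2) by (intro borel_measurable_sum) (auto simp: centered_gaussian_def)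
  fix u
  have "char (distr M borel (\<lambda>\<omega>. \<Sum>i\<in>A. X i \<omega>)) u = (\<Prod>i\<in>A. of_real (exp (- u\<^sup>2 * v i / 2)))"
    using assms by (subst char_distr_sum) (auto simp: centered_gaussian_def intro!: prod.cong)
  also have "\<dots> = of_real (exp (\<Sum>i\<in>A. - u\<^sup>2 * v i / 2))"
    by (cases "finite A") (simp_all add: exp_sum)
  also have "(\<Sum>i\<in>A. - u\<^sup>2 * v i / 2) = - u\<^sup>2 * (\<Sum>i\<in>A. v i) / 2"
    by (simp add: sum_distrib_left sum_divide_distrib)
  finally show "char (distr M borel (\<lambda>\<omega>. \<Sum>i\<in>A. X i \<omega>)) u = of_real (exp (- u\<^sup>2 * (\<Sum>i\<in>A. v i) / 2))" .
qed

text \<open>With variance 0 the characteristic function is that of the point mass at 0. This is what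
  makes Wiener integrals unique almost surely.\<close>

lemma (in prob_space) centered_gaussian_zero:
  assumes "centered_gaussian M X 0"
  shows "AE \<omega> in M. X \<omega> = 0"
proof -
  have X [measurable]: "X \<in> borel_measurable M" using assms by (simp add: centered_gaussian_def)
  have "distr M borel X = return borel 0"
  proof (rule Levy_uniqueness)
    show "real_distribution (distr M borel X)" by (rule real_distribution_distr) simp
    show "real_distribution (return borel 0)"
      by (intro real_distribution.intro real_distribution_axioms.intro prob_space_return) auto
    show "char (distr M borel X) = char (return borel 0)"
      using assms by (auto simp: centered_gaussian_def char_def integral_return)
  qed
  moreover have "AE x in return borel (0::real). x = 0" by (subst AE_return) auto
  ultimately have "AE x in distr M borel X. x = 0" by (simp only:)
  then show ?thesis by (subst (asm) AE_distr_iff) auto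
qed

lemma has_bochner_integral_exp_std_normal:
  "has_bochner_integral lborel (\<lambda>x. std_normal_density x * exp (s * x)) (exp (s\<^sup>2 / 2))"
proof -
  have "std_normal_density x * exp (s * x) = exp (s\<^sup>2 / 2) * normal_density s 1 x" for x
  proof -
    have "- x\<^sup>2 / 2 + s * x = s\<^sup>2 / 2 + - (x - s)\<^sup>2 / 2"
      by (simp add: power2_diff field_simps)
    then show ?thesis unfolding normal_density_def by (simp flip: exp_add)
  qed
  then show ?thesis by (simp add: has_bochner_integral_iff)
qed

lemma (in prob_space) centered_gaussian_moments:
  assumes "centered_gaussian M X v" "v \<ge> 0"
  shows "integrable M (\<lambda>\<omega>. exp (X \<omega>))" "(\<integral>\<omega>. exp (X \<omega>) \<partial>M) = exp (v / 2)"
    "integrable M (\<lambda>\<omega>. (X \<omega>)\<^sup>2)" "(\<integral>\<omega>. (X \<omega>)\<^sup>2 \<partial>M) = v"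
proof -
  have X [measurable]: "X \<in> borel_measurable M" using assms by (simp add: centered_gaussian_def)
  have "integrable M (\<lambda>\<omega>. exp (X \<omega>)) \<and> (\<integral>\<omega>. exp (X \<omega>) \<partial>M) = exp (v / 2) \<and>
     integrable M (\<lambda>\<omega>. (X \<omega>)\<^sup>2) \<and> (\<integral>\<omega>. (X \<omega>)\<^sup>2 \<partial>M) = v"
  \<comment> \<open>Standardizing divides by sqrt v, so the degenerate case is treated on its
    own.\<close>
  proof (cases "v = 0")
    case True
    have z: "AE \<omega> in M. X \<omega> = 0" using assms True by (intro centered_gaussian_zero) simp
    have "has_bochner_integral M (\<lambda>\<omega>. exp (X \<omega>)) 1"
      by (subst has_bochner_integral_cong_AE[where g="\<lambda>_. 1"])
         (use z in \<open>auto simp: has_bochner_integral_iff prob_space\<close>)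
    moreover have "has_bochner_integral M (\<lambda>\<omega>. (X \<omega>)\<^sup>2) 0"
      by (subst has_bochner_integral_cong_AE[where g="\<lambda>_. 0"])
         (use z in \<open>auto simp: has_bochner_integral_iff\<close>)
    ultimately show ?thesis using True by (auto simp: has_bochner_integral_iff)
  next
    case False
    define s where "s = sqrt v"
    have s: "s > 0" "s\<^sup>2 = v" using False assms(2) by (auto simp: s_def)
    define Z where "Z = (\<lambda>\<omega>. (1 / s) * X \<omega>)"
    have [measurable]: "Z \<in> borel_measurable M" unfolding Z_def by measurable
    have XZ: "X \<omega> = s * Z \<omega>" for \<omega> using s by (simp add: Z_def)
    have "centered_gaussian M Z ((1/s)\<^sup>2 * v)" unfolding Z_def using assms(1)
        by (rule centered_gaussian_scale)
    moreover have "(1/s)\<^sup>2 * v = 1" using s by (simp add: power_one_over flip: s(2))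
    ultimately have Z: "centered_gaussian M Z 1" by simp
    have d: "distr M borel Z = std_normal_distribution"
    proof (rule Levy_uniqueness)
      show "real_distribution (distr M borel Z)" by (rule real_distribution_distr) simp
      show "real_distribution std_normal_distribution" by (rule real_dist_normal_dist)
      show "char (distr M borel Z) = char std_normal_distribution"
        using Z by (auto simp: centered_gaussian_def char_std_normal_distribution)
    qed
    have tr: "has_bochner_integral M (\<lambda>\<omega>. h (Z \<omega>)) c"
      if h: "has_bochner_integral lborel (\<lambda>x. std_normal_density x * h x) c"
        "h \<in> borel_measurable borel" for h :: "real \<Rightarrow> real" and c
    proof -
      have [measurable]: "h \<in> borel_measurable borel" by fact
      have "has_bochner_integral std_normal_distribution h c"
        using h by (subst has_bochner_integral_density) (auto simp: normal_density_nonneg)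
      then have "has_bochner_integral (distr M borel Z) h c" by (simp add: d)
      then show ?thesis by (simp add: has_bochner_integral_iff integrable_distr_eq integral_distr)
    qed
    have "has_bochner_integral M (\<lambda>\<omega>. exp (s * Z \<omega>)) (exp (s\<^sup>2 / 2))"
      by (rule tr[of "\<lambda>x. exp (s * x)", OF has_bochner_integral_exp_std_normal]) simp
    moreover have "has_bochner_integral M (\<lambda>\<omega>. (Z \<omega>)\<^sup>2) 1"
      using tr[of "\<lambda>x. x\<^sup>2" 1] std_normal_moment_even[of 1] by (simp add: fact_2)
    then have "has_bochner_integral M (\<lambda>\<omega>. s\<^sup>2 * (Z \<omega>)\<^sup>2) (s\<^sup>2 * 1)"
      by (rule has_bochner_integral_mult_right)
    ultimately show ?thesis unfolding XZ using s
      by (auto simp: has_bochner_integral_iff power_mult_distrib)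
  qed
  then show "integrable M (\<lambda>\<omega>. exp (X \<omega>))" "(\<integral>\<omega>. exp (X \<omega>) \<partial>M) = exp (v / 2)"
    "integrable M (\<lambda>\<omega>. (X \<omega>)\<^sup>2)" "(\<integral>\<omega>. (X \<omega>)\<^sup>2 \<partial>M) = v" by auto
qed

lemma norm_iexp_diff_le: "cmod (iexp x - iexp y) \<le> \<bar>x - y\<bar>"
proof -
  have "iexp x - iexp y = iexp y * (iexp (x - y) - 1)"
    by (simp add: algebra_simps flip: exp_add)
  then have "cmod (iexp x - iexp y) = cmod (iexp (x - y) - 1)" by (simp add: norm_mult)
  also have "\<dots> \<le> \<bar>x - y\<bar>" using iexp_approx1[of "x - y" 0] by simp
  finally show ?thesis .
qed

text \<open>Since x \<mapsto> exp (i u x) is Lipschitz with constant |u|, the characteristic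
  functions differ by at most |u| times the L^1 distance, which the L^2 distance bounds on a
  probability space.\<close>

lemma (in prob_space) centered_gaussian_limit:
  assumes "L2_tendsto M Xs X" "\<And>n. centered_gaussian M (Xs n) (v n)" "v \<longlonglongrightarrow> v'"
  shows "centered_gaussian M X v'"
proof -
  have L: "X \<in> L2_space M" "\<And>n. Xs n \<in> L2_space M" using assms by (auto simp: L2_tendsto_def)
  note [measurable] = L2_spaceD(1)[OF L(1)] L2_spaceD(1)[OF L(2)]
  have one: "(\<lambda>_. 1) \<in> L2_space M" using L2_space_bounded[OF finite_measure_axioms, of "\<lambda>_. 1" 1]
      by simp
  have "char (distr M borel X) u = of_real (exp (- u\<^sup>2 * v' / 2))" for u
  proof (rule LIMSEQ_unique)
    have "(\<lambda>n. of_real (exp (- u\<^sup>2 * v n / 2)) :: complex) \<longlonglongrightarrow> of_real (exp (- u\<^sup>2 * v' / 2))"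
      by (intro tendsto_intros assms) simp
    then show "(\<lambda>n. char (distr M borel (Xs n)) u) \<longlonglongrightarrow> of_real (exp (- u\<^sup>2 * v' / 2))"
      using assms(2) by (simp add: centered_gaussian_def)
    have "(\<lambda>n. char (distr M borel (Xs n)) u - char (distr M borel X) u) \<longlonglongrightarrow> 0"
    proof (rule Lim_null_comparison)
      show "\<forall>\<^sub>F n in sequentially. cmod (char (distr M borel (Xs n)) u - char (distr M borel X) u)
          \<le> \<bar>u\<bar> * sqrt (\<integral>\<omega>. (Xs n \<omega> - X \<omega>)\<^sup>2 \<partial>M)"
      proof (intro always_eventually allI)
        fix n
        have D: "(\<lambda>\<omega>. Xs n \<omega> - X \<omega>) \<in> L2_space M" by (intro L2_space_diff L)
        have D': "(\<lambda>\<omega>. \<bar>Xs n \<omega> - X \<omega>\<bar>) \<in> L2_space M" using D by (auto simp: L2_space_def)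
        have iD: "integrable M (\<lambda>\<omega>. \<bar>Xs n \<omega> - X \<omega>\<bar>)" using L2_mult_integrable[OF D' one] by simp
        have ib: "integrable M (\<lambda>\<omega>. iexp (u * Y \<omega>))" if [measurable]: "Y \<in> borel_measurable M" for Y
          by (rule integrable_const_bound[where B=1]) auto
        have "char (distr M borel (Xs n)) u - char (distr M borel X) u
            = (\<integral>\<omega>. iexp (u * Xs n \<omega>) - iexp (u * X \<omega>) \<partial>M)"
          unfolding char_distr[OF L2_spaceD(1)[OF L(1)]] char_distr[OF L2_spaceD(1)[OF L(2)]]
          by (rule Bochner_Integration.integral_diff[symmetric]; rule ib; measurable)
        also have "cmod \<dots> \<le> (\<integral>\<omega>. \<bar>u\<bar> * \<bar>Xs n \<omega> - X \<omega>\<bar> \<partial>M)"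
        proof (rule norm_integral_le)
          show "integrable M (\<lambda>\<omega>. iexp (u * Xs n \<omega>) - iexp (u * X \<omega>))"
            by (intro Bochner_Integration.integrable_diff ib) auto
          show "integrable M (\<lambda>\<omega>. \<bar>u\<bar> * \<bar>Xs n \<omega> - X \<omega>\<bar>)" using iD by simp
          fix \<omega>
          show "cmod (iexp (u * Xs n \<omega>) - iexp (u * X \<omega>)) \<le> \<bar>u\<bar> * \<bar>Xs n \<omega> - X \<omega>\<bar>"
            using norm_iexp_diff_le[of "u * Xs n \<omega>" "u * X \<omega>"]
              by (simp add: right_diff_distrib[symmetric] abs_mult)
        qed
        also have "\<dots> = \<bar>u\<bar> * (\<integral>\<omega>. \<bar>Xs n \<omega> - X \<omega>\<bar> \<partial>M)" by simp
        also have "\<dots> \<le> \<bar>u\<bar> * sqrt (\<integral>\<omega>. (Xs n \<omega> - X \<omega>)\<^sup>2 \<partial>M)"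
          using L2_Cauchy_Schwarz[OF D' one] by (intro mult_left_mono) (auto simp: prob_space)
        finally show "cmod (char (distr M borel (Xs n)) u - char (distr M borel X) u)
          \<le> \<bar>u\<bar> * sqrt (\<integral>\<omega>. (Xs n \<omega> - X \<omega>)\<^sup>2 \<partial>M)" .
      qed
      have "(\<lambda>n. \<bar>u\<bar> * sqrt (\<integral>\<omega>. (Xs n \<omega> - X \<omega>)\<^sup>2 \<partial>M)) \<longlonglongrightarrow> \<bar>u\<bar> * sqrt 0"
        using assms(1) unfolding L2_tendsto_def by (intro tendsto_intros) auto
      then show "(\<lambda>n. \<bar>u\<bar> * sqrt (\<integral>\<omega>. (Xs n \<omega> - X \<omega>)\<^sup>2 \<partial>M)) \<longlonglongrightarrow> 0" by simp
    qed
    then show "(\<lambda>n. char (distr M borel (Xs n)) u) \<longlonglongrightarrow> char (distr M borel X) u"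
        by (simp add: LIM_zero_iff)
  qed
  then show ?thesis by (simp add: centered_gaussian_def)
qed

subsection \<open>Step functions\<close>

lemma is_step_append [simp]: "is_step (ps @ qs) \<longleftrightarrow> is_step ps \<and> is_step qs"
  by (simp add: is_step_def ball_Un)

lemma step_fun_append: "step_fun (ps @ qs) s = step_fun ps s + step_fun qs s"
  by (simp add: step_fun_def)

lemma step_integral_append: "step_integral V (ps @ qs) \<omega>
    = step_integral V ps \<omega> + step_integral V qs \<omega>"
  by (simp add: step_integral_def)

definition step_scale :: "real \<Rightarrow> (real \<times> real \<times> real) list \<Rightarrow> (real \<times> real \<times> real) list" where
  "step_scale k ps = map (\<lambda>(c, a, b). (k * c, a, b)) ps"

lemma is_step_scale [simp]: "is_step ps \<Longrightarrow> is_step (step_scale k ps)"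
  by (auto simp: is_step_def step_scale_def)

lemma step_fun_scale: "step_fun (step_scale k ps) s = k * step_fun ps s"
  by (induction ps) (auto simp: step_fun_def step_scale_def algebra_simps)

lemma step_integral_scale: "step_integral V (step_scale k ps) \<omega> = k * step_integral V ps \<omega>"
  by (induction ps) (auto simp: step_integral_def step_scale_def algebra_simps)

text \<open>The indicator of (a, b] at s is the increment from a to b of the path t \<mapsto>
  \<open>of_bool (s \<le> t)\<close>. A step function is thus itself an elementary integral, and the
  regrouping along a grid is proved once, for an arbitrary integrator.\<close>

lemma step_fun_eq_step_integral:
  "is_step ps \<Longrightarrow> step_fun ps s = step_integral (\<lambda>t s. of_bool (s \<le> t)) ps s"
  by (induction ps) (auto simp: step_integral_def step_fun_def is_step_def indicator_def)

text \<open>The listed intervals may overlap, whereas independence concerns disjoint increments. On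
  a grid containing all end points each interval telescopes into cells. The value on a cell is read
  off at its right end point, because the intervals are left-open and right-closed.\<close>

lemma step_integral_grid:
  fixes t :: "nat \<Rightarrow> real"
  assumes mono: "\<And>i j. i < j \<Longrightarrow> j \<le> N \<Longrightarrow> t i < t j"
    and ps: "\<And>c a b. (c, a, b) \<in> set ps \<Longrightarrow> a \<le> b \<and> a \<in> t ` {..N} \<and> b \<in> t ` {..N}"
  shows "step_integral V ps \<omega> = (\<Sum>i<N. step_fun ps (t (Suc i)) * (V (t (Suc i)) \<omega> - V (t i) \<omega>))"
  using ps
proof (induction ps)
  case Nil
  then show ?case by (simp add: step_integral_def step_fun_def)
next
  case (Cons p ps)
  obtain c a b where p: "p = (c, a, b)" by (cases p)
  from Cons.prems[of c a b] obtain j k where jk: "a = t j" "b = t k" "j \<le> N" "k \<le> N" "a \<le> b"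
    by (auto simp: p)
  have less: "t i < t i' \<longleftrightarrow> i < i'" if "i \<le> N" "i' \<le> N" for i i'
    using mono[of i i'] mono[of i' i] that by (cases i i' rule: linorder_cases) auto
  have "j \<le> k" using jk less[of k j] by (meson not_le)
  have ind: "indicator {a<..b} (t (Suc i)) = (of_bool (j \<le> i \<and> i < k) :: real)" if "i < N" for i
    using less[of j "Suc i"] less[of k "Suc i"] that jk by (auto simp: indicator_def not_less)
  have "(\<Sum>i<N. indicator {a<..b} (t (Suc i)) * (V (t (Suc i)) \<omega> - V (t i) \<omega>))
      = (\<Sum>i<N. if i \<in> {j..<k} then V (t (Suc i)) \<omega> - V (t i) \<omega> else 0)"
    by (intro sum.cong) (auto simp: ind)
  also have "\<dots> = (\<Sum>i\<in>{j..<k}. V (t (Suc i)) \<omega> - V (t i) \<omega>)"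
    using jk by (subst sum.inter_restrict[symmetric]) (auto intro!: sum.cong)
  also have "\<dots> = V b \<omega> - V a \<omega>" using sum_Suc_diff'[OF \<open>j \<le> k\<close>, of "\<lambda>i. V (t i) \<omega>"] jk by simp
  finally have *: "V b \<omega> - V a \<omega> = (\<Sum>i<N. indicator {a<..b} (t (Suc i))
      * (V (t (Suc i)) \<omega> - V (t i) \<omega>))" by simp
  have IH: "step_integral V ps \<omega> = (\<Sum>i<N. step_fun ps (t (Suc i)) * (V (t (Suc i)) \<omega> - V (t i) \<omega>))"
    using Cons by auto
  have sf: "step_fun (p # ps) s = c * indicator {a<..b} s + step_fun ps s" for s
    by (simp add: step_fun_def p)
  have "step_integral V (p # ps) \<omega> = c * (V b \<omega> - V a \<omega>) + step_integral V ps \<omega>"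
    by (simp add: step_integral_def p)
  also have "\<dots> = (\<Sum>i<N. step_fun (p # ps) (t (Suc i)) * (V (t (Suc i)) \<omega> - V (t i) \<omega>))"
    unfolding * IH sf by (simp only: sum_distrib_left distrib_right sum.distrib mult.assoc)
  finally show ?case .
qed

lemma obtain_grid:
  assumes "is_step ps"
  obtains N and t :: "nat \<Rightarrow> real" where "\<And>i j. i < j \<Longrightarrow> j \<le> N \<Longrightarrow> t i < t j" "0 \<le> t 0" "t N \<le> 1"
    "\<And>c a b. (c, a, b) \<in> set ps \<Longrightarrow> a \<le> b \<and> a \<in> t ` {..N} \<and> b \<in> t ` {..N}"
proof -
  \<comment> \<open>The point 0 keeps the grid nonempty when \<open>ps\<close> is the empty
    list.\<close>
  define P where "P = insert 0 ((\<lambda>(c, a, b). a) ` set ps \<union> (\<lambda>(c, a, b). b) ` set ps)"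
  have P: "finite P" "P \<noteq> {}" "P \<subseteq> {0..1}"
    using assms by (auto simp: P_def is_step_def)
  define xs where "xs = sorted_list_of_set P"
  have xs: "set xs = P" "sorted_wrt (<) xs" "xs \<noteq> []" using P by (auto simp: xs_def)
  define N where "N = length xs - 1"
  have len: "length xs = Suc N" using xs(3) by (cases xs) (auto simp: N_def)
  have im: "(!) xs ` {..N} = P" using xs(1) len
      by (auto simp: set_conv_nth less_Suc_eq_le image_iff) 
  show ?thesis
  proof (rule that[of N "(!) xs"])
    show "xs ! i < xs ! j" if "i < j" "j \<le> N" for i j
      using sorted_wrt_nth_less[OF xs(2)] that len by auto
    show "0 \<le> xs ! 0" "xs ! N \<le> 1" using im P(3) by force+
    fix c a b assume *: "(c, a, b) \<in> set ps"
    have "a \<in> P" "b \<in> P" using * by (force simp: P_def)+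
    moreover have "a \<le> b" using * assms by (auto simp: is_step_def)
    ultimately show "a \<le> b \<and> a \<in> (!) xs ` {..N} \<and> b \<in> (!) xs ` {..N}" by (simp add: im)
  qed
qed

section \<open>Step functions as elements of L^2 of the unit interval\<close>

lemma finite_measure_unit: "finite_measure unit_interval_measure"
  by (rule finite_measureI) (simp add: emeasure_restrict_space)

lemma measurable_unit_borel: "f \<in> borel_measurable borel
    \<Longrightarrow> f \<in> borel_measurable unit_interval_measure"
  by (rule measurable_restrict_space1) (simp add: measurable_completion)

lemma integral_indicator_unit:
  assumes "0 \<le> a" "a \<le> b" "b \<le> 1"
  shows "has_bochner_integral unit_interval_measure (indicator {a<..b}) (b - a)"
proof -
  have s: "{a<..b} \<in> sets unit_interval_measure"
    using assms by (subst sets_restrict_space_iff) auto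
  have "emeasure unit_interval_measure {a<..b} = emeasure lebesgue {a<..b}"
    using assms by (subst emeasure_restrict_space) auto
  then have e: "emeasure unit_interval_measure {a<..b} = ennreal (b - a)" using assms by simp
  then have "measure unit_interval_measure {a<..b} = b - a" using assms by (simp add: measure_def)
  then show ?thesis using has_bochner_integral_real_indicator[OF s] e by simp
qed

lemma step_fun_measurable: "step_fun ps \<in> borel_measurable borel"
proof (induction ps)
  case (Cons p ps)
  have "step_fun (p # ps) = (\<lambda>s. fst p * indicator {fst (snd p)<..snd (snd p)} s + step_fun ps s)"
    by (auto simp: step_fun_def split: prod.split)
  moreover have "\<dots> \<in> borel_measurable borel" using Cons by (intro borel_measurable_add) auto
  ultimately show ?case by metis
qed (simp add: step_fun_def[abs_def])

lemma step_fun_bounded: "\<exists>B. \<forall>s. \<bar>step_fun ps s\<bar> \<le> B"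
proof (induction ps)
  case (Cons p ps)
  then obtain B where B: "\<And>s. \<bar>step_fun ps s\<bar> \<le> B" by auto
  have "\<bar>step_fun (p # ps) s\<bar> \<le> \<bar>fst p\<bar> + B" for s
    using B[of s] by (cases p) (auto simp: step_fun_def indicator_def)
  then show ?case by blast
qed (auto simp: step_fun_def)

lemma step_fun_L2: "step_fun ps \<in> L2_01"
  using step_fun_bounded[of ps] L2_space_bounded[OF finite_measure_unit
    measurable_unit_borel[OF step_fun_measurable]]
  by blast

text \<open>Distinct cells are disjoint, so the cross terms of the square vanish. The right-hand
  side is written over the same grid as the variance of the step integral, so that the two can be
  compared term by term.\<close>

lemma inner_step_fun_grid:
  assumes ps: "is_step ps" and mono: "\<And>i j. i < j \<Longrightarrow> j \<le> N \<Longrightarrow> t i < t j" and t: "0 \<le> t 0" "t N \<le> 1"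
    and grid: "\<And>c a b. (c, a, b) \<in> set ps \<Longrightarrow> a \<le> b \<and> a \<in> t ` {..N} \<and> b \<in> t ` {..N}"
  shows "inner_01 (step_fun ps) (step_fun ps) = (\<Sum>i<N. (step_fun ps (t (Suc i)))\<^sup>2
      * (t (Suc i) - t i))"
proof -
  define c where "c i = step_fun ps (t (Suc i))" for i
  define I where "I i = {t i<..t (Suc i)}" for i
  have le: "t i \<le> t j" if "i \<le> j" "j \<le> N" for i j using mono[of i j] that by (cases "i = j") auto
  have sf: "step_fun ps s = (\<Sum>i<N. c i * indicator (I i) s)" for s
  proof -
    have "step_fun ps s = step_integral (\<lambda>t s. of_bool (s \<le> t)) ps s"
      by (rule step_fun_eq_step_integral[OF ps])
    also have "\<dots> = (\<Sum>i<N. c i * (of_bool (s \<le> t (Suc i)) - of_bool (s \<le> t i)))"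
      unfolding c_def by (rule step_integral_grid[OF mono grid])
    also have "\<dots> = (\<Sum>i<N. c i * indicator (I i) s)"
    proof (intro sum.cong refl)
      fix i assume "i \<in> {..<N}"
      then have "t i < t (Suc i)" using mono by auto
      then show "c i * (of_bool (s \<le> t (Suc i)) - of_bool (s \<le> t i)) = c i * indicator (I i) s"
        by (auto simp: I_def indicator_def)
    qed
    finally show ?thesis .
  qed
  have disj: "indicator (I i) s * indicator (I j) s = (0::real)" if "i < N" "j < N" "i \<noteq> j"
      for i j s
    using le[of "Suc i" j] le[of "Suc j" i] that
    by (cases i j rule: linorder_cases) (auto simp: I_def indicator_def Suc_le_eq)
  have sq: "step_fun ps s * step_fun ps s = (\<Sum>i<N. (c i)\<^sup>2 * indicator (I i) s)" for s
  proof -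
    have "step_fun ps s * step_fun ps s = (\<Sum>i<N. \<Sum>j<N. (c i * c j)
        * (indicator (I i) s * indicator (I j) s))"
      unfolding sf sum_product by (intro sum.cong) (auto simp: mult_ac)
    also have "\<dots> = (\<Sum>i<N. \<Sum>j<N. if i = j then (c i)\<^sup>2 * indicator (I i) s else 0)"
      using disj by (intro sum.cong refl) (auto simp: power2_eq_square indicator_def)
    also have "\<dots> = (\<Sum>i<N. (c i)\<^sup>2 * indicator (I i) s)" by simp
    finally show ?thesis .
  qed
  have "has_bochner_integral unit_interval_measure (\<lambda>s. \<Sum>i<N. (c i)\<^sup>2
      * indicator (I i) s) (\<Sum>i<N. (c i)\<^sup>2 * (t (Suc i) - t i))"
  proof (intro has_bochner_integral_sum has_bochner_integral_mult_right)
    fix i assume "i \<in> {..<N}"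
    then show "has_bochner_integral unit_interval_measure (indicator (I i)) (t (Suc i) - t i)"
      unfolding I_def using le[of 0 i] le[of "Suc i" N] le[of i "Suc i"] t
        by (intro integral_indicator_unit) auto
  qed
  then show ?thesis unfolding inner_01_def sq c_def by (simp add: has_bochner_integral_iff)
qed

lemma brownian_motionD:
  assumes "brownian_motion M W"
  shows "prob_space M" "\<And>t. t \<in> {0..1} \<Longrightarrow> W t \<in> borel_measurable M" "AE \<omega> in M. W 0 \<omega> = 0"
  using assms by (auto simp: brownian_motion_def)

text \<open>Along a grid the integral is a weighted sum of independent Gaussian increments. That its
  variance is the squared norm of the step function is the isometry for elementary
  integrands.\<close>

lemma centered_gaussian_step_integral:
  assumes bm: "brownian_motion M W" and ps: "is_step ps"
  shows "centered_gaussian M (step_integral W ps) (inner_01 (step_fun ps) (step_fun ps))"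
proof -
  interpret prob_space M using bm by (rule brownian_motionD)
  obtain N and t :: "nat \<Rightarrow> real" where t: "\<And>i j. i < j \<Longrightarrow> j \<le> N \<Longrightarrow> t i < t j" "0 \<le> t 0" "t N \<le> 1"
    "\<And>c a b. (c, a, b) \<in> set ps \<Longrightarrow> a \<le> b \<and> a \<in> t ` {..N} \<and> b \<in> t ` {..N}"
    using obtain_grid[OF ps] by metis
  have le: "t i \<le> t j" if "i \<le> j" "j \<le> N" for i j using t(1)[of i j] that by (cases "i = j") auto
  have ind: "indep_vars (\<lambda>_. borel) (\<lambda>i \<omega>. W (t (Suc i)) \<omega> - W (t i) \<omega>) {..<N}"
    using bm le t(2,3) unfolding brownian_motion_def by auto
  define c where "c = (\<lambda>i. step_fun ps (t (Suc i)))"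
  have si: "step_integral W ps = (\<lambda>\<omega>. \<Sum>i<N. c i * (W (t (Suc i)) \<omega> - W (t i) \<omega>))"
    unfolding c_def by (intro ext step_integral_grid[OF t(1) t(4)])
  have "centered_gaussian M (\<lambda>\<omega>. \<Sum>i<N. c i * (W (t (Suc i)) \<omega> - W (t i) \<omega>)) (\<Sum>i<N. (c i)\<^sup>2
      * (t (Suc i) - t i))"
  proof (rule centered_gaussian_sum)
    show "indep_vars (\<lambda>_. borel) (\<lambda>i \<omega>. c i * (W (t (Suc i)) \<omega> - W (t i) \<omega>)) {..<N}"
      using ind by (rule indep_vars_compose2[where Y="\<lambda>i x. c i * x"]) simp
    fix i assume "i \<in> {..<N}"
    then have i: "0 \<le> t i" "t i < t (Suc i)" "t (Suc i) \<le> 1"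
      using le[of 0 i] t(1)[of i "Suc i"] le[of "Suc i" N] t(2,3) by auto
    then have "distributed M lborel (\<lambda>\<omega>. W (t (Suc i)) \<omega>
        - W (t i) \<omega>) (normal_density 0 (sqrt (t (Suc i) - t i)))"
      using bm unfolding brownian_motion_def by blast
    from centered_gaussian_normal[OF this] i
    have "centered_gaussian M (\<lambda>\<omega>. W (t (Suc i)) \<omega> - W (t i) \<omega>) (t (Suc i) - t i)" by simp
    then show "centered_gaussian M (\<lambda>\<omega>. c i * (W (t (Suc i)) \<omega> - W (t i) \<omega>)) ((c i)\<^sup>2
        * (t (Suc i) - t i))"
      by (rule centered_gaussian_scale)
  qed
  moreover have "inner_01 (step_fun ps) (step_fun ps) = (\<Sum>i<N. (c i)\<^sup>2 * (t (Suc i) - t i))"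
    unfolding c_def by (rule inner_step_fun_grid[OF ps t])
  ultimately show ?thesis unfolding si by simp
qed

subsection \<open>Density of step functions\<close>

lemma L2_tendsto_dominated:
  assumes [measurable]: "\<And>n. hs n \<in> borel_measurable M" "f \<in> borel_measurable M"
    and w: "w \<in> L2_space M" and conv: "AE x in M. (\<lambda>n. hs n x) \<longlonglongrightarrow> f x"
    and bound: "\<And>n. AE x in M. \<bar>hs n x\<bar> \<le> w x" "AE x in M. \<bar>f x\<bar> \<le> w x"
  shows "L2_tendsto M hs f"
proof -
  note [measurable] = L2_spaceD(1)[OF w]
  have sq: "integrable M (\<lambda>x. (h x)\<^sup>2)" if [measurable]: "h \<in> borel_measurable M"
      and h: "AE x in M. \<bar>h x\<bar> \<le> w x" for h
    by (rule Bochner_Integration.integrable_bound[OF L2_spaceD(2)[OF w]])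
       (use h in \<open>auto elim!: eventually_mono simp: abs_le_square_iff[symmetric]\<close>)
  have "(\<lambda>n. \<integral>x. (hs n x - f x)\<^sup>2 \<partial>M) \<longlonglongrightarrow> (\<integral>x. 0 \<partial>M)"
  proof (rule integral_dominated_convergence)
    show "integrable M (\<lambda>x. 4 * (w x)\<^sup>2)" using L2_spaceD(2)[OF w] by simp
    show "AE x in M. (\<lambda>n. (hs n x - f x)\<^sup>2) \<longlonglongrightarrow> 0"
      using conv
    proof eventually_elim
      case (elim x)
      then have "(\<lambda>n. (hs n x - f x)\<^sup>2) \<longlonglongrightarrow> (f x - f x)\<^sup>2" by (intro tendsto_intros)
      then show ?case by simp
    qed
    show "AE x in M. norm ((hs n x - f x)\<^sup>2) \<le> 4 * (w x)\<^sup>2" for n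
      using bound(1)[of n] bound(2)
    proof eventually_elim
      case (elim x)
      then have "\<bar>hs n x - f x\<bar> \<le> \<bar>2 * w x\<bar>" by linarith
      then have "(hs n x - f x)\<^sup>2 \<le> (2 * w x)\<^sup>2" by (simp only: abs_le_square_iff)
      then show ?case by (simp add: power_mult_distrib)
    qed
  qed measurable
  then show ?thesis using sq bound by (auto simp: L2_tendsto_def L2_space_def)
qed

text \<open>Density of step functions, formulated for a single f. It is informative when the squared
  difference is integrable, since a non-integrable function has integral 0 by convention.\<close>

definition step_approximable :: "(real \<Rightarrow> real) \<Rightarrow> bool" where
  "step_approximable f \<longleftrightarrow> (\<forall>e>0. \<exists>ps. is_step ps
    \<and> (\<integral>s. (step_fun ps s - f s)\<^sup>2 \<partial>unit_interval_measure) < e)"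

lemma step_approximable_limit:
  assumes lim: "L2_tendsto unit_interval_measure hs f" and hs: "\<And>n. step_approximable (hs n)"
  shows "step_approximable f"
  unfolding step_approximable_def
proof (intro allI impI)
  fix e :: real assume e: "e > 0"
  have "\<forall>\<^sub>F n in sequentially. (\<integral>s. (hs n s - f s)\<^sup>2 \<partial>unit_interval_measure) < e / 4"
    using lim e unfolding L2_tendsto_def by (intro order_tendstoD(2)[where y=0]) auto
  then obtain n where n: "(\<integral>s. (hs n s - f s)\<^sup>2 \<partial>unit_interval_measure) < e / 4"
    using eventually_happens'[OF sequentially_bot] by blast
  obtain ps where ps: "is_step ps" "(\<integral>s. (step_fun ps s - hs n s)\<^sup>2 \<partial>unit_interval_measure) < e / 4"
    using hs[of n] e unfolding step_approximable_def by (meson divide_pos_pos zero_less_numeral)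
  have L: "(\<lambda>s. step_fun ps s - hs n s) \<in> L2_01" "(\<lambda>s. hs n s - f s) \<in> L2_01"
    using lim by (auto simp: L2_tendsto_def intro!: L2_space_diff step_fun_L2)
  have "(\<integral>s. (step_fun ps s - f s)\<^sup>2 \<partial>unit_interval_measure) < e"
    using L2_integral_power2_lin_le[OF L, of 1 1] n ps(2) by simp
  then show "\<exists>ps. is_step ps \<and> (\<integral>s. (step_fun ps s - f s)\<^sup>2 \<partial>unit_interval_measure) < e"
    using ps(1) by blast
qed

lemma step_approximable_limit_step:
  assumes "L2_tendsto unit_interval_measure (\<lambda>n. step_fun (p n)) f" "\<And>n. is_step (p n)"
  shows "step_approximable f"
proof (rule step_approximable_limit[OF assms(1)])
  fix n show "step_approximable (step_fun (p n))"
    unfolding step_approximable_def using assms(2)[of n] by (auto intro!: exI[of _ "p n"])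
qed

text \<open>Left-open cells inside [0,1] cover (0,1] but never the point 0; this is the null set to
  be discarded.\<close>

lemma AE_unit_pos: "AE s in unit_interval_measure. 0 < s \<and> s \<le> 1"
proof -
  have "{0} \<in> null_sets unit_interval_measure"
    by (simp add: null_sets_restrict_space)
  then have "AE s in unit_interval_measure. s \<notin> {0}" by (rule AE_not_in)
  then show ?thesis using AE_space by eventually_elim auto
qed

lemma step_approximable_continuous:
  assumes g: "continuous_on UNIV g"
  shows "step_approximable g"
proof -
  define p where "p n = map (\<lambda>k. (g (real (Suc k) / real (Suc n)), real k
      / real (Suc n), real (Suc k) / real (Suc n))) [0..<Suc n]" for n
  have st: "is_step (p n)" for n
    by (auto simp: p_def is_step_def divide_right_mono)
  \<comment> \<open>\<open>p n\<close> samples g at the right end of each cell of length 1/(n+1);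
    for a point s that end is obtained by rounding (n+1) s up to an integer.\<close>
  have val: "step_fun (p n) s = g (real_of_int \<lceil>real (Suc n) * s\<rceil> / real (Suc n))"
      if s: "0 < s" "s \<le> 1" for n s
  proof -
    define k where "k = nat (\<lceil>real (Suc n) * s\<rceil> - 1)"
    have pos: "0 < real (Suc n) * s" using s by simp
    then have c: "\<lceil>real (Suc n) * s\<rceil> \<ge> 1" by linarith
    have "real (Suc n) * s \<le> real (Suc n)" using s by (simp add: mult_left_le)
    then have c2: "\<lceil>real (Suc n) * s\<rceil> \<le> int (Suc n)" by linarith
    have k: "k < Suc n" "real (Suc k) = real_of_int \<lceil>real (Suc n) * s\<rceil>"
      using c c2 unfolding k_def by linarith+
    have ind: "indicator {real j / real (Suc n)<..real (Suc j) / real (Suc n)} s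
        = (of_bool (j = k) :: real)" for j
    proof -
      have "real j / real (Suc n) < s \<longleftrightarrow> real j < real (Suc n) * s" by (simp add: field_simps)
      moreover have "s \<le> real (Suc j) / real (Suc n) \<longleftrightarrow> real (Suc n) * s \<le> real (Suc j)"
        by (simp add: field_simps)
      moreover have "(real j < real (Suc n) * s \<and> real (Suc n) * s \<le> real (Suc j)) \<longleftrightarrow> j = k"
        using k(2) by linarith
      ultimately show ?thesis by (auto simp: indicator_def)
    qed
    have "step_fun (p n) s = (\<Sum>j\<in>{0..<Suc n}. g (real (Suc j) / real (Suc n)) * of_bool (j = k))"
      unfolding step_fun_def p_def map_map o_def split_def fst_conv snd_conv ind
      by (subst interv_sum_list_conv_sum_set_nat) simp
    also have "\<dots> = g (real (Suc k) / real (Suc n))"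
      using k(1) by (simp add: of_bool_def if_distrib[of "\<lambda>x. _ * x"] cong: if_cong del:
        sum.op_ivl_Suc of_nat_Suc)
    finally show ?thesis by (simp only: k(2))
  qed
  have "compact (g ` {0..1})" using g
      by (intro compact_continuous_image) (auto intro: continuous_on_subset)
  then have "bounded (g ` {0..1})" by (rule compact_imp_bounded)
  then have "\<exists>B. \<forall>s\<in>{0..1}. \<bar>g s\<bar> \<le> B" unfolding bounded_iff by simp
  then obtain B where "\<forall>s\<in>{0..1}. \<bar>g s\<bar> \<le> B" ..
  then have B: "\<bar>g s\<bar> \<le> B" if "s \<in> {0..1}" for s using that by blast
  have unit: "real_of_int \<lceil>real (Suc n) * s\<rceil> / real (Suc n) \<in> {0..1}" if s: "0 < s" "s \<le> 1" for n s
  proof -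
    have "real (Suc n) * s \<le> real (Suc n)" using s by (simp add: mult_left_le)
    then have "\<lceil>real (Suc n) * s\<rceil> \<le> int (Suc n)" by linarith
    moreover have "0 < real (Suc n) * s" using s by simp
    then have "\<lceil>real (Suc n) * s\<rceil> \<ge> 0" by linarith
    ultimately show ?thesis by (simp add: divide_le_eq)
  qed
  have "L2_tendsto unit_interval_measure (\<lambda>n. step_fun (p n)) g"
  proof (rule L2_tendsto_dominated[where w="\<lambda>_. B"])
    show "step_fun (p n) \<in> borel_measurable unit_interval_measure" for n
      by (rule measurable_unit_borel[OF step_fun_measurable])
    show "g \<in> borel_measurable unit_interval_measure"
      by (rule measurable_unit_borel[OF borel_measurable_continuous_onI[OF g]])
    show "(\<lambda>_. B) \<in> L2_01" by (rule L2_space_bounded[OF finite_measure_unit, where B="\<bar>B\<bar>"]) auto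
    show "AE x in unit_interval_measure. \<bar>step_fun (p n) x\<bar> \<le> B" for n
      using AE_unit_pos by eventually_elim (simp only: val B unit)
    show "AE x in unit_interval_measure. \<bar>g x\<bar> \<le> B"
      using AE_unit_pos by eventually_elim (auto intro: B)
    show "AE x in unit_interval_measure. (\<lambda>n. step_fun (p n) x) \<longlonglongrightarrow> g x"
      using AE_unit_pos
    proof eventually_elim
      case (elim s)
      have "(\<lambda>n. real_of_int \<lceil>real (Suc n) * s\<rceil> / real (Suc n)) \<longlonglongrightarrow> s"
      proof (rule tendsto_sandwich[where f="\<lambda>_. s" and h="\<lambda>n. s + 1 / real (Suc n)"])
        show "\<forall>\<^sub>F n in sequentially. s \<le> real_of_int \<lceil>real (Suc n) * s\<rceil> / real (Suc n)"
        proof (intro always_eventually allI)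
          fix n
          have "real (Suc n) * s \<le> real_of_int \<lceil>real (Suc n) * s\<rceil>" by linarith
          then show "s \<le> real_of_int \<lceil>real (Suc n) * s\<rceil> / real (Suc n)" by (simp add: field_simps)
        qed
        show "\<forall>\<^sub>F n in sequentially. real_of_int \<lceil>real (Suc n) * s\<rceil> / real (Suc n)
            \<le> s + 1 / real (Suc n)"
        proof (intro always_eventually allI)
          fix n
          have "real_of_int \<lceil>real (Suc n) * s\<rceil> \<le> real (Suc n) * s + 1" by linarith
          then have "real_of_int \<lceil>real (Suc n) * s\<rceil> / real (Suc n)
              \<le> (real (Suc n) * s + 1) / real (Suc n)"
            by (intro divide_right_mono) auto
          also have "\<dots> = s + 1 / real (Suc n)" by (simp add: add_divide_distrib del: of_nat_Suc)
          finally show "real_of_int \<lceil>real (Suc n) * s\<rceil> / real (Suc n) \<le> s + 1 / real (Suc n)" .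
        qed
        have "(\<lambda>n. s + 1 / real (Suc n)) \<longlonglongrightarrow> s + 0"
          by (intro tendsto_intros LIMSEQ_Suc[OF lim_1_over_n])
        then show "(\<lambda>n. s + 1 / real (Suc n)) \<longlonglongrightarrow> s" by simp
      qed auto
      then have "(\<lambda>n. g (real_of_int \<lceil>real (Suc n) * s\<rceil> / real (Suc n))) \<longlonglongrightarrow> g s"
        using g by (intro isCont_tendsto_compose[where g=g])
          (auto simp: continuous_on_eq_continuous_at)
      then show ?case using elim by (simp only: val)
    qed
  qed
  then show ?thesis using st by (rule step_approximable_limit_step)
qed

text \<open>Measurability supplies continuous functions that converge to f off a negligible set.
  Truncating them at K keeps them continuous and provides the bound for dominated
  convergence.\<close>

lemma step_approximable_bounded:
  assumes f: "f \<in> borel_measurable unit_interval_measure" and K: "\<And>s. \<bar>f s\<bar> \<le> K"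
  shows "step_approximable f"
proof -
  have "f measurable_on {0..1}"
    using f by (simp add: measurable_on_iff_borel_measurable)
  then obtain N g where N: "negligible N" and g: "\<And>n. continuous_on UNIV (g n)"
    and lim: "\<And>x. x \<notin> N \<Longrightarrow> (\<lambda>n. g n x) \<longlonglongrightarrow> (if x \<in> {0..1} then f x else 0)"
    unfolding measurable_on_def by blast
  define h where "h n s = max (-K) (min K (g n s))" for n s
  have h: "continuous_on UNIV (h n)" for n
    unfolding h_def by (intro continuous_intros g)
  have K0: "K \<ge> 0" using K[of 0] by linarith
  have "L2_tendsto unit_interval_measure h f"
  proof (rule L2_tendsto_dominated[where w="\<lambda>_. K"])
    show "h n \<in> borel_measurable unit_interval_measure" for n
      by (rule measurable_unit_borel[OF borel_measurable_continuous_onI[OF h]])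
    show "(\<lambda>_. K) \<in> L2_01" by (rule L2_space_bounded[OF finite_measure_unit, where B="\<bar>K\<bar>"]) auto
    show "AE x in unit_interval_measure. \<bar>h n x\<bar> \<le> K" for n
      using K0 by (intro AE_I2) (auto simp: h_def)
    show "AE x in unit_interval_measure. \<bar>f x\<bar> \<le> K" using K by simp
    have "N \<inter> {0..1} \<in> null_sets unit_interval_measure"
      using N by (subst null_sets_restrict_space) (auto simp: negligible_iff_null_sets intro:
        null_set_Int2)
    then have "AE x in unit_interval_measure. x \<notin> N \<inter> {0..1}" by (rule AE_not_in)
    then show "AE x in unit_interval_measure. (\<lambda>n. h n x) \<longlonglongrightarrow> f x"
      using AE_space
    proof eventually_elim
      case (elim x)
      then have "x \<notin> N" "x \<in> {0..1}" by auto
      then have "(\<lambda>n. g n x) \<longlonglongrightarrow> f x" using lim[of x] by simp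
      then have "(\<lambda>n. h n x) \<longlonglongrightarrow> max (-K) (min K (f x))"
        unfolding h_def by (intro tendsto_max tendsto_min tendsto_const)
      then show ?case using K[of x] by (simp add: abs_le_iff max_def min_def split: if_splits)
    qed
  qed fact
  then show ?thesis by (rule step_approximable_limit) (rule step_approximable_continuous[OF h])
qed

lemma step_approximable_L2:
  assumes f: "f \<in> L2_01"
  shows "step_approximable f"
proof -
  note [measurable] = L2_spaceD(1)[OF f]
  define h where "h n s = max (- real n) (min (real n) (f s))" for n s
  have [measurable]: "h n \<in> borel_measurable unit_interval_measure" for n unfolding h_def
      by measurable
  have "L2_tendsto unit_interval_measure h f"
  proof (rule L2_tendsto_dominated[where w="\<lambda>s. \<bar>f s\<bar>"])
    show "(\<lambda>s. \<bar>f s\<bar>) \<in> L2_01" using f by (auto simp: L2_space_def)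
    show "AE x in unit_interval_measure. \<bar>h n x\<bar> \<le> \<bar>f x\<bar>" for n
      by (intro AE_I2) (auto simp: h_def)
    show "AE x in unit_interval_measure. (\<lambda>n. h n x) \<longlonglongrightarrow> f x"
    proof (intro AE_I2)
      fix x
      obtain N :: nat where N: "\<bar>f x\<bar> \<le> real N" using real_arch_simple by blast
      have "h n x = f x" if "n \<ge> N" for n
      proof -
        have "\<bar>f x\<bar> \<le> real n" using N that by (meson of_nat_mono order_trans)
        then show ?thesis by (auto simp: h_def)
      qed
      then show "(\<lambda>n. h n x) \<longlonglongrightarrow> f x"
        by (intro tendsto_eventually eventually_sequentiallyI[of N])
    qed
    show "h n \<in> borel_measurable unit_interval_measure"
        "f \<in> borel_measurable unit_interval_measure" for n
      by measurable
  qed simp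
  then show ?thesis
  proof (rule step_approximable_limit)
    show "step_approximable (h n)" for n
      by (rule step_approximable_bounded[where K="real n"]) (measurable, auto simp: h_def)
  qed
qed

subsection \<open>The Wiener integral\<close>

lemma inner_self: "inner_01 f f = (\<integral>s. (f s)\<^sup>2 \<partial>unit_interval_measure)"
  by (simp add: inner_01_def power2_eq_square)

lemma inner_self_nonneg: "inner_01 f f \<ge> 0"
  unfolding inner_self by (intro Bochner_Integration.integral_nonneg) simp

lemma inner_commute: "inner_01 f g = inner_01 g f"
  by (simp add: inner_01_def mult.commute)

lemma inner_sum_left:
  assumes "\<And>i. i \<in> A \<Longrightarrow> u i \<in> L2_01" "h \<in> L2_01"
  shows "inner_01 (\<lambda>s. \<Sum>i\<in>A. c i * u i s) h = (\<Sum>i\<in>A. c i * inner_01 (u i) h)"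
proof -
  have "(\<integral>s. (\<Sum>i\<in>A. c i * u i s) * h s \<partial>unit_interval_measure)
      = (\<integral>s. (\<Sum>i\<in>A. c i * (u i s * h s)) \<partial>unit_interval_measure)"
    by (simp add: sum_distrib_right mult.assoc)
  also have "\<dots> = (\<Sum>i\<in>A. \<integral>s. c i * (u i s * h s) \<partial>unit_interval_measure)"
    by (rule Bochner_Integration.integral_sum)
       (auto intro!: L2_mult_integrable assms Bochner_Integration.integrable_mult_right)
  finally show ?thesis by (simp add: inner_01_def)
qed

lemma inner_sum_sum:
  assumes "\<And>i. i \<in> A \<Longrightarrow> u i \<in> L2_01"
  shows "inner_01 (\<lambda>s. \<Sum>i\<in>A. c i * u i s) (\<lambda>s. \<Sum>i\<in>A. c i * u i s)
      = (\<Sum>i\<in>A. \<Sum>j\<in>A. c i * c j * inner_01 (u i) (u j))"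
proof -
  have L: "(\<lambda>s. \<Sum>i\<in>A. c i * u i s) \<in> L2_01" using assms by (rule L2_space_sum)
  have "inner_01 (u i) (\<lambda>s. \<Sum>i\<in>A. c i * u i s) = (\<Sum>j\<in>A. c j * inner_01 (u i) (u j))" if "i \<in> A"
      for i
    by (subst inner_commute, subst inner_sum_left)
      (auto intro: assms that sum.cong simp: inner_commute)
  then show ?thesis
    by (subst inner_sum_left[OF assms L]) (auto simp: sum_distrib_left mult.assoc)
qed

text \<open>The relation inside the \<open>SOME\<close> of \<open>wiener_integral\<close>. Results
  proved for it hold for every representative, in particular for linear combinations and for the
  version built from the grid values of W alone.\<close>

definition is_wiener_integral ::
    "'a measure \<Rightarrow> (real \<Rightarrow> 'a \<Rightarrow> real) \<Rightarrow> (real \<Rightarrow> real) \<Rightarrow> ('a \<Rightarrow> real) \<Rightarrow> bool" where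
  "is_wiener_integral M W f X \<longleftrightarrow> (\<exists>p. (\<forall>n. is_step (p n)) \<and>
     L2_tendsto unit_interval_measure (\<lambda>n. step_fun (p n)) f \<and>
     L2_tendsto M (\<lambda>n. step_integral W (p n)) X)"

lemma is_wiener_integral_lin:
  assumes "is_wiener_integral M W f X" "is_wiener_integral M W g Y"
  shows "is_wiener_integral M W (\<lambda>s. a * f s + b * g s) (\<lambda>\<omega>. a * X \<omega> + b * Y \<omega>)"
proof -
  from assms obtain p q where p: "\<And>n. is_step (p n)"
    "L2_tendsto unit_interval_measure (\<lambda>n. step_fun (p n)) f"
     "L2_tendsto M (\<lambda>n. step_integral W (p n)) X"
    and q: "\<And>n. is_step (q n)" "L2_tendsto unit_interval_measure (\<lambda>n. step_fun (q n)) g"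
     "L2_tendsto M (\<lambda>n. step_integral W (q n)) Y"
    unfolding is_wiener_integral_def by auto
  define r where "r n = step_scale a (p n) @ step_scale b (q n)" for n
  have "step_fun (r n) = (\<lambda>s. a * step_fun (p n) s + b * step_fun (q n) s)"
    "step_integral W (r n) = (\<lambda>s. a * step_integral W (p n) s + b * step_integral W (q n) s)" for n
    by (auto simp: r_def step_fun_append step_fun_scale step_integral_append step_integral_scale)
  then show ?thesis unfolding is_wiener_integral_def
    using L2_tendsto_lin[OF p(2) q(2), of a b] L2_tendsto_lin[OF p(3) q(3), of a b] p(1) q(1)
    by (intro exI[of _ r]) (auto simp: r_def)
qed

lemma is_wiener_integral_L2:
  "is_wiener_integral M W f X \<Longrightarrow> f \<in> L2_01" "is_wiener_integral M W f X \<Longrightarrow> X \<in> L2_space M"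
  by (auto simp: is_wiener_integral_def L2_tendsto_def)

lemma is_wiener_integral_cong_AE:
  assumes "is_wiener_integral M W f X" "AE \<omega> in M. X \<omega> = X' \<omega>" "X' \<in> borel_measurable M"
  shows "is_wiener_integral M W f X'"
  using assms L2_tendsto_AE_cong unfolding is_wiener_integral_def by metis

locale brownian =
  fixes M :: "'a measure" and W :: "real \<Rightarrow> 'a \<Rightarrow> real"
  assumes bm: "brownian_motion M W"

sublocale brownian \<subseteq> prob_space M
  using bm by (rule brownian_motionD)

context brownian
begin

lemma W_measurable: "t \<in> {0..1} \<Longrightarrow> W t \<in> borel_measurable M"
  using bm by (rule brownian_motionD)

lemma step_integral_L2:
  assumes "is_step ps"
  shows "step_integral W ps \<in> L2_space M"
    "(\<integral>\<omega>. (step_integral W ps \<omega>)\<^sup>2 \<partial>M) = (\<integral>s. (step_fun ps s)\<^sup>2 \<partial>unit_interval_measure)"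
  using centered_gaussian_moments(3,4)[OF centered_gaussian_step_integral[OF bm assms]
    inner_self_nonneg]
    centered_gaussian_step_integral[OF bm assms]
  by (auto simp: L2_space_def inner_self centered_gaussian_def)

lemma is_wiener_integral_step:
  assumes "is_step ps"
  shows "is_wiener_integral M W (step_fun ps) (step_integral W ps)"
  unfolding is_wiener_integral_def
  using assms by (intro exI[of _ "\<lambda>_. ps"]) (auto intro!: L2_tendsto_const step_fun_L2
    step_integral_L2)

lemma is_wiener_integral_zero: "is_wiener_integral M W (\<lambda>_. 0) (\<lambda>_. 0)"
  using is_wiener_integral_step[of "[]"]
    by (simp add: is_step_def step_fun_def[abs_def] step_integral_def[abs_def])

lemma is_wiener_integral_sum:
  assumes "\<And>i. i \<in> A \<Longrightarrow> is_wiener_integral M W (u i) (X i)"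
  shows "is_wiener_integral M W (\<lambda>s. \<Sum>i\<in>A. c i * u i s) (\<lambda>\<omega>. \<Sum>i\<in>A. c i * X i \<omega>)"
  using assms
proof (induction A rule: infinite_finite_induct)
  case (insert j A)
  then show ?case
    using is_wiener_integral_lin[of M W "u j" "X j" "\<lambda>s. \<Sum>i\<in>A. c i * u i s" "\<lambda>\<omega>. \<Sum>i\<in>A. c i
      * X i \<omega>" "c j" 1] by simp
qed (simp_all add: is_wiener_integral_zero)

lemma is_wiener_integral_gaussian:
  assumes "is_wiener_integral M W f X"
  shows "centered_gaussian M X (inner_01 f f)"
proof -
  from assms obtain p where p: "\<And>n. is_step (p n)"
    "L2_tendsto unit_interval_measure (\<lambda>n. step_fun (p n)) f"
     "L2_tendsto M (\<lambda>n. step_integral W (p n)) X"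
    unfolding is_wiener_integral_def by auto
  show ?thesis
  proof (rule centered_gaussian_limit[OF p(3)])
    show "centered_gaussian M (step_integral W (p n))
        (inner_01 (step_fun (p n)) (step_fun (p n)))" for n
      by (rule centered_gaussian_step_integral[OF bm p(1)])
    show "(\<lambda>n. inner_01 (step_fun (p n)) (step_fun (p n))) \<longlonglongrightarrow> inner_01 f f"
      unfolding inner_01_def by (rule L2_tendsto_integral_mult[OF p(2) p(2)])
  qed
qed

text \<open>The difference of two candidates is a Wiener integral of 0, hence centered Gaussian with
  variance 0. The approximating step functions of the two may be different.\<close>

lemma is_wiener_integral_AE_unique:
  assumes "is_wiener_integral M W f X" "is_wiener_integral M W f Y"
  shows "AE \<omega> in M. X \<omega> = Y \<omega>"
proof -
  have "is_wiener_integral M W (\<lambda>s. 0) (\<lambda>\<omega>. X \<omega> - Y \<omega>)"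
    using is_wiener_integral_lin[OF assms, of 1 "-1"] by simp
  from centered_gaussian_zero[of "\<lambda>\<omega>. X \<omega> - Y \<omega>"] is_wiener_integral_gaussian[OF this]
  have "AE \<omega> in M. X \<omega> - Y \<omega> = 0" by (simp add: inner_01_def)
  then show ?thesis by simp
qed

text \<open>Step functions that approximate f form a Cauchy sequence, and the isometry transports
  this to their integrals.\<close>

lemma is_wiener_integral_exists:
  assumes f: "f \<in> L2_01"
  shows "\<exists>X. is_wiener_integral M W f X"
proof -
  define U where "U = unit_interval_measure"
  have "\<exists>ps. is_step ps \<and> (\<integral>s. (step_fun ps s - f s)\<^sup>2 \<partial>U) < 1 / real (Suc n)" for n
    using step_approximable_L2[OF f] unfolding step_approximable_def U_def by simp
  then obtain p where p: "\<And>n. is_step (p n)" "\<And>n. (\<integral>s. (step_fun (p n) s - f s)\<^sup>2 \<partial>U)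
      < 1 / real (Suc n)"
    by metis
  have L: "(\<lambda>s. step_fun (p n) s - f s) \<in> L2_space U" for n
    unfolding U_def by (intro L2_space_diff step_fun_L2 f)
  have lim: "L2_tendsto U (\<lambda>n. step_fun (p n)) f"
    unfolding L2_tendsto_def
  proof (intro conjI allI)
    show "(\<lambda>n. \<integral>s. (step_fun (p n) s - f s)\<^sup>2 \<partial>U) \<longlonglongrightarrow> 0"
    proof (rule Lim_null_comparison)
      show "\<forall>\<^sub>F n in sequentially. norm (\<integral>s. (step_fun (p n) s - f s)\<^sup>2 \<partial>U) \<le> 1 / real (Suc n)"
        using p(2) by (intro always_eventually allI) (simp add: less_imp_le)
      show "(\<lambda>n. 1 / real (Suc n)) \<longlonglongrightarrow> 0" by (rule LIMSEQ_Suc[OF lim_1_over_n])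
    qed
  qed (use f in \<open>auto simp: U_def step_fun_L2\<close>)
  have "\<exists>X. L2_tendsto M (\<lambda>n. step_integral W (p n)) X"
  proof (rule Riesz_Fischer)
    show "step_integral W (p n) \<in> L2_space M" for n by (rule step_integral_L2[OF p(1)])
    fix e :: real assume e: "e > 0"
    \<comment> \<open>A quarter of e, because bounding the square of a difference by squares costs a
      factor 2 and there are two terms.\<close>
    obtain N where N: "1 / real (Suc N) < e / 4" using e nat_approx_posE[of "e/4"]
        by (metis divide_pos_pos zero_less_numeral)
    have "(\<integral>\<omega>. (step_integral W (p m) \<omega> - step_integral W (p n) \<omega>)\<^sup>2 \<partial>M) < e"
        if mn: "m \<ge> N" "n \<ge> N" for m n
    proof -
      define r where "r = p m @ step_scale (-1) (p n)"
      have r: "is_step r" using p(1) by (simp add: r_def)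
      have "(\<integral>\<omega>. (step_integral W (p m) \<omega> - step_integral W (p n) \<omega>)\<^sup>2 \<partial>M)
          = (\<integral>s. (step_fun r s)\<^sup>2 \<partial>U)"
        using step_integral_L2(2)[OF r]
          by (simp add: r_def step_integral_append step_integral_scale U_def)
      also have "\<dots> = (\<integral>s. (1 * (step_fun (p m) s - f s) + (-1) * (step_fun (p n) s - f s))\<^sup>2 \<partial>U)"
        by (simp add: r_def step_fun_append step_fun_scale)
      also have "\<dots> \<le> 2 * (\<integral>s. (step_fun (p m) s - f s)\<^sup>2 \<partial>U) + 2
          * (\<integral>s. (step_fun (p n) s - f s)\<^sup>2 \<partial>U)"
        using L2_integral_power2_lin_le[OF L[of m] L[of n], of 1 "-1"] by simp
      also have "\<dots> < e"
      proof -
        have "1 / real (Suc m) \<le> 1 / real (Suc N)" "1 / real (Suc n) \<le> 1 / real (Suc N)"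
          using mn by (auto intro!: divide_left_mono)
        then show ?thesis using p(2)[of m] p(2)[of n] N by linarith
      qed
      finally show ?thesis .
    qed
    then show "\<exists>N. \<forall>m\<ge>N. \<forall>n\<ge>N. (\<integral>\<omega>. (step_integral W (p m) \<omega> - step_integral W (p n) \<omega>)\<^sup>2 \<partial>M) < e"
        by blast
  qed
  then show ?thesis using p(1) lim unfolding is_wiener_integral_def U_def by blast
qed

lemma is_wiener_integral_wiener_integral:
  "f \<in> L2_01 \<Longrightarrow> is_wiener_integral M W f (wiener_integral M W f)"
  using someI_ex[OF is_wiener_integral_exists] unfolding wiener_integral_def
    is_wiener_integral_def .

text \<open>This relates the generators W s of the sigma-algebra to Wick exponentials. The step
  integral is W s - W 0, which is replaced by W s because W 0 = 0 almost surely.\<close>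

lemma is_wiener_integral_brownian:
  assumes S: "S \<subseteq> {0..1}"
  shows "is_wiener_integral M W (\<lambda>r. \<Sum>s\<in>S. c s * indicator {0<..s} r) (\<lambda>\<omega>. \<Sum>s\<in>S. c s * W s \<omega>)"
proof (rule is_wiener_integral_sum)
  fix s assume "s \<in> S"
  then have s: "s \<in> {0..1}" using S by auto
  have "is_step [(1, 0, s)]" using s by (simp add: is_step_def)
  from is_wiener_integral_step[OF this]
  have "is_wiener_integral M W (\<lambda>r. indicator {0<..s} r) (\<lambda>\<omega>. W s \<omega> - W 0 \<omega>)"
    by (simp add: step_fun_def[abs_def] step_integral_def[abs_def])
  then show "is_wiener_integral M W (\<lambda>r. indicator {0<..s} r) (W s)"
    by (rule is_wiener_integral_cong_AE) (use brownian_motionD(3)[OF bm] W_measurable[OF s] in auto)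
qed

section \<open>Exponential moments of Wiener integrals\<close>

lemma exp_wiener:
  assumes "is_wiener_integral M W f X"
  shows "integrable M (\<lambda>\<omega>. exp (X \<omega>))" "(\<integral>\<omega>. exp (X \<omega>) \<partial>M) = exp (inner_01 f f / 2)"
  using centered_gaussian_moments(1,2)[OF is_wiener_integral_gaussian[OF assms] inner_self_nonneg]
    by auto

lemma exp_wiener_L2:
  assumes "is_wiener_integral M W f X"
  shows "(\<lambda>\<omega>. exp (X \<omega>)) \<in> L2_space M"
proof -
  note [measurable] = L2_spaceD(1)[OF is_wiener_integral_L2(2)[OF assms]]
  have "is_wiener_integral M W (\<lambda>s. 2 * f s) (\<lambda>\<omega>. 2 * X \<omega>)"
    using is_wiener_integral_lin[OF assms assms, of 1 1] by simp
  from exp_wiener(1)[OF this] show ?thesis by (simp add: L2_space_def exp_double)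
qed

lemma exp_wiener_sum_L2:
  assumes "\<And>i. i \<in> A \<Longrightarrow> is_wiener_integral M W (u i) (X i)"
  shows "(\<lambda>\<omega>. exp (\<Sum>i\<in>A. c i * X i \<omega>)) \<in> L2_space M"
  by (rule exp_wiener_L2[OF is_wiener_integral_sum]) (rule assms)

lemma wick_exp_L2: "h \<in> L2_01 \<Longrightarrow> wick_exp M W h \<in> L2_space M"
  using L2_space_cmult[OF exp_wiener_L2[OF is_wiener_integral_wiener_integral, of h], of
    "exp (- (inner_01 h h / 2))"]
  by (simp add: wick_exp_def[abs_def] diff_conv_add_uminus exp_add mult.commute del:
    add_uminus_conv_diff)

lemma cexp_wiener_integrable:
  assumes "finite A" "\<And>i. i \<in> A \<Longrightarrow> is_wiener_integral M W (u i) (X i)"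
  shows "integrable M (\<lambda>\<omega>. exp (\<Sum>i\<in>A. \<zeta> i * complex_of_real (X i \<omega>)))"
proof (rule Bochner_Integration.integrable_bound)
  have X [measurable]: "i \<in> A \<Longrightarrow> X i \<in> borel_measurable M" for i
    using assms(2) is_wiener_integral_L2(2) L2_spaceD(1) by blast
  show "integrable M (\<lambda>\<omega>. exp (\<Sum>i\<in>A. Re (\<zeta> i) * X i \<omega>))"
    by (rule exp_wiener(1)[OF is_wiener_integral_sum]) (rule assms)
  show "(\<lambda>\<omega>. exp (\<Sum>i\<in>A. \<zeta> i * complex_of_real (X i \<omega>))) \<in> borel_measurable M" by measurable
  show "AE \<omega> in M. cmod (exp (\<Sum>i\<in>A. \<zeta> i * complex_of_real (X i \<omega>)))
      \<le> norm (exp (\<Sum>i\<in>A. Re (\<zeta> i) * X i \<omega>))"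
    by (simp add: norm_exp_eq_Re)
qed

text \<open>The real case extends by analytic continuation in one coefficient at a time.\<close>

lemma cexp_wiener:
  assumes A: "finite A" and u: "\<And>i. i \<in> A \<Longrightarrow> is_wiener_integral M W (u i) (X i)"
  shows "(\<integral>\<omega>. exp (\<Sum>i\<in>A. \<zeta> i * complex_of_real (X i \<omega>)) \<partial>M)
     = exp ((\<Sum>i\<in>A. \<Sum>j\<in>A. \<zeta> i * \<zeta> j * complex_of_real (inner_01 (u i) (u j))) / 2)"
proof -
  have X [measurable]: "i \<in> A \<Longrightarrow> X i \<in> borel_measurable M" for i
    using u is_wiener_integral_L2(2) L2_spaceD(1) by blast
  have uL: "i \<in> A \<Longrightarrow> u i \<in> L2_01" for i using u is_wiener_integral_L2(1) by blast
  \<comment> \<open>\<open>S\<close> collects the indices whose coefficients may be complex while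
    the others are real; the induction enlarges \<open>S\<close> from the empty set to
    \<open>A\<close>.\<close>
  have "(\<forall>i\<in>A - S. \<zeta> i \<in> \<real>) \<longrightarrow> (\<integral>\<omega>. exp (\<Sum>i\<in>A. \<zeta> i * complex_of_real (X i \<omega>)) \<partial>M)
     = exp ((\<Sum>i\<in>A. \<Sum>j\<in>A. \<zeta> i * \<zeta> j * complex_of_real (inner_01 (u i) (u j))) / 2)"
    if "finite S" "S \<subseteq> A" for S
    using that
  proof (induction S arbitrary: \<zeta>)
    case empty
    show ?case
    proof
      assume "\<forall>i\<in>A - {}. \<zeta> i \<in> \<real>"
      then have "\<exists>c. \<forall>i\<in>A. \<zeta> i = complex_of_real (c i)" by (intro exI[of _ "\<lambda>i. Re (\<zeta> i)"]) auto
      then obtain c where c: "\<And>i. i \<in> A \<Longrightarrow> \<zeta> i = complex_of_real (c i)" by auto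
      have "(\<integral>\<omega>. exp (\<Sum>i\<in>A. \<zeta> i * complex_of_real (X i \<omega>)) \<partial>M)
          = (\<integral>\<omega>. complex_of_real (exp (\<Sum>i\<in>A. c i * X i \<omega>)) \<partial>M)"
        by (simp add: c flip: exp_of_real)
      also have "\<dots> = complex_of_real (exp ((\<Sum>i\<in>A. \<Sum>j\<in>A. c i * c j * inner_01 (u i) (u j)) / 2))"
        using exp_wiener(2)[OF is_wiener_integral_sum[of A u X c, OF u]] uL
        by (simp add: inner_sum_sum)
      also have "\<dots> = exp ((\<Sum>i\<in>A. \<Sum>j\<in>A. \<zeta> i * \<zeta> j * complex_of_real (inner_01 (u i) (u j))) / 2)"
        by (simp add: c flip: exp_of_real)
      finally show "(\<integral>\<omega>. exp (\<Sum>i\<in>A. \<zeta> i * complex_of_real (X i \<omega>)) \<partial>M) = \<dots>" .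
    qed
  next
    case (insert j S)
    then have j: "j \<in> A" "j \<notin> S" by auto
    show ?case
    proof
      assume real: "\<forall>i\<in>A - insert j S. \<zeta> i \<in> \<real>"
      \<comment> \<open>Only the coefficient of index \<open>j\<close> varies; the exponential of
        the remaining terms becomes the factor Y of the Laplace transform.\<close>
      have upd: "(\<Sum>i\<in>A. (\<zeta>(j := z)) i * complex_of_real (X i \<omega>))
          = z * complex_of_real (X j \<omega>) + (\<Sum>i\<in>A-{j}. \<zeta> i * complex_of_real (X i \<omega>))" for z \<omega>
        using A j by (subst sum.remove[of A j]) auto
      define L where "L z = (\<integral>\<omega>. exp (\<Sum>i\<in>A. (\<zeta>(j := z)) i * complex_of_real (X i \<omega>)) \<partial>M)" for z
      define R where "R z = exp ((\<Sum>i\<in>A. \<Sum>k\<in>A. (\<zeta>(j := z)) i * (\<zeta>(j := z)) k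
          * complex_of_real (inner_01 (u i) (u k))) / 2)" for z
      have "L z = R z" for z
      proof (rule entire_eq_on_Reals[of L R z])
        have L_eq: "L = (\<lambda>z. \<integral>\<omega>. exp (z * complex_of_real (X j \<omega>))
            * exp (\<Sum>i\<in>A-{j}. \<zeta> i * complex_of_real (X i \<omega>)) \<partial>M)"
          unfolding L_def upd exp_add by simp
        show "L holomorphic_on UNIV"
          unfolding L_eq
        proof (rule holomorphic_laplace)
          fix c :: real
          have "integrable M (\<lambda>\<omega>. exp (\<Sum>i\<in>A. (\<zeta>(j := complex_of_real c)) i
              * complex_of_real (X i \<omega>)))"
            by (rule cexp_wiener_integrable[OF A u])
          then show "integrable M (\<lambda>\<omega>. exp (c * X j \<omega>) *\<^sub>R exp (\<Sum>i\<in>A - {j}. \<zeta> i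
              * complex_of_real (X i \<omega>)))"
            unfolding upd exp_add by (simp add: scaleR_conv_of_real exp_of_real[symmetric])
        qed (use j in measurable)
        have "(\<lambda>z. (\<zeta>(j := z)) i) holomorphic_on UNIV" for i
          by (cases "i = j") auto
        then show "R holomorphic_on UNIV"
          unfolding R_def by (intro holomorphic_intros) auto
        fix x :: real
        have "\<forall>i\<in>A - S. (\<zeta>(j := complex_of_real x)) i \<in> \<real>" using real by auto
        then show "L (of_real x) = R (of_real x)"
          unfolding L_def R_def using insert.IH[of "\<zeta>(j := complex_of_real x)"] insert.prems
            by blast
      qed
      from this[of "\<zeta> j"]
      show "(\<integral>\<omega>. exp (\<Sum>i\<in>A. \<zeta> i * complex_of_real (X i \<omega>)) \<partial>M)
          = exp ((\<Sum>i\<in>A. \<Sum>j\<in>A. \<zeta> i * \<zeta> j * complex_of_real (inner_01 (u i) (u j))) / 2)"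
        by (simp add: L_def R_def)
    qed
  qed
  from this[OF A subset_refl] show ?thesis by simp
qed

text \<open>Up to a positive constant, the exponential of \<Sum> c s W s is the Wick exponential of
  a step function, so uniqueness of Laplace transforms applies. The time set T is left open: T =
  [0,1] shows that S-transforms determine elements of L^2, and T = grid characterizes conditional
  expectations.\<close>

lemma wick_exp_unique_sigma:
  assumes T: "T \<subseteq> {0..1}" and Y: "Y \<in> L2_space M"
    and zero: "\<And>S c. finite S \<Longrightarrow> S \<subseteq> T
      \<Longrightarrow> (\<integral>\<omega>. Y \<omega> * wick_exp M W (\<lambda>r. \<Sum>s\<in>S. c s * indicator {0<..s} r) \<omega> \<partial>M) = 0"
    and E: "E \<in> sets (sigma_gen_by M W T)"
  shows "(\<integral>\<omega>\<in>E. Y \<omega> \<partial>M) = 0"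
proof (rule laplace_unique_sigma[OF _ _ _ _ E])
  have one: "(\<lambda>_. 1) \<in> L2_space M" using L2_space_bounded[OF finite_measure_axioms, of "\<lambda>_. 1" 1]
      by simp
  show "integrable M Y" using L2_mult_integrable[OF Y one] by simp
  show "W t \<in> borel_measurable M" if "t \<in> T" for t using T that W_measurable by blast
  fix S :: "real set" and c assume S: "finite S" "S \<subseteq> T"
  define h where "h = (\<lambda>r. \<Sum>s\<in>S. c s * indicator {0<..s} r :: real)"
  have w: "is_wiener_integral M W h (\<lambda>\<omega>. \<Sum>s\<in>S. c s * W s \<omega>)"
    unfolding h_def using S T by (intro is_wiener_integral_brownian) auto
  note [measurable] = L2_spaceD(1)[OF is_wiener_integral_L2(2)[OF w]] L2_spaceD(1)[OF Y]
  have hL: "h \<in> L2_01" by (rule is_wiener_integral_L2(1)[OF w])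
  note [measurable] = L2_spaceD(1)[OF wick_exp_L2[OF hL]]
  show "integrable M (\<lambda>\<omega>. exp (\<Sum>s\<in>S. c s * W s \<omega>) * Y \<omega>)"
    by (rule L2_mult_integrable[OF exp_wiener_L2[OF w] Y])
  have "AE \<omega> in M. wiener_integral M W h \<omega> = (\<Sum>s\<in>S. c s * W s \<omega>)"
    by (rule is_wiener_integral_AE_unique[OF is_wiener_integral_wiener_integral[OF hL] w])
  then have "AE \<omega> in M. exp (\<Sum>s\<in>S. c s * W s \<omega>) * Y \<omega>
      = exp (inner_01 h h / 2) * (Y \<omega> * wick_exp M W h \<omega>)"
    by eventually_elim (simp add: wick_exp_def exp_diff)
  then have "(\<integral>\<omega>. exp (\<Sum>s\<in>S. c s * W s \<omega>) * Y \<omega> \<partial>M)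
      = (\<integral>\<omega>. exp (inner_01 h h / 2) * (Y \<omega> * wick_exp M W h \<omega>) \<partial>M)"
    by (intro integral_cong_AE) auto
  also have "\<dots> = 0" using zero[OF S, of c] by (simp add: h_def)
  finally show "(\<integral>\<omega>. exp (\<Sum>s\<in>S. c s * W s \<omega>) * Y \<omega> \<partial>M) = 0" .
qed

text \<open>Vanishing integrals over the sets generated by W become vanishing almost everywhere
  through the completeness clause of \<open>brownian_motion\<close>.\<close>

lemma wick_exp_unique:
  assumes Y: "Y \<in> L2_space M" and zero: "\<And>h. h \<in> L2_01 \<Longrightarrow> (\<integral>\<omega>. Y \<omega> * wick_exp M W h \<omega> \<partial>M) = 0"
  shows "AE \<omega> in M. Y \<omega> = 0"
proof (rule AE_zero_of_set_integral_zero)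
  have one: "(\<lambda>_. 1) \<in> L2_space M" using L2_space_bounded[OF finite_measure_axioms, of "\<lambda>_. 1" 1]
      by simp
  show "integrable M Y" using L2_mult_integrable[OF Y one] by simp
  show "subalgebra M (sigma_gen_by M W {0..1})" by (rule subalgebra_sigma_gen_by[OF W_measurable])
  show "sets M = sets (completion (restr_to_subalg M (sigma_gen_by M W {0..1})))"
    using bm by (simp add: brownian_motion_def)
  fix E assume "E \<in> sets (sigma_gen_by M W {0..1})"
  then show "(\<integral>\<omega>\<in>E. Y \<omega> \<partial>M) = 0"
  proof (rule wick_exp_unique_sigma[OF subset_refl Y, rotated])
    fix S c assume "finite S" "S \<subseteq> {0..1::real}"
    then show "(\<integral>\<omega>. Y \<omega> * wick_exp M W (\<lambda>r. \<Sum>s\<in>S. c s * indicator {0<..s} r) \<omega> \<partial>M) = 0"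
      by (intro zero is_wiener_integral_L2(1)[OF is_wiener_integral_brownian])
  qed
qed

end

subsection \<open>The Borel transform on a circle\<close>

text \<open>The circle is parametrized by [0,1] with Lebesgue measure. Contour integrals against dz
  / (2 \<pi> i z) then become expectations, and tori become product probability spaces.\<close>

definition circ :: "real measure" where "circ = restrict_space lborel {0..1}"

definition circ_pt :: "real \<Rightarrow> real \<Rightarrow> complex" where "circ_pt R t = of_real R * cis (2 * pi * t)"

lemma prob_space_circ: "prob_space circ"
  by (rule prob_spaceI) (simp add: circ_def emeasure_restrict_space space_restrict_space)

interpretation circ: prob_space circ by (rule prob_space_circ)

lemma measurable_circ: "f \<in> borel_measurable borel \<Longrightarrow> f \<in> borel_measurable circ"
  unfolding circ_def by (rule measurable_restrict_space1) simp

lemma circ_pt_measurable: "circ_pt R \<in> borel_measurable circ"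
  unfolding circ_pt_def
  by (intro measurable_circ borel_measurable_continuous_onI continuous_intros)

lemma norm_circ_pt [simp]: "R \<ge> 0 \<Longrightarrow> norm (circ_pt R t) = R"
  by (simp add: circ_pt_def norm_mult)

lemma circ_pt_nonzero [simp]: "R > 0 \<Longrightarrow> circ_pt R t \<noteq> 0"
  by (simp add: circ_pt_def)

lemma integral_cis:
  fixes n :: int
  assumes "n \<noteq> 0"
  shows "(\<integral>t. cis (2 * pi * of_int n * t) \<partial>circ) = 0"
proof -
  define c where "c = \<i> * (2 * pi * of_int n)"
  have c: "c \<noteq> 0" using assms by (simp add: c_def)
  have ce: "cis (2 * pi * of_int n * t) = exp (c * of_real t)" for t
    by (simp add: c_def cis_conv_exp mult_ac)
  have "(\<integral>t. cis (2 * pi * of_int n * t) \<partial>circ)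
      = (\<integral>t. indicator {0..1} t *\<^sub>R exp (c * of_real t) \<partial>lborel)"
    unfolding circ_def ce by (subst integral_restrict_space) (auto simp: set_lebesgue_integral_def)
  also have "\<dots> = exp (c * of_real 1) / c - exp (c * of_real 0) / c"
  proof (rule integral_FTC_atLeastAtMost)
    fix x :: real
    have "((\<lambda>z. exp (c * z) / c) has_field_derivative exp (c * of_real x)) (at (of_real x))"
      using c by (auto intro!: derivative_eq_intros)
    then show "((\<lambda>x. exp (c * of_real x) / c) has_vector_derivative exp (c
        * of_real x)) (at x within {0..1})"
      by (rule has_vector_derivative_real_field)
  qed (auto intro!: continuous_intros)
  also have "exp (c * of_real 1) = 1"
    using cis_multiple_2pi[of "of_int n"] by (simp add: c_def cis_conv_exp mult_ac)
  finally show ?thesis by simp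
qed

lemma integral_circ_pt_powers:
  assumes R: "R > 0"
  shows "(\<integral>t. circ_pt R t ^ n / circ_pt R t ^ k \<partial>circ) = of_bool (n = k)"
proof -
  have eq: "circ_pt R t ^ n / circ_pt R t ^ k = of_real (R ^ n / R ^ k)
      * cis (2 * pi * of_int (int n - int k) * t)" for t
  proof -
    have "circ_pt R t ^ n / circ_pt R t ^ k = of_real (R ^ n / R ^ k)
        * (cis (real n * (2 * pi * t)) / cis (real k * (2 * pi * t)))"
      by (simp only: circ_pt_def power_mult_distrib Complex.DeMoivre of_real_power of_real_divide
        times_divide_times_eq)
    also have "cis (real n * (2 * pi * t)) / cis (real k * (2 * pi * t))
        = cis (2 * pi * of_int (int n - int k) * t)"
      by (simp add: cis_divide algebra_simps)
    finally show ?thesis .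
  qed
  show ?thesis
  proof (cases "n = k")
    case True
    then show ?thesis using R by (simp add: circ.prob_space)
  next
    case False
    then show ?thesis unfolding eq using integral_cis[of "int n - int k"] by simp
  qed
qed

lemma sums_integral_bounded:
  fixes f :: "nat \<Rightarrow> 'a \<Rightarrow> complex"
  assumes "prob_space M" and [measurable]: "\<And>i. f i \<in> borel_measurable M"
    and b: "\<And>i x. norm (f i x) \<le> b i" "summable b"
  shows "(\<lambda>i. integral\<^sup>L M (f i)) sums (\<integral>x. (\<Sum>i. f i x) \<partial>M)"
proof -
  interpret prob_space M by fact
  have i: "integrable M (f i)" for i using b(1)
      by (intro integrable_const_bound[where B="b i"]) auto
  show ?thesis
  proof (rule sums_integral[OF i])
    show "AE x in M. summable (\<lambda>i. norm (f i x))"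
      by (intro AE_I2 summable_comparison_test'[OF b(2), where N=0]) (simp add: b(1))
    show "summable (\<lambda>i. \<integral>x. norm (f i x) \<partial>M)"
    proof (rule summable_comparison_test'[OF b(2), where N=0])
      fix i
      have "(\<integral>x. norm (f i x) \<partial>M) \<le> (\<integral>x. b i \<partial>M)"
        by (intro integral_mono integrable_norm i b(1)) simp
      then show "norm (\<integral>x. norm (f i x) \<partial>M) \<le> b i" by (simp add: prob_space)
    qed
  qed
qed

text \<open>Cauchy's coefficient formula: the average of z^(p-k) exp (z x) over the circle is the
  coefficient of z^(k-p) in exp (z x). The exponent p counts derivatives; p = 0 and p = 1 are the
  cases of interest.\<close>

lemma integral_circ_exp:
  assumes R: "R > 0"
  shows "(\<integral>t. circ_pt R t ^ p / circ_pt R t ^ k * exp (circ_pt R t * x) \<partial>circ)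
    = (if k < p then 0 else x ^ (k - p) / fact (k - p))"
proof -
  note [measurable] = circ_pt_measurable
  define f where "f n t = circ_pt R t ^ p / circ_pt R t ^ k * ((circ_pt R t * x) ^ n / fact n)"
      for n t
  have "(\<lambda>n. integral\<^sup>L circ (f n)) sums (\<integral>t. (\<Sum>n. f n t) \<partial>circ)"
  proof (rule sums_integral_bounded[OF prob_space_circ])
    show "f n \<in> borel_measurable circ" for n unfolding f_def by measurable
    show "norm (f n t) \<le> R ^ p / R ^ k * (inverse (fact n) * (R * norm x) ^ n)" for n t
      using R by (simp add: f_def norm_mult norm_divide norm_power field_simps)
    show "summable (\<lambda>n. R ^ p / R ^ k * (inverse (fact n) * (R * norm x) ^ n))"
      by (intro summable_mult summable_exp)
  qed
  also have "(\<lambda>t. \<Sum>n. f n t) = (\<lambda>t. circ_pt R t ^ p / circ_pt R t ^ k * exp (circ_pt R t * x))"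
  proof
    fix t
    have "(\<lambda>n. (circ_pt R t * x) ^ n / fact n) sums exp (circ_pt R t * x)"
      using exp_converges[of "circ_pt R t * x"]
        by (simp add: scaleR_conv_of_real divide_inverse mult.commute)
    then show "(\<Sum>n. f n t) = circ_pt R t ^ p / circ_pt R t ^ k * exp (circ_pt R t * x)"
      unfolding f_def by (intro sums_unique[symmetric] sums_mult)
  qed
  \<comment> \<open>Only n = k - p contributes. For k < p the truncated difference is 0, and the
    inner conditional makes that term vanish as well.\<close>
  also have "(\<lambda>n. integral\<^sup>L circ (f n)) = (\<lambda>n. if n
      = k - p then (if k < p then 0 else x ^ (k - p) / fact (k - p)) else 0)"
  proof
    fix n
    have "integral\<^sup>L circ (f n) = (\<integral>t. (x ^ n / fact n)
        * (circ_pt R t ^ (n + p) / circ_pt R t ^ k) \<partial>circ)"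
      unfolding f_def by (intro Bochner_Integration.integral_cong)
        (auto simp: power_mult_distrib power_add mult_ac)
    also have "\<dots> = x ^ n / fact n * of_bool (n + p = k)"
      by (simp only: integral_mult_right_zero integral_circ_pt_powers[OF R])
    finally show "integral\<^sup>L circ (f n) = (if n = k - p then (if k
        < p then 0 else x ^ (k - p) / fact (k - p)) else 0)"
      by auto
  qed
  finally have "(\<lambda>n. if n = k - p then (if k < p then 0 else x ^ (k - p) / fact (k - p)) else 0)
     sums (\<integral>t. circ_pt R t ^ p / circ_pt R t ^ k * exp (circ_pt R t * x) \<partial>circ)" .
  moreover have "(\<lambda>n. if n = k - p then (if k < p then 0 else x ^ (k - p) / fact (k - p)) else 0)
     sums (if k < p then 0 else x ^ (k - p) / fact (k - p))"
    by (rule sums_single)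
  ultimately show ?thesis by (rule sums_unique2)
qed

definition borel_transform :: "real \<Rightarrow> (nat \<Rightarrow> real) \<Rightarrow> real \<Rightarrow> complex" where
  "borel_transform R a t = (\<Sum>k. of_real (a k * fact k) / circ_pt R t ^ k)"

text \<open>Absolute convergence on the whole circle: it bounds the transform there and permits
  integration term by term.\<close>

definition borel_summable :: "real \<Rightarrow> (nat \<Rightarrow> real) \<Rightarrow> bool" where
  "borel_summable R a \<longleftrightarrow> R > 0 \<and> summable (\<lambda>k. \<bar>a k\<bar> * fact k / R ^ k)"

lemma norm_borel_term:
  "R > 0 \<Longrightarrow> norm (of_real (a k * fact k) / circ_pt R t ^ k) = \<bar>a k\<bar> * fact k / R ^ k"
  by (simp add: norm_divide norm_mult norm_power abs_mult)

lemma borel_transform_measurable: "borel_transform R a \<in> borel_measurable circ"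
  using circ_pt_measurable[measurable] unfolding borel_transform_def by measurable

lemma norm_borel_transform_le:
  assumes "borel_summable R a"
  shows "norm (borel_transform R a t) \<le> (\<Sum>k. \<bar>a k\<bar> * fact k / R ^ k)"
proof -
  have R: "R > 0" and s: "summable (\<lambda>k. \<bar>a k\<bar> * fact k / R ^ k)" using assms
      by (auto simp: borel_summable_def)
  have "norm (borel_transform R a t) \<le> (\<Sum>k. norm (of_real (a k * fact k) / circ_pt R t ^ k))"
    unfolding borel_transform_def
      by (rule summable_norm) (use s in \<open>simp only: norm_borel_term[OF R]\<close>)
  then show ?thesis by (simp only: norm_borel_term[OF R])
qed

text \<open>The factor k! in the transform cancels the denominator of the exponential series. What
  remains is the series of a k k!/(k-p)! x^(k-p), the p-th derivative of the power series with
  coefficients a.\<close>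

lemma integral_borel_transform:
  assumes "borel_summable R a"
  shows "(\<lambda>k. of_real (a k * fact k) * (if k < p then 0 else x ^ (k - p) / fact (k - p)))
    sums (\<integral>t. circ_pt R t ^ p * borel_transform R a t * exp (circ_pt R t * x) \<partial>circ)"
proof -
  note [measurable] = circ_pt_measurable
  have R: "R > 0" and s: "summable (\<lambda>k. \<bar>a k\<bar> * fact k / R ^ k)" using assms
      by (auto simp: borel_summable_def)
  define f where "f k t = of_real (a k * fact k) * (circ_pt R t ^ p / circ_pt R t ^ k
      * exp (circ_pt R t * x))" for k t
  have "(\<lambda>k. integral\<^sup>L circ (f k)) sums (\<integral>t. (\<Sum>k. f k t) \<partial>circ)"
  proof (rule sums_integral_bounded[OF prob_space_circ])
    show "f k \<in> borel_measurable circ" for k unfolding f_def by measurable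
    show "norm (f k t) \<le> (\<bar>a k\<bar> * fact k / R ^ k) * (R ^ p * exp (R * norm x))" for k t
    proof -
      have "norm (exp (circ_pt R t * x)) \<le> exp (norm (circ_pt R t * x))" by (rule norm_exp)
      then have e: "norm (exp (circ_pt R t * x)) \<le> exp (R * norm x)" using R
          by (simp add: norm_mult)
      have "norm (f k t) = (\<bar>a k\<bar> * fact k / R ^ k) * (R ^ p * norm (exp (circ_pt R t * x)))"
        using R by (simp add: f_def norm_mult norm_divide norm_power abs_mult)
      also have "\<dots> \<le> (\<bar>a k\<bar> * fact k / R ^ k) * (R ^ p * exp (R * norm x))"
        using e R by (intro mult_left_mono) auto
      finally show ?thesis .
    qed
    show "summable (\<lambda>k. (\<bar>a k\<bar> * fact k / R ^ k) * (R ^ p * exp (R * norm x)))"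
      by (rule summable_mult2[OF s])
  qed
  also have "(\<lambda>t. \<Sum>k. f k t) = (\<lambda>t. circ_pt R t ^ p * borel_transform R a t
      * exp (circ_pt R t * x))"
  proof
    fix t
    have "summable (\<lambda>k. of_real (a k * fact k) / circ_pt R t ^ k)"
      by (rule summable_norm_cancel) (use s in \<open>simp only: norm_borel_term[OF R]\<close>)
    then have "(\<lambda>k. of_real (a k * fact k) / circ_pt R t ^ k) sums borel_transform R a t"
      unfolding borel_transform_def by (rule summable_sums)
    then have "(\<lambda>k. (circ_pt R t ^ p * exp (circ_pt R t * x))
        * (of_real (a k * fact k) / circ_pt R t ^ k))
       sums ((circ_pt R t ^ p * exp (circ_pt R t * x)) * borel_transform R a t)" by (rule sums_mult)
    then show "(\<Sum>k. f k t) = circ_pt R t ^ p * borel_transform R a t * exp (circ_pt R t * x)"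
      unfolding f_def by (intro sums_unique[symmetric]) (simp add: mult_ac)
  qed
  also have "(\<lambda>k. integral\<^sup>L circ (f k)) = (\<lambda>k. of_real (a k * fact k) * (if k
      < p then 0 else x ^ (k - p) / fact (k - p)))"
    unfolding f_def by (simp only: integral_mult_right_zero integral_circ_exp[OF R])
  finally show ?thesis .
qed

section \<open>Recovering a power series and its derivative from the Borel transform\<close>

definition power_series :: "(nat \<Rightarrow> real) \<Rightarrow> real \<Rightarrow> real" where
  "power_series a x = (\<Sum>k. a k * x ^ k)"

definition deriv_coeffs :: "(nat \<Rightarrow> real) \<Rightarrow> nat \<Rightarrow> real" where
  "deriv_coeffs a = (\<lambda>l. real (l + 1) * a (l + 1))"

text \<open>Since (k+1) k! = (k+1)!, differentiation only shifts the series and multiplies it by R.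
  The radius therefore stays the same.\<close>

lemma borel_summable_deriv:
  assumes "borel_summable R a" shows "borel_summable R (deriv_coeffs a)"
proof -
  have R: "R > 0" and s: "summable (\<lambda>k. \<bar>a k\<bar> * fact k / R ^ k)" using assms
      by (auto simp: borel_summable_def)
  from s have s2: "summable (\<lambda>k. R * (\<bar>a (Suc k)\<bar> * fact (Suc k) / R ^ Suc k))"
    by (intro summable_mult) (subst summable_Suc_iff)
  have eq: "R * (\<bar>a (Suc k)\<bar> * fact (Suc k) / R ^ Suc k) = \<bar>deriv_coeffs a k\<bar> * fact k / R ^ k"
      for k
  proof -
    have "\<bar>deriv_coeffs a k\<bar> = real (Suc k) * \<bar>a (Suc k)\<bar>"
      by (simp only: deriv_coeffs_def abs_mult Suc_eq_plus1 abs_of_nat)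
    then show ?thesis using R by (simp only: fact_Suc power_Suc) (simp add: field_simps)
  qed
  from s2[unfolded eq] show ?thesis using R by (simp add: borel_summable_def)
qed

lemma integral_borel_transform_0:
  assumes "borel_summable R a"
  shows "(\<lambda>k. a k * x ^ k) sums power_series a x"
    "(\<integral>t. borel_transform R a t * exp (circ_pt R t * of_real x) \<partial>circ) = of_real (power_series a x)"
proof -
  define I where "I = (\<integral>t. borel_transform R a t * exp (circ_pt R t * of_real x) \<partial>circ)"
  have J: "(\<lambda>k. complex_of_real (a k * x ^ k)) sums I"
    using integral_borel_transform[OF assms, of 0 "of_real x"] by (simp add: I_def)
  from sums_Re[OF this] have "(\<lambda>k. a k * x ^ k) sums Re I" by (simp only: Re_complex_of_real)
  then show 1: "(\<lambda>k. a k * x ^ k) sums power_series a x"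
    unfolding power_series_def by (simp add: sums_iff)
  then have "(\<lambda>k. complex_of_real (a k * x ^ k)) sums of_real (power_series a x)"
      by (rule sums_of_real)
  then show "I = of_real (power_series a x)"
    by (rule sums_unique2[OF J])
qed

lemma integral_borel_transform_1:
  assumes "borel_summable R a"
  shows "(\<integral>t. circ_pt R t * borel_transform R a t * exp (circ_pt R t * of_real x) \<partial>circ)
    = of_real (power_series (deriv_coeffs a) x)"
proof -
  define s where "s = (\<lambda>k. complex_of_real (a k * fact k) * (if k
      < 1 then 0 else of_real x ^ (k - 1) / fact (k - 1)))"
  have "s sums (\<integral>t. circ_pt R t * borel_transform R a t * exp (circ_pt R t * of_real x) \<partial>circ)"
    using integral_borel_transform[OF assms, of 1 "of_real x"] by (simp add: s_def)
  moreover have "(\<lambda>k. s (Suc k)) = (\<lambda>k. of_real (deriv_coeffs a k * x ^ k))"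
    by (auto simp: s_def deriv_coeffs_def field_simps)
  then have "(\<lambda>k. s (Suc k)) sums of_real (power_series (deriv_coeffs a) x)"
    using sums_of_real[OF integral_borel_transform_0(1)[OF borel_summable_deriv[OF assms]]] by metis
  then have "s sums of_real (power_series (deriv_coeffs a) x)"
    by (subst (asm) sums_Suc_iff) (simp add: s_def)
  ultimately show ?thesis by (rule sums_unique2)
qed

subsection \<open>Mixtures of Wick exponentials\<close>

definition torus :: "nat set \<Rightarrow> (nat \<Rightarrow> real) measure" where
  "torus A = PiM A (\<lambda>_. circ)"

lemma prob_space_torus: "prob_space (torus A)"
  unfolding torus_def by (intro prob_space_PiM prob_space_circ)

lemma torus_component_measurable: "f \<in> borel_measurable circ \<Longrightarrow> i \<in> A
    \<Longrightarrow> (\<lambda>t. f (t i)) \<in> borel_measurable (torus A)"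
  unfolding torus_def by (rule measurable_compose[OF measurable_component_singleton])

lemma integral_torus_prod:
  fixes f :: "nat \<Rightarrow> real \<Rightarrow> complex"
  assumes "finite A" "\<And>i. i \<in> A \<Longrightarrow> f i \<in> borel_measurable circ" "\<And>i t. i \<in> A \<Longrightarrow> norm (f i t) \<le> b i"
  shows "(\<integral>t. (\<Prod>i\<in>A. f i (t i)) \<partial>torus A) = (\<Prod>i\<in>A. integral\<^sup>L circ (f i))"
proof -
  interpret product_sigma_finite "\<lambda>_::nat. circ" by unfold_locales
  show ?thesis unfolding torus_def
  proof (rule product_integral_prod[OF assms(1)])
    fix i assume "i \<in> A"
    then show "integrable circ (f i)"
      using assms by (intro circ.integrable_const_bound[where B="b i"]) auto
  qed
qed

text \<open>The bound holds at every t, not merely almost everywhere, so that estimates of mixtures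
  hold pointwise.\<close>

definition bounded_weight :: "nat set \<Rightarrow> ((nat \<Rightarrow> real) \<Rightarrow> complex) \<Rightarrow> real \<Rightarrow> bool" where
  "bounded_weight A \<beta> K \<longleftrightarrow> \<beta> \<in> borel_measurable (torus A) \<and> (\<forall>t. norm (\<beta> t) \<le> K)"

lemma bounded_weight_prod:
  assumes "finite A" "\<And>i. i \<in> A \<Longrightarrow> f i \<in> borel_measurable circ" "\<And>i t. i \<in> A \<Longrightarrow> norm (f i t) \<le> b i"
  shows "bounded_weight A (\<lambda>t. \<Prod>i\<in>A. f i (t i)) (\<Prod>i\<in>A. b i)"
  unfolding bounded_weight_def
proof (intro conjI allI)
  show "(\<lambda>t. \<Prod>i\<in>A. f i (t i)) \<in> borel_measurable (torus A)"
    by (intro borel_measurable_prod torus_component_measurable assms)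
  show "norm (\<Prod>i\<in>A. f i (t i)) \<le> (\<Prod>i\<in>A. b i)" for t
    unfolding prod_norm[symmetric] using assms(3) by (intro prod_mono) auto
qed

text \<open>The correction term uses the bilinear extension of the inner product, without
  conjugation. This keeps the expression holomorphic in z and makes the expectation of a product of
  two of them the exponential of a bilinear form.\<close>

definition cwick_exp :: "nat set \<Rightarrow> (nat \<Rightarrow> real \<Rightarrow> real) \<Rightarrow> (nat \<Rightarrow> 'a \<Rightarrow> real) \<Rightarrow> (nat \<Rightarrow> complex) \<Rightarrow> 'a
  \<Rightarrow> complex" where
  "cwick_exp A u X z \<omega> = exp ((\<Sum>i\<in>A. z i * of_real (X i \<omega>))
    - (\<Sum>i\<in>A. \<Sum>j\<in>A. z i * z j * of_real (inner_01 (u i) (u j))) / 2)"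

definition wick_mixture ::
  "real \<Rightarrow> nat set \<Rightarrow> ((nat \<Rightarrow> real) \<Rightarrow> complex) \<Rightarrow> (nat \<Rightarrow> real \<Rightarrow> real) \<Rightarrow> (nat \<Rightarrow> 'a \<Rightarrow> real) \<Rightarrow> 'a \<Rightarrow>
  complex" where
  "wick_mixture R A \<beta> u X \<omega> = (\<integral>t. \<beta> t * cwick_exp A u X (\<lambda>i. circ_pt R (t i)) \<omega> \<partial>torus A)"

text \<open>A majorant independent of the point of the torus: exp (R \<Sum> |X i|) equals exp
  (\<Sum> \<plusminus>R X i) for one choice of signs, and the sum runs over all choices. Unlike the
  absolute values, each summand is the exponential of a Wiener integral and hence in L^2.\<close>

definition cwick_bound :: "real \<Rightarrow> nat set \<Rightarrow> (nat \<Rightarrow> real \<Rightarrow> real) \<Rightarrow> (nat \<Rightarrow> 'a \<Rightarrow> real) \<Rightarrow> 'a \<Rightarrow> real"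
  where
  "cwick_bound R A u X \<omega> = (\<Sum>B\<in>Pow A. exp ((\<Sum>i\<in>A. \<Sum>j\<in>A. R * R * \<bar>inner_01 (u i) (u j)\<bar>) / 2) *
     exp (\<Sum>i\<in>A. (if i \<in> B then R else - R) * X i \<omega>))"

lemma cwick_bound_nonneg: "cwick_bound R A u X \<omega> \<ge> 0"
  unfolding cwick_bound_def by (intro sum_nonneg) simp

lemma norm_cwick_exp_le:
  assumes A: "finite A" and z: "\<And>i. i \<in> A \<Longrightarrow> norm (z i) \<le> R" and R: "R \<ge> 0"
  shows "norm (cwick_exp A u X z \<omega>) \<le> cwick_bound R A u X \<omega>"
proof -
  define c where "c = (\<Sum>i\<in>A. \<Sum>j\<in>A. R * R * \<bar>inner_01 (u i) (u j)\<bar>) / 2"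
  define S where "S = (\<Sum>i\<in>A. \<Sum>j\<in>A. z i * z j * of_real (inner_01 (u i) (u j))) / 2"
  have "norm S \<le> c"
  proof -
    have "norm (\<Sum>i\<in>A. \<Sum>j\<in>A. z i * z j * of_real (inner_01 (u i) (u j)))
        \<le> (\<Sum>i\<in>A. \<Sum>j\<in>A. R * R * \<bar>inner_01 (u i) (u j)\<bar>)"
      by (intro sum_norm_le) (auto simp: norm_mult intro!: mult_mono z R mult_nonneg_nonneg)
    then show ?thesis by (simp add: S_def c_def norm_divide)
  qed
  \<comment> \<open>The sign pattern of the X i at \<omega>; its summand alone already
    dominates.\<close>
  define B where "B = {i\<in>A. X i \<omega> \<ge> 0}"
  have "Re (z i * of_real (X i \<omega>)) \<le> (if i \<in> B then R else - R) * X i \<omega>" if "i \<in> A" for i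
  proof -
    have "Re (z i * of_real (X i \<omega>)) \<le> norm (z i * of_real (X i \<omega>))" by (rule complex_Re_le_cmod)
    also have "\<dots> \<le> R * \<bar>X i \<omega>\<bar>" using z[OF that] by (simp add: norm_mult mult_right_mono)
    also have "\<dots> = (if i \<in> B then R else - R) * X i \<omega>" using that by (auto simp: B_def)
    finally show ?thesis .
  qed
  then have "Re (\<Sum>i\<in>A. z i * of_real (X i \<omega>)) \<le> (\<Sum>i\<in>A. (if i \<in> B then R else - R) * X i \<omega>)"
    unfolding Re_sum by (intro sum_mono)
  moreover have "- Re S \<le> c" using \<open>norm S \<le> c\<close> abs_Re_le_cmod[of S] by linarith
  ultimately have "norm (cwick_exp A u X z \<omega>)
    \<le> exp (c + (\<Sum>i\<in>A. (if i \<in> B then R else - R) * X i \<omega>))"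
    by (simp add: cwick_exp_def norm_exp_eq_Re flip: S_def)
  also have "\<dots> = exp c * exp (\<Sum>i\<in>A. (if i \<in> B then R else - R) * X i \<omega>)" by (rule exp_add)
  also have "\<dots> \<le> cwick_bound R A u X \<omega>"
    unfolding cwick_bound_def c_def
    by (rule member_le_sum[where f="\<lambda>B. exp ((\<Sum>i\<in>A. \<Sum>j\<in>A. R * R * \<bar>inner_01 (u i) (u j)\<bar>) / 2)
      * exp (\<Sum>i\<in>A. (if i \<in> B then R else - R) * X i \<omega>)"])
       (use A in \<open>auto simp: B_def\<close>)
  finally show ?thesis .
qed

text \<open>Stated for an arbitrary measure space \<open>N\<close>: taken with the sigma-algebra of
  the grid, it gives the measurability demanded of a conditional expectation.\<close>

lemma wick_mixture_measurable:
  assumes \<beta>: "bounded_weight A \<beta> K" and X: "\<And>i. i \<in> A \<Longrightarrow> X i \<in> borel_measurable N"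
  shows "wick_mixture R A \<beta> u X \<in> borel_measurable N"
proof -
  interpret T: prob_space "torus A" by (rule prob_space_torus)
  have [measurable]: "\<beta> \<in> borel_measurable (torus A)" using \<beta> by (simp add: bounded_weight_def)
  have [measurable]: "i \<in> A \<Longrightarrow> X i \<in> borel_measurable N" for i by (rule X)
  have [measurable]: "i \<in> A \<Longrightarrow> (\<lambda>t. circ_pt R (t i)) \<in> borel_measurable (torus A)" for i
    by (rule torus_component_measurable[OF circ_pt_measurable])
  show ?thesis unfolding wick_mixture_def cwick_exp_def
    by (rule T.borel_measurable_lebesgue_integral) measurable
qed

lemma norm_wick_mixture_le:
  assumes A: "finite A" and \<beta>: "bounded_weight A \<beta> K" and R: "R > 0"
  shows "norm (wick_mixture R A \<beta> u X \<omega>) \<le> K * cwick_bound R A u X \<omega>"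
proof -
  interpret T: prob_space "torus A" by (rule prob_space_torus)
  have [measurable]: "\<beta> \<in> borel_measurable (torus A)" using \<beta> by (simp add: bounded_weight_def)
  have [measurable]: "i \<in> A \<Longrightarrow> (\<lambda>t. circ_pt R (t i)) \<in> borel_measurable (torus A)" for i
    by (rule torus_component_measurable[OF circ_pt_measurable])
  have b: "norm (\<beta> t * cwick_exp A u X (\<lambda>i. circ_pt R (t i)) \<omega>) \<le> K * cwick_bound R A u X \<omega>" for t
    unfolding norm_mult using \<beta> R
    by (intro mult_mono norm_cwick_exp_le A) (auto simp: bounded_weight_def cwick_bound_nonneg
      intro: order_trans[OF norm_ge_zero])
  have i: "integrable (torus A) (\<lambda>t. \<beta> t * cwick_exp A u X (\<lambda>i. circ_pt R (t i)) \<omega>)"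
    by (rule T.integrable_const_bound[where B="K * cwick_bound R A u X \<omega>"])
       (use b in \<open>auto simp: cwick_exp_def\<close>)
  have "norm (wick_mixture R A \<beta> u X \<omega>) \<le> (\<integral>t. K * cwick_bound R A u X \<omega> \<partial>torus A)"
    unfolding wick_mixture_def by (rule norm_integral_le[OF i]) (use b in auto)
  then show ?thesis by (simp add: T.prob_space)
qed

context brownian
begin

lemma cwick_bound_L2:
  assumes "finite A" "\<And>i. i \<in> A \<Longrightarrow> is_wiener_integral M W (u i) (X i)"
  shows "cwick_bound R A u X \<in> L2_space M"
  unfolding cwick_bound_def[abs_def] by (intro L2_space_sum exp_wiener_sum_L2[OF assms(2)])

text \<open>The two families are joined over the disjoint sum \<open>A <+> B\<close>, so that one
  Gaussian exponential moment covers both. The terms within each family cancel against the Wick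
  corrections; the mixed terms occur twice and absorb the factor 1/2.\<close>

lemma cwick_exp_pairing:
  assumes A: "finite A" "\<And>i. i \<in> A \<Longrightarrow> is_wiener_integral M W (u i) (X i)"
    and B: "finite B" "\<And>i. i \<in> B \<Longrightarrow> is_wiener_integral M W (v i) (Y i)"
  shows "(\<integral>\<omega>. cwick_exp A u X z \<omega> * cwick_exp B v Y w \<omega> \<partial>M)
     = exp (\<Sum>i\<in>A. \<Sum>j\<in>B. z i * w j * of_real (inner_01 (u i) (v j)))"
proof -
  define c where "c = (\<Sum>i\<in>A. \<Sum>j\<in>A. z i * z j * complex_of_real (inner_01 (u i) (u j)))"
  define d where "d = (\<Sum>i\<in>B. \<Sum>j\<in>B. w i * w j * complex_of_real (inner_01 (v i) (v j)))"
  define e where "e = (\<Sum>i\<in>A. \<Sum>j\<in>B. z i * w j * complex_of_real (inner_01 (u i) (v j)))"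
  have "(\<integral>\<omega>. exp (\<Sum>i\<in>A <+> B. case_sum z w i * complex_of_real (case_sum X Y i \<omega>)) \<partial>M)
     = exp ((\<Sum>i\<in>A <+> B. \<Sum>j\<in>A <+> B. case_sum z w i * case_sum z w j * complex_of_real
       (inner_01 (case_sum u v i) (case_sum u v j))) / 2)"
    using A B by (intro cexp_wiener) auto
  also have "(\<Sum>i\<in>A <+> B. \<Sum>j\<in>A <+> B. case_sum z w i * case_sum z w j
      * complex_of_real (inner_01 (case_sum u v i) (case_sum u v j))) = (c + e) + (e + d)"
  proof -
    have "(\<Sum>i\<in>B. \<Sum>j\<in>A. w i * z j * complex_of_real (inner_01 (v i) (u j))) = e"
      unfolding e_def by (subst sum.swap) (simp add: inner_commute mult_ac)
    then show ?thesis using A B by (simp add: sum.Plus sum.distrib c_def d_def e_def)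
  qed
  finally have *: "(\<integral>\<omega>. exp ((\<Sum>i\<in>A. z i * complex_of_real (X i \<omega>))
      + (\<Sum>i\<in>B. w i * complex_of_real (Y i \<omega>))) \<partial>M)
     = exp ((c + e + (e + d)) / 2)"
    using A B by (simp add: sum.Plus)
  have "cwick_exp A u X z \<omega> * cwick_exp B v Y w \<omega> = exp (- (c + d) / 2)
      * exp ((\<Sum>i\<in>A. z i * complex_of_real (X i \<omega>)) + (\<Sum>i\<in>B. w i * complex_of_real (Y i \<omega>)))" for \<omega>
    unfolding cwick_exp_def c_def[symmetric] d_def[symmetric] exp_add[symmetric]
    by (rule arg_cong[where f=exp]) (simp add: field_simps)
  then have "(\<integral>\<omega>. cwick_exp A u X z \<omega> * cwick_exp B v Y w \<omega> \<partial>M)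
      = exp (- (c + d) / 2) * exp ((c + e + (e + d)) / 2)"
    by (simp add: *)
  also have "\<dots> = exp e" unfolding exp_add[symmetric]
    by (rule arg_cong[where f=exp]) (simp add: field_simps)
  finally show ?thesis by (simp add: e_def)
qed

text \<open>The integrand is bounded by K times \<open>cwick_bound\<close> times |Y|, a product of
  two L^2 functions that does not depend on the point of the torus.\<close>

lemma wick_mixture_Fubini:
  assumes A: "finite A" and X: "\<And>i. i \<in> A \<Longrightarrow> is_wiener_integral M W (u i) (X i)"
    and \<beta>: "bounded_weight A \<beta> K" and R: "R > 0"
    and Y: "Y \<in> borel_measurable M" "(\<lambda>\<omega>. norm (Y \<omega>)) \<in> L2_space M"
  shows "(\<integral>\<omega>. wick_mixture R A \<beta> u X \<omega> * Y \<omega> \<partial>M)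
     = (\<integral>t. \<beta> t * (\<integral>\<omega>. cwick_exp A u X (\<lambda>i. circ_pt R (t i)) \<omega> * Y \<omega> \<partial>M) \<partial>torus A)"
proof -
  interpret T: prob_space "torus A" by (rule prob_space_torus)
  interpret P: pair_prob_space M "torus A" ..
  have [measurable]: "\<beta> \<in> borel_measurable (torus A)" using \<beta> by (simp add: bounded_weight_def)
  have [measurable]: "i \<in> A \<Longrightarrow> (\<lambda>t. circ_pt R (t i)) \<in> borel_measurable (torus A)" for i
    by (rule torus_component_measurable[OF circ_pt_measurable])
  have [measurable]: "i \<in> A \<Longrightarrow> X i \<in> borel_measurable M" for i
    using X is_wiener_integral_L2(2) L2_spaceD(1) by blast
  note [measurable] = Y(1) L2_spaceD(1)[OF cwick_bound_L2[OF A X]]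
  define f where "f \<omega> t = \<beta> t * cwick_exp A u X (\<lambda>i. circ_pt R (t i)) \<omega> * Y \<omega>" for \<omega> t
  have fm [measurable]: "case_prod f \<in> borel_measurable (M \<Otimes>\<^sub>M torus A)"
    unfolding f_def cwick_exp_def by measurable
  have K: "K \<ge> 0" using \<beta> norm_ge_zero order_trans unfolding bounded_weight_def by blast
  have b: "norm (f \<omega> t) \<le> K * (cwick_bound R A u X \<omega> * norm (Y \<omega>))" for \<omega> t
    unfolding f_def norm_mult mult.assoc using \<beta> R K
    by (intro mult_mono norm_cwick_exp_le A) (auto simp: bounded_weight_def cwick_bound_nonneg)
  have ib: "integrable M (\<lambda>\<omega>. K * (cwick_bound R A u X \<omega> * norm (Y \<omega>)))"
    by (intro integrable_mult_right L2_mult_integrable[OF cwick_bound_L2[OF A X]] Y) auto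
  have "integrable (M \<Otimes>\<^sub>M torus A) (\<lambda>p. K * (cwick_bound R A u X (fst p) * norm (Y (fst p))))"
  proof (rule P.Fubini_integrable)
    show "(\<lambda>p. K * (cwick_bound R A u X (fst p) * norm (Y (fst p))))
        \<in> borel_measurable (M \<Otimes>\<^sub>M torus A)" by measurable
    show "integrable M (\<lambda>x. \<integral>y. norm (K * (cwick_bound R A u X (fst (x, y))
        * norm (Y (fst (x, y))))) \<partial>torus A)"
      using integrable_norm[OF ib] by (simp add: T.prob_space)
  qed simp
  then have int: "integrable (M \<Otimes>\<^sub>M torus A) (case_prod f)"
    by (rule Bochner_Integration.integrable_bound) (use b in \<open>auto intro!: AE_I2 order_trans[OF b]\<close>)
  have "(\<integral>\<omega>. wick_mixture R A \<beta> u X \<omega> * Y \<omega> \<partial>M) = (\<integral>\<omega>. (\<integral>t. f \<omega> t \<partial>torus A) \<partial>M)"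
    unfolding wick_mixture_def f_def by (simp only: integral_mult_left_zero)
  also have "\<dots> = (\<integral>t. (\<integral>\<omega>. f \<omega> t \<partial>M) \<partial>torus A)"
    using P.Fubini_integral[OF int] by simp
  also have "\<dots> = (\<integral>t. \<beta> t * (\<integral>\<omega>. cwick_exp A u X (\<lambda>i. circ_pt R (t i)) \<omega> * Y \<omega> \<partial>M) \<partial>torus A)"
    unfolding f_def mult.assoc by (simp only: integral_mult_right_zero)
  finally show ?thesis .
qed

lemma wick_mixture_L2:
  assumes A: "finite A" and X: "\<And>i. i \<in> A \<Longrightarrow> is_wiener_integral M W (u i) (X i)"
    and \<beta>: "bounded_weight A \<beta> K" and R: "R > 0"
  shows "(\<lambda>\<omega>. norm (wick_mixture R A \<beta> u X \<omega>)) \<in> L2_space M"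
proof -
  have [measurable]: "i \<in> A \<Longrightarrow> X i \<in> borel_measurable M" for i
    using X is_wiener_integral_L2(2) L2_spaceD(1) by blast
  have [measurable]: "wick_mixture R A \<beta> u X \<in> borel_measurable M"
    by (rule wick_mixture_measurable[OF \<beta>]) simp
  have "integrable M (\<lambda>\<omega>. (K * cwick_bound R A u X \<omega>)\<^sup>2)"
    using L2_space_cmult[OF cwick_bound_L2[OF A X, where R=R], where a=K]
      by (simp add: L2_space_def)
  then have "integrable M (\<lambda>\<omega>. (norm (wick_mixture R A \<beta> u X \<omega>))\<^sup>2)"
    by (rule Bochner_Integration.integrable_bound)
       (auto intro!: AE_I2 power_mono norm_wick_mixture_le[OF A \<beta> R])
  then show ?thesis by (simp add: L2_space_def)
qed

lemma wick_mixture_pairing: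
  assumes A: "finite A" and X: "\<And>i. i \<in> A \<Longrightarrow> is_wiener_integral M W (u i) (X i)"
    and B: "finite B" and Y: "\<And>i. i \<in> B \<Longrightarrow> is_wiener_integral M W (v i) (Y i)"
    and \<beta>: "bounded_weight A \<beta> K" and \<gamma>: "bounded_weight B \<gamma> L" and R: "R > 0"
  shows "(\<integral>\<omega>. wick_mixture R A \<beta> u X \<omega> * wick_mixture R B \<gamma> v Y \<omega> \<partial>M)
     = (\<integral>t. \<beta> t * (\<integral>s. \<gamma> s * exp (\<Sum>i\<in>A. \<Sum>j\<in>B. circ_pt R (t i) * circ_pt R (s j) * of_real
       (inner_01 (u i) (v j))) \<partial>torus B) \<partial>torus A)"
proof -
  have [measurable]: "i \<in> A \<Longrightarrow> X i \<in> borel_measurable M" for i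
    using X is_wiener_integral_L2(2) L2_spaceD(1) by blast
  have [measurable]: "i \<in> B \<Longrightarrow> Y i \<in> borel_measurable M" for i
    using Y is_wiener_integral_L2(2) L2_spaceD(1) by blast
  have [measurable]: "wick_mixture R B \<gamma> v Y \<in> borel_measurable M"
    by (rule wick_mixture_measurable[OF \<gamma>]) simp
  have inner: "(\<integral>\<omega>. cwick_exp A u X (\<lambda>i. circ_pt R (t i)) \<omega> * wick_mixture R B \<gamma> v Y \<omega> \<partial>M)
     = (\<integral>s. \<gamma> s * exp (\<Sum>i\<in>A. \<Sum>j\<in>B. circ_pt R (t i) * circ_pt R (s j) * of_real
       (inner_01 (u i) (v j))) \<partial>torus B)" for t
  proof -
    define z where "z = (\<lambda>i. circ_pt R (t i))"
    have zR: "norm (z i) \<le> R" for i using R by (simp add: z_def)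
    have m [measurable]: "cwick_exp A u X z \<in> borel_measurable M"
      unfolding cwick_exp_def[abs_def] by measurable
    have "integrable M (\<lambda>\<omega>. (cwick_bound R A u X \<omega>)\<^sup>2)"
      using cwick_bound_L2[OF A X, where R=R] by (simp add: L2_space_def)
    then have "integrable M (\<lambda>\<omega>. (norm (cwick_exp A u X z \<omega>))\<^sup>2)"
      by (rule Bochner_Integration.integrable_bound)
         (use R in \<open>auto intro!: AE_I2 power_mono norm_cwick_exp_le[OF A zR]\<close>)
    then have L: "(\<lambda>\<omega>. norm (cwick_exp A u X z \<omega>)) \<in> L2_space M" by (simp add: L2_space_def)
    have "(\<integral>\<omega>. cwick_exp A u X z \<omega> * wick_mixture R B \<gamma> v Y \<omega> \<partial>M)
        = (\<integral>\<omega>. wick_mixture R B \<gamma> v Y \<omega> * cwick_exp A u X z \<omega> \<partial>M)"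
      by (simp add: mult.commute)
    also have "\<dots> = (\<integral>s. \<gamma> s * (\<integral>\<omega>. cwick_exp B v Y (\<lambda>i. circ_pt R (s i)) \<omega>
        * cwick_exp A u X z \<omega> \<partial>M) \<partial>torus B)"
      by (rule wick_mixture_Fubini[OF B Y \<gamma> R m L])
    also have "\<dots> = (\<integral>s. \<gamma> s * exp (\<Sum>i\<in>A. \<Sum>j\<in>B. z i * circ_pt R (s j)
        * of_real (inner_01 (u i) (v j))) \<partial>torus B)"
      by (subst mult.commute[of "cwick_exp B v Y _ _"], subst cwick_exp_pairing[OF A X B Y])
        simp_all
    finally show ?thesis by (simp add: z_def)
  qed
  show ?thesis
    by (subst wick_mixture_Fubini[OF A X \<beta> R _ wick_mixture_L2[OF B Y \<gamma> R]]) (simp_all add: inner)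
qed

lemma wick_mixture_wick_exp:
  assumes A: "finite A" and X: "\<And>i. i \<in> A \<Longrightarrow> is_wiener_integral M W (u i) (X i)"
    and \<beta>: "bounded_weight A \<beta> K" and R: "R > 0" and h: "h \<in> L2_01"
  shows "(\<integral>\<omega>. wick_mixture R A \<beta> u X \<omega> * of_real (wick_exp M W h \<omega>) \<partial>M)
     = (\<integral>t. \<beta> t * exp (\<Sum>i\<in>A. circ_pt R (t i) * of_real (inner_01 (u i) h)) \<partial>torus A)"
proof -
  note [measurable] = L2_spaceD(1)[OF wick_exp_L2[OF h]]
  have nL: "(\<lambda>\<omega>. norm (complex_of_real (wick_exp M W h \<omega>))) \<in> L2_space M"
    using wick_exp_L2[OF h] by (auto simp: L2_space_def)
  \<comment> \<open>A real Wick exponential is a complex one over a one-point index set with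
    coefficient 1.\<close>
  have e: "complex_of_real (wick_exp M W h \<omega>)
      = cwick_exp {0} (\<lambda>_. h) (\<lambda>_. wiener_integral M W h) (\<lambda>_. 1) \<omega>" for \<omega>
    by (simp add: wick_exp_def cwick_exp_def flip: exp_of_real)
  have "(\<integral>\<omega>. cwick_exp A u X z \<omega> * of_real (wick_exp M W h \<omega>) \<partial>M)
      = exp (\<Sum>i\<in>A. z i * of_real (inner_01 (u i) h))" for z
    unfolding e by (subst cwick_exp_pairing[OF A X])
      (auto intro: is_wiener_integral_wiener_integral[OF h])
  then show ?thesis
    by (subst wick_mixture_Fubini[OF A X \<beta> R _ nL]) simp_all
qed

end

subsection \<open>S-transforms\<close>

context brownian
begin

definition has_S_transform :: "('a \<Rightarrow> real) \<Rightarrow> ((real \<Rightarrow> real) \<Rightarrow> real) \<Rightarrow> bool" where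
  "has_S_transform Y s \<longleftrightarrow> Y \<in> L2_space M \<and> (\<forall>h\<in>L2_01. (\<integral>\<omega>. Y \<omega> * wick_exp M W h \<omega> \<partial>M) = s h)"

lemma has_S_transform_lin:
  assumes "has_S_transform Y s" "has_S_transform Y' s'"
  shows "has_S_transform (\<lambda>\<omega>. a * Y \<omega> + b * Y' \<omega>) (\<lambda>h. a * s h + b * s' h)"
  unfolding has_S_transform_def
proof (intro conjI ballI)
  have L: "Y \<in> L2_space M" "Y' \<in> L2_space M" using assms by (auto simp: has_S_transform_def)
  then show "(\<lambda>\<omega>. a * Y \<omega> + b * Y' \<omega>) \<in> L2_space M" by (rule L2_space_lin)
  fix h assume h: "h \<in> L2_01"
  have "(\<integral>\<omega>. (a * Y \<omega> + b * Y' \<omega>) * wick_exp M W h \<omega> \<partial>M)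
    = (\<integral>\<omega>. a * (Y \<omega> * wick_exp M W h \<omega>) + b * (Y' \<omega> * wick_exp M W h \<omega>) \<partial>M)"
    by (simp add: algebra_simps)
  also have "\<dots> = a * s h + b * s' h"
    using L2_mult_integrable[OF L(1) wick_exp_L2[OF h]]
      L2_mult_integrable[OF L(2) wick_exp_L2[OF h]] assms h
    by (simp add: has_S_transform_def)
  finally show "(\<integral>\<omega>. (a * Y \<omega> + b * Y' \<omega>) * wick_exp M W h \<omega> \<partial>M) = a * s h + b * s' h" .
qed

lemma has_S_transform_zero_imp_AE:
  assumes "has_S_transform Y (\<lambda>_. 0)"
  shows "AE \<omega> in M. Y \<omega> = 0"
  using assms by (intro wick_exp_unique) (auto simp: has_S_transform_def)

lemma has_S_transform_AE_unique:
  assumes "has_S_transform Y s" "has_S_transform Y' s"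
  shows "AE \<omega> in M. Y \<omega> = Y' \<omega>"
  using has_S_transform_zero_imp_AE[of "\<lambda>\<omega>. Y \<omega> - Y' \<omega>"] has_S_transform_lin[OF assms, of 1 "-1"]
    by simp

lemma has_S_transform_cong_AE:
  assumes Y: "has_S_transform Y s" and Y': "Y' \<in> borel_measurable M" "AE \<omega> in M. Y \<omega> = Y' \<omega>"
  shows "has_S_transform Y' s"
  unfolding has_S_transform_def
proof (intro conjI ballI)
  have YL: "Y \<in> L2_space M" using Y by (simp add: has_S_transform_def)
  note [measurable] = L2_spaceD(1)[OF YL] Y'(1)
  have "integrable M (\<lambda>x. (Y' x)\<^sup>2)"
    using L2_spaceD(2)[OF YL] by (rule Bochner_Integration.integrable_cong_AE_imp) (use Y' in auto)
  then show "Y' \<in> L2_space M" using Y' by (simp add: L2_space_def)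
  fix h assume h: "h \<in> L2_01"
  note [measurable] = L2_spaceD(1)[OF wick_exp_L2[OF h]]
  have "(\<integral>\<omega>. Y' \<omega> * wick_exp M W h \<omega> \<partial>M) = (\<integral>\<omega>. Y \<omega> * wick_exp M W h \<omega> \<partial>M)"
    by (intro integral_cong_AE) (use Y' in auto)
  then show "(\<integral>\<omega>. Y' \<omega> * wick_exp M W h \<omega> \<partial>M) = s h" using Y h by (simp add: has_S_transform_def)
qed

text \<open>The \<open>SOME\<close> in \<open>wick_prod\<close> is informative only if some L^2
  element has the product S-transform. \<open>Z\<close> supplies it; in the applications
  \<open>Z\<close> is the real part of a mixture.\<close>

lemma has_S_transform_wick_prod:
  assumes "has_S_transform X s" "has_S_transform Y s'" "has_S_transform Z (\<lambda>h. s h * s' h)"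
  shows "has_S_transform (wick_prod M W X Y) (\<lambda>h. s h * s' h)"
proof -
  have *: "is_wick_prod M W X Y V \<longleftrightarrow> has_S_transform V (\<lambda>h. s h * s' h)" for V
    using assms by (auto simp: is_wick_prod_def has_S_transform_def)
  show ?thesis using someI[of "is_wick_prod M W X Y" Z] assms(3) unfolding wick_prod_def * by blast
qed

text \<open>Test functions and the prescribed values are real, so the imaginary part has S-transform
  0 and vanishes almost surely.\<close>

lemma has_S_transform_Re:
  assumes \<Phi> [measurable]: "\<Phi> \<in> borel_measurable M" and L: "(\<lambda>\<omega>. norm (\<Phi> \<omega>)) \<in> L2_space M"
    and S: "\<And>h. h \<in> L2_01 \<Longrightarrow> (\<integral>\<omega>. \<Phi> \<omega> * complex_of_real (wick_exp M W h \<omega>) \<partial>M)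
      = complex_of_real (s h)"
  shows "has_S_transform (\<lambda>\<omega>. Re (\<Phi> \<omega>)) s" "AE \<omega> in M. Im (\<Phi> \<omega>) = 0"
proof -
  have ReL: "(\<lambda>\<omega>. Re (\<Phi> \<omega>)) \<in> L2_space M" "(\<lambda>\<omega>. Im (\<Phi> \<omega>)) \<in> L2_space M"
  proof -
    have le: "(Re z)\<^sup>2 \<le> (norm z)\<^sup>2" "(Im z)\<^sup>2 \<le> (norm z)\<^sup>2" for z
      using power_mono[OF abs_Re_le_cmod[of z], of 2] power_mono[OF abs_Im_le_cmod[of z], of 2]
        by simp_all
    have "integrable M (\<lambda>\<omega>. (Re (\<Phi> \<omega>))\<^sup>2)" "integrable M (\<lambda>\<omega>. (Im (\<Phi> \<omega>))\<^sup>2)"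
      by (rule Bochner_Integration.integrable_bound[OF L2_spaceD(2)[OF L]]; simp add: le)+
    then show "(\<lambda>\<omega>. Re (\<Phi> \<omega>)) \<in> L2_space M" "(\<lambda>\<omega>. Im (\<Phi> \<omega>)) \<in> L2_space M"
        by (simp_all add: L2_space_def)
  qed
  have parts: "(\<integral>\<omega>. Re (\<Phi> \<omega>) * wick_exp M W h \<omega> \<partial>M) = s h \<and> (\<integral>\<omega>. Im (\<Phi> \<omega>) * wick_exp M W h \<omega> \<partial>M)
      = 0" if h: "h \<in> L2_01" for h
  proof -
    note [measurable] = L2_spaceD(1)[OF wick_exp_L2[OF h]]
    have i: "integrable M (\<lambda>\<omega>. \<Phi> \<omega> * complex_of_real (wick_exp M W h \<omega>))"
      by (rule Bochner_Integration.integrable_bound[OF L2_mult_integrable[OF L wick_exp_L2[OF h]]])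
         (auto simp: norm_mult abs_mult)
    have "(\<integral>\<omega>. Re (\<Phi> \<omega>) * wick_exp M W h \<omega> \<partial>M)
        = Re (\<integral>\<omega>. \<Phi> \<omega> * complex_of_real (wick_exp M W h \<omega>) \<partial>M)"
      "(\<integral>\<omega>. Im (\<Phi> \<omega>) * wick_exp M W h \<omega> \<partial>M) = Im (\<integral>\<omega>. \<Phi> \<omega> * complex_of_real (wick_exp M W h \<omega>) \<partial>M)"
      by (simp_all flip: integral_Re[OF i] integral_Im[OF i])
    then show ?thesis using S[OF h] by simp
  qed
  then show "has_S_transform (\<lambda>\<omega>. Re (\<Phi> \<omega>)) s" using ReL by (auto simp: has_S_transform_def)
  show "AE \<omega> in M. Im (\<Phi> \<omega>) = 0"
    by (rule has_S_transform_zero_imp_AE) (use ReL parts in \<open>auto simp: has_S_transform_def\<close>)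
qed

end

text \<open>\<open>J\<close> is the set of differentiated factors: empty for the functional itself,
  a singleton for a partial derivative.\<close>

definition mix_weight :: "real \<Rightarrow> nat set \<Rightarrow> (nat \<Rightarrow> nat \<Rightarrow> real) \<Rightarrow> nat set \<Rightarrow> (nat \<Rightarrow> real) \<Rightarrow> complex"
  where
  "mix_weight R A a J t = (\<Prod>i\<in>A. (if i \<in> J then circ_pt R (t i) else 1)
    * borel_transform R (a i) (t i))"

definition mix_S :: "nat set \<Rightarrow> (nat \<Rightarrow> nat \<Rightarrow> real) \<Rightarrow> nat set \<Rightarrow> (nat \<Rightarrow> real \<Rightarrow> real) \<Rightarrow> (real \<Rightarrow> real)
  \<Rightarrow> real" where
  "mix_S A a J u h = (\<Prod>i\<in>A. power_series (if i \<in> J then deriv_coeffs (a i) else a i)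
    (inner_01 (u i) h))"

definition mix_bound :: "real \<Rightarrow> nat set \<Rightarrow> (nat \<Rightarrow> nat \<Rightarrow> real) \<Rightarrow> nat set \<Rightarrow> real" where
  "mix_bound R A a J = (\<Prod>i\<in>A. (if i \<in> J then R else 1) * (\<Sum>k. \<bar>a i k\<bar> * fact k / R ^ k))"

lemma mix_factor_bound:
  assumes "borel_summable R a" "P \<longrightarrow> z = circ_pt R t" "\<not> P \<longrightarrow> z = 1"
  shows "norm (z * borel_transform R a t) \<le> (if P then R else 1) * (\<Sum>k. \<bar>a k\<bar> * fact k / R ^ k)"
proof -
  have R: "R > 0" using assms by (simp add: borel_summable_def)
  have "norm z = (if P then R else 1)" using assms R by auto
  then show ?thesis unfolding norm_mult
    using norm_borel_transform_le[OF assms(1)] R by (auto intro!: mult_left_mono)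
qed

lemma bounded_weight_mix_weight:
  assumes "finite A" "\<And>i. i \<in> A \<Longrightarrow> borel_summable R (a i)"
  shows "bounded_weight A (mix_weight R A a J) (mix_bound R A a J)"
  unfolding mix_weight_def[abs_def] mix_bound_def
proof (rule bounded_weight_prod[OF assms(1)])
  fix i assume "i \<in> A"
  note [measurable] = circ_pt_measurable borel_transform_measurable
  show "(\<lambda>t. (if i \<in> J then circ_pt R t else 1) * borel_transform R (a i) t)
      \<in> borel_measurable circ"
    by measurable
  show "norm ((if i \<in> J then circ_pt R t else 1) * borel_transform R (a i) t)
    \<le> (if i \<in> J then R else 1) * (\<Sum>k. \<bar>a i k\<bar> * fact k / R ^ k)" for t
    using assms(2)[OF \<open>i \<in> A\<close>] by (intro mix_factor_bound) auto
qed

text \<open>The exponential of the sum factorizes over the coordinates, so the torus integral is a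
  product of circle averages, each giving a power series or, for an index in \<open>J\<close>, its
  derivative.\<close>

lemma integral_mix_weight:
  assumes A: "finite A" and a: "\<And>i. i \<in> A \<Longrightarrow> borel_summable R (a i)"
  shows "(\<integral>t. mix_weight R A a J t * exp (\<Sum>i\<in>A. circ_pt R (t i) * complex_of_real (x i)) \<partial>torus A)
    = complex_of_real (\<Prod>i\<in>A. power_series (if i \<in> J then deriv_coeffs (a i) else a i) (x i))"
proof -
  define f where "f i t = (if i \<in> J then circ_pt R t else 1) * borel_transform R (a i) t
      * exp (circ_pt R t * complex_of_real (x i))" for i t
  have "(\<integral>t. mix_weight R A a J t * exp (\<Sum>i\<in>A. circ_pt R (t i) * complex_of_real (x i)) \<partial>torus A)
    = (\<integral>t. (\<Prod>i\<in>A. f i (t i)) \<partial>torus A)"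
    using A by (simp add: mix_weight_def f_def exp_sum prod.distrib)
  also have "\<dots> = (\<Prod>i\<in>A. integral\<^sup>L circ (f i))"
  proof (rule integral_torus_prod[OF A])
    fix i assume i: "i \<in> A"
    note [measurable] = circ_pt_measurable borel_transform_measurable
    show "f i \<in> borel_measurable circ" unfolding f_def by measurable
    fix t
    have R: "R > 0" using a[OF i] by (simp add: borel_summable_def)
    have "norm (exp (circ_pt R t * complex_of_real (x i)))
        \<le> exp (norm (circ_pt R t * complex_of_real (x i)))" by (rule norm_exp)
    also have "\<dots> = exp (R * \<bar>x i\<bar>)" using R by (simp add: norm_mult)
    finally have e: "norm (exp (circ_pt R t * complex_of_real (x i))) \<le> exp (R * \<bar>x i\<bar>)" .
    have b: "norm ((if i \<in> J then circ_pt R t else 1) * borel_transform R (a i) t)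
      \<le> (if i \<in> J then R else 1) * (\<Sum>k. \<bar>a i k\<bar> * fact k / R ^ k)"
      using a[OF i] by (intro mix_factor_bound) auto
    have b0: "0 \<le> (if i \<in> J then R else 1) * (\<Sum>k. \<bar>a i k\<bar> * fact k / R ^ k)"
      by (rule order_trans[OF norm_ge_zero b])
    show "norm (f i t) \<le> ((if i \<in> J then R else 1) * (\<Sum>k. \<bar>a i k\<bar> * fact k / R ^ k))
        * exp (R * \<bar>x i\<bar>)"
      unfolding f_def norm_mult[of "_ * _"]
      by (intro mult_mono e b b0 norm_ge_zero)
  qed
  also have "\<dots> = (\<Prod>i\<in>A. complex_of_real (power_series (if i
      \<in> J then deriv_coeffs (a i) else a i) (x i)))"
    using integral_borel_transform_0(2)[OF a] integral_borel_transform_1[OF a]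
    by (intro prod.cong refl) (auto simp: f_def[abs_def])
  finally show ?thesis by simp
qed

context brownian
begin

text \<open>Every product of power series in the numbers \<open>inner_01 (u i) h\<close> with Borel
  summable coefficients is thus an S-transform. This is the existence statement behind Wick powers,
  series and products.\<close>

lemma wick_mixture_has_S_transform:
  assumes A: "finite A" and R: "R > 0" and a: "\<And>i. i \<in> A \<Longrightarrow> borel_summable R (a i)"
    and X: "\<And>i. i \<in> A \<Longrightarrow> is_wiener_integral M W (u i) (X i)"
  shows "has_S_transform (\<lambda>\<omega>. Re (wick_mixture R A (mix_weight R A a J) u X \<omega>)) (mix_S A a J u)"
    and "AE \<omega> in M. Im (wick_mixture R A (mix_weight R A a J) u X \<omega>) = 0"
proof -
  note \<beta> = bounded_weight_mix_weight[OF A a, where J=J]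
  have Xm: "i \<in> A \<Longrightarrow> X i \<in> borel_measurable M" for i
    using X is_wiener_integral_L2(2) L2_spaceD(1) by blast
  note 1 = wick_mixture_measurable[OF \<beta> Xm, where R=R and u=u]
  note 2 = wick_mixture_L2[OF A X \<beta> R]
  have 3: "(\<integral>\<omega>. wick_mixture R A (mix_weight R A a J) u X \<omega> * complex_of_real (wick_exp M W h \<omega>) \<partial>M)
      = complex_of_real (mix_S A a J u h)" if "h \<in> L2_01" for h
  proof -
    have "(\<integral>\<omega>. wick_mixture R A (mix_weight R A a J) u X \<omega> * complex_of_real (wick_exp M W h \<omega>) \<partial>M)
      = (\<integral>t. mix_weight R A a J t * exp (\<Sum>i\<in>A. circ_pt R (t i) * of_real (inner_01 (u i) h))
        \<partial>torus A)"
      by (rule wick_mixture_wick_exp[OF A X \<beta> R that])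
    also have "\<dots> = complex_of_real (mix_S A a J u h)"
      unfolding mix_S_def by (rule integral_mix_weight[OF A a])
    finally show ?thesis .
  qed
  show "has_S_transform (\<lambda>\<omega>. Re (wick_mixture R A (mix_weight R A a J) u X \<omega>)) (mix_S A a J u)"
    using 1 2 3 by (rule has_S_transform_Re)
  show "AE \<omega> in M. Im (wick_mixture R A (mix_weight R A a J) u X \<omega>) = 0"
    using 1 2 3 by (rule has_S_transform_Re)
qed

lemma AE_eq_wick_mixture:
  assumes Y: "has_S_transform Y (mix_S A a J u)"
    and A: "finite A" and R: "R > 0" and a: "\<And>i. i \<in> A \<Longrightarrow> borel_summable R (a i)"
    and X: "\<And>i. i \<in> A \<Longrightarrow> is_wiener_integral M W (u i) (X i)"
  shows "AE \<omega> in M. complex_of_real (Y \<omega>) = wick_mixture R A (mix_weight R A a J) u X \<omega>"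
proof -
  have "AE \<omega> in M. Y \<omega> = Re (wick_mixture R A (mix_weight R A a J) u X \<omega>)"
    by (rule has_S_transform_AE_unique[OF Y wick_mixture_has_S_transform(1)]) (use assms in auto)
  moreover have "AE \<omega> in M. Im (wick_mixture R A (mix_weight R A a J) u X \<omega>) = 0"
    by (rule wick_mixture_has_S_transform(2)) (use assms in auto)
  ultimately show ?thesis by eventually_elim (simp add: complex_eq_iff)
qed

section \<open>S-transforms of Wick powers, Wick series and Wick-analytic functionals\<close>

lemma has_S_transform_one: "has_S_transform (\<lambda>_. 1) (\<lambda>_. 1)"
  unfolding has_S_transform_def
proof (intro conjI ballI)
  show "(\<lambda>_. 1) \<in> L2_space M" using L2_space_bounded[OF finite_measure_axioms, of "\<lambda>_. 1" 1] by simp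
  fix h assume "h \<in> L2_01"
  from exp_wiener(2)[OF is_wiener_integral_wiener_integral[OF this]]
  show "(\<integral>\<omega>. 1 * wick_exp M W h \<omega> \<partial>M) = 1"
    by (simp add: wick_exp_def exp_diff)
qed

text \<open>The expectation of exp (z I(f)) times the Wick exponential of h is exp (z^2 \<langle>f,
  f\<rangle> / 2 + z \<langle>f, h\<rangle>) for all complex z. Comparing the derivatives at z = 0
  gives the claim. A mixture with the same S-transform exists anyway, but only this computation
  identifies it with I(f).\<close>

lemma has_S_transform_wiener_integral:
  assumes f: "f \<in> L2_01"
  shows "has_S_transform (wiener_integral M W f) (\<lambda>h. inner_01 f h)"
  unfolding has_S_transform_def
proof (intro conjI ballI)
  define X where "X = wiener_integral M W f"
  have X: "is_wiener_integral M W f X" unfolding X_def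
      by (rule is_wiener_integral_wiener_integral[OF f])
  show XL: "X \<in> L2_space M" by (rule is_wiener_integral_L2(2)[OF X])
  fix h assume h: "h \<in> L2_01"
  note [measurable] = L2_spaceD(1)[OF XL] L2_spaceD(1)[OF wick_exp_L2[OF h]]
  define G where "G z = exp (z * z * complex_of_real (inner_01 f f) / 2 + z
      * complex_of_real (inner_01 f h))" for z
  define Y where "Y = (\<lambda>\<omega>. complex_of_real (wick_exp M W h \<omega>))"
  have [measurable]: "Y \<in> borel_measurable M" unfolding Y_def by measurable
  have e: "Y \<omega> = cwick_exp {0} (\<lambda>_. h) (\<lambda>_. wiener_integral M W h) (\<lambda>_. 1) \<omega>" for \<omega>
    by (simp add: Y_def wick_exp_def cwick_exp_def flip: exp_of_real)
  have lap: "(\<integral>\<omega>. exp (z * of_real (X \<omega>)) * Y \<omega> \<partial>M) = G z" for z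
  proof -
    have "(\<integral>\<omega>. cwick_exp {0} (\<lambda>_. f) (\<lambda>_. X) (\<lambda>_. z) \<omega> * Y \<omega> \<partial>M) = exp (z * of_real (inner_01 f h))"
      unfolding e by (subst cwick_exp_pairing) (auto intro: X
        is_wiener_integral_wiener_integral[OF h])
    moreover have eq: "exp (z * of_real (X \<omega>)) * Y \<omega>
      = exp (z * z * of_real (inner_01 f f) / 2) * (cwick_exp {0} (\<lambda>_. f) (\<lambda>_. X) (\<lambda>_. z) \<omega> * Y
      \<omega>)" for \<omega>
      by (simp add: cwick_exp_def mult.assoc[symmetric] flip: exp_add)
    ultimately show ?thesis by (simp only: eq integral_mult_right_zero G_def exp_add)
  qed
  have int: "integrable M (\<lambda>\<omega>. exp (c * X \<omega>) *\<^sub>R Y \<omega>)" for c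
  proof -
    have "is_wiener_integral M W (\<lambda>s. c * f s) (\<lambda>\<omega>. c * X \<omega>)"
      using is_wiener_integral_lin[OF X X, of c 0] by simp
    from L2_mult_integrable[OF exp_wiener_L2[OF this] wick_exp_L2[OF h]]
    have "integrable M (\<lambda>\<omega>. complex_of_real (exp (c * X \<omega>) * wick_exp M W h \<omega>))"
        by (rule integrable_of_real)
    then show ?thesis by (simp add: Y_def scaleR_conv_of_real)
  qed
  define b where "b = (\<lambda>i. \<integral>\<omega>. of_real (X \<omega>) ^ i / fact i * Y \<omega> \<partial>M)"
  have sums: "(\<lambda>i. b i * z ^ i) sums G z" for z
    using laplace_sums[of X M Y z] int unfolding b_def lap by auto
  then have Geq: "G = (\<lambda>z. \<Sum>i. b i * z ^ i)" by (auto simp: sums_iff)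
  have "((\<lambda>z. \<Sum>i. b i * z ^ i) has_field_derivative (\<Sum>i. diffs b i * 0 ^ i)) (at 0)"
    by (rule termdiffs_strong_converges_everywhere) (use sums in \<open>auto simp: sums_iff\<close>)
  then have "(G has_field_derivative b 1) (at 0)"
    unfolding Geq by (simp add: powser_zero diffs_def)
  moreover have "(G has_field_derivative of_real (inner_01 f h)) (at 0)"
    unfolding G_def by (auto intro!: derivative_eq_intros)
  ultimately have "b 1 = of_real (inner_01 f h)" by (rule DERIV_unique)
  then have "(\<integral>\<omega>. complex_of_real (X \<omega> * wick_exp M W h \<omega>) \<partial>M) = of_real (inner_01 f h)"
    by (simp add: b_def Y_def)
  then show "(\<integral>\<omega>. X \<omega> * wick_exp M W h \<omega> \<partial>M) = inner_01 f h"
    by (simp only: integral_complex_of_real of_real_eq_iff)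
qed

text \<open>The mixture whose sole nonzero coefficient is the one of degree k + 1 witnesses that the
  next Wick product exists. For finitely many coefficients any radius would do; it is taken to be
  1.\<close>

lemma has_S_transform_wick_power:
  assumes f: "f \<in> L2_01"
  shows "has_S_transform (wick_power M W (wiener_integral M W f) k) (\<lambda>h. inner_01 f h ^ k)"
proof (induction k)
  case 0
  then show ?case using has_S_transform_one by simp
next
  case (Suc k)
  define a where "a = (\<lambda>(_::nat) j. of_bool (j = Suc k) :: real)"
  have "borel_summable 1 (a i)" for i
    unfolding borel_summable_def a_def by (auto intro!: summable_finite[of "{Suc k}"])
  then have "has_S_transform (\<lambda>\<omega>. Re (wick_mixture 1 {0} (mix_weight 1 {0} a {}) (\<lambda>_. f)
      (\<lambda>_. wiener_integral M W f) \<omega>)) (mix_S {0} a {} (\<lambda>_. f))"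
    by (intro wick_mixture_has_S_transform is_wiener_integral_wiener_integral f) auto
  moreover have "mix_S {0} a {} (\<lambda>_. f) h = inner_01 f h ^ k * inner_01 f h" for h
  proof -
    have "(\<lambda>j. a 0 j * inner_01 f h ^ j) = (\<lambda>j. if j = Suc k then inner_01 f h ^ j else 0)"
      by (auto simp: a_def)
    then have "(\<lambda>j. a 0 j * inner_01 f h ^ j) sums (inner_01 f h ^ Suc k)"
      using sums_single[of "Suc k" "\<lambda>j. inner_01 f h ^ j"] by simp
    then show ?thesis by (simp add: mix_S_def power_series_def sums_iff mult.commute)
  qed
  then have "mix_S {0} a {} (\<lambda>_. f) = (\<lambda>h. inner_01 f h ^ k * inner_01 f h)" ..
  ultimately have "has_S_transform (wick_power M W (wiener_integral M W f) (Suc k))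
    (\<lambda>h. inner_01 f h ^ k * inner_01 f h)"
    using has_S_transform_wick_prod[OF Suc has_S_transform_wiener_integral[OF f]]
      by (simp only: wick_power.simps)
  then show ?case by (simp only: power_Suc2)
qed

end

context brownian
begin

text \<open>The remainder of the series is a mixture whose weight
  is the tail of the Borel transform, which
  tends to \<open>0\<close> uniformly on the circle.\<close>

lemma wick_series_has_S_transform:
  assumes f: "f \<in> L2_01" and c: "borel_summable R c"
  shows "has_S_transform (wick_series M W c f) (\<lambda>h. power_series c (inner_01 f h))"
proof -
  have R: "R > 0" and sc: "summable (\<lambda>k. \<bar>c k\<bar> * fact k / R ^ k)" using c
      by (auto simp: borel_summable_def)
  define X where "X = wiener_integral M W f"
  have X: "is_wiener_integral M W f X" unfolding X_def
      by (rule is_wiener_integral_wiener_integral[OF f])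
  define S where "S = (\<lambda>n \<omega>. \<Sum>k<n. c k * wick_power M W X k \<omega>)"
  have S: "has_S_transform (S n) (\<lambda>h. \<Sum>k<n. c k * inner_01 f h ^ k)" for n
  proof (induction n)
    case 0
    then show ?case using has_S_transform_lin[OF has_S_transform_one has_S_transform_one, of 0 0]
        by (simp add: S_def)
  next
    case (Suc n)
    from has_S_transform_lin[OF Suc has_S_transform_wick_power[OF f, of n], of 1 "c n"]
    show ?case by (simp add: S_def X_def)
  qed
  define V where "V \<omega> = Re (wick_mixture R {0} (mix_weight R {0} (\<lambda>_. c) {}) (\<lambda>_. f) (\<lambda>_. X) \<omega>)"
      for \<omega>
  have "has_S_transform V (mix_S {0} (\<lambda>_. c) {} (\<lambda>_. f))"
    unfolding V_def by (rule wick_mixture_has_S_transform(1)) (use R c X in auto)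
  moreover have "mix_S {0} (\<lambda>_. c) {} (\<lambda>_. f) = (\<lambda>h. power_series c (inner_01 f h))"
    by (auto simp: mix_S_def)
  ultimately have V: "has_S_transform V (\<lambda>h. power_series c (inner_01 f h))" by (simp only:)
  define tail where "tail n k = (if k < n then 0 else c k)" for n k
  define g where "g k = \<bar>c k\<bar> * fact k / R ^ k" for k
  have tail_g: "(\<lambda>k. \<bar>tail n k\<bar> * fact k / R ^ k) sums (suminf g - (\<Sum>k<n. g k))" for n
  proof -
    have "(\<lambda>k. g k - (if k \<in> {..<n} then g k else 0)) sums (suminf g - (\<Sum>k<n. g k))"
      by (intro sums_diff sums_If_finite_set summable_sums) (use sc in \<open>auto simp: g_def\<close>)
    moreover have "(\<lambda>k. g k - (if k \<in> {..<n} then g k else 0)) = (\<lambda>k. \<bar>tail n k\<bar> * fact k / R ^ k)"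
      by (auto simp: tail_def g_def)
    ultimately show ?thesis by simp
  qed
  then have ts: "borel_summable R (tail n)" for n using R
      by (auto simp: borel_summable_def sums_iff)
  have tail_ps: "power_series (tail n) x = power_series c x - (\<Sum>k<n. c k * x ^ k)" for n x
  proof -
    have "(\<lambda>k. c k * x ^ k - (if k \<in> {..<n} then c k * x ^ k else 0)) sums (power_series c x
        - (\<Sum>k<n. c k * x ^ k))"
      by (intro sums_diff sums_If_finite_set integral_borel_transform_0(1)[OF c]) auto
    moreover have "(\<lambda>k. c k * x ^ k - (if k \<in> {..<n} then c k * x ^ k else 0))
      = (\<lambda>k. tail n k * x ^ k)"
      by (auto simp: tail_def)
    ultimately show ?thesis by (simp add: power_series_def sums_iff)
  qed
  define D where "D = cwick_bound R {0} (\<lambda>_. f) (\<lambda>_. X)"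
  have DL: "D \<in> L2_space M" unfolding D_def by (rule cwick_bound_L2) (use X in auto)
  \<comment> \<open>The tail of the series of absolute values, a uniform bound on the circle for the
    Borel transform of \<open>tail n\<close>.\<close>
  define K where "K n = suminf g - (\<Sum>k<n. g k)" for n
  have K0: "K \<longlonglongrightarrow> 0"
  proof -
    have "(\<lambda>n. \<Sum>k<n. g k) \<longlonglongrightarrow> suminf g" using summable_LIMSEQ[of g] sc by (simp add: g_def[abs_def])
    then have "(\<lambda>n. suminf g - (\<Sum>k<n. g k)) \<longlonglongrightarrow> suminf g - suminf g" by (intro tendsto_intros)
    then show ?thesis by (simp add: K_def[abs_def])
  qed
  have le: "AE \<omega> in M. \<bar>S n \<omega> - V \<omega>\<bar> \<le> K n * D \<omega>" for n
  proof -
    define E where "E = (\<lambda>\<omega>. 1 * V \<omega> + (-1) * S n \<omega>)"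
    have "has_S_transform E (\<lambda>h. 1 * power_series c (inner_01 f h) + (-1)
        * (\<Sum>k<n. c k * inner_01 f h ^ k))"
      unfolding E_def by (rule has_S_transform_lin[OF V S])
    moreover have "(\<lambda>h. 1 * power_series c (inner_01 f h) + (-1) * (\<Sum>k<n. c k * inner_01 f h ^ k))
        = mix_S {0} (\<lambda>_. tail n) {} (\<lambda>_. f)"
      by (auto simp: mix_S_def tail_ps)
    ultimately have E: "has_S_transform E (mix_S {0} (\<lambda>_. tail n) {} (\<lambda>_. f))" by (simp only:)
    have "AE \<omega> in M. complex_of_real (E \<omega>)
        = wick_mixture R {0} (mix_weight R {0} (\<lambda>_. tail n) {}) (\<lambda>_. f) (\<lambda>_. X) \<omega>"
      by (rule AE_eq_wick_mixture[OF E]) (use R ts X in auto)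
    then show ?thesis
    proof eventually_elim
      case (elim \<omega>)
      have "bounded_weight {0} (mix_weight R {0} (\<lambda>_. tail n) {}) (mix_bound R {0} (\<lambda>_. tail n) {})"
        by (rule bounded_weight_mix_weight) (use ts in auto)
      then have "norm (complex_of_real (E \<omega>)) \<le> mix_bound R {0} (\<lambda>_. tail n) {} * D \<omega>"
        unfolding elim D_def by (intro norm_wick_mixture_le R) auto
      then have "\<bar>E \<omega>\<bar> \<le> mix_bound R {0} (\<lambda>_. tail n) {} * D \<omega>" by (simp only: norm_of_real)
      moreover have "mix_bound R {0} (\<lambda>_. tail n) {} = K n"
        using tail_g[of n] by (simp add: mix_bound_def K_def sums_iff)
      ultimately show ?case by (simp add: E_def abs_minus_commute)
    qed
  qed
  have SV: "L2_tendsto M S V"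
    unfolding L2_tendsto_def
  proof (intro conjI allI)
    have L: "S n \<in> L2_space M" "V \<in> L2_space M" for n using S V by (auto simp: has_S_transform_def)
    then show "S n \<in> L2_space M" "V \<in> L2_space M" for n by auto
    show "(\<lambda>n. \<integral>\<omega>. (S n \<omega> - V \<omega>)\<^sup>2 \<partial>M) \<longlonglongrightarrow> 0"
    proof (rule Lim_null_comparison)
      show "\<forall>\<^sub>F n in sequentially. norm (\<integral>\<omega>. (S n \<omega> - V \<omega>)\<^sup>2 \<partial>M) \<le> (K n)\<^sup>2 * (\<integral>\<omega>. (D \<omega>)\<^sup>2 \<partial>M)"
      proof (intro always_eventually allI)
        fix n
        have "(\<integral>\<omega>. (S n \<omega> - V \<omega>)\<^sup>2 \<partial>M) \<le> (\<integral>\<omega>. (K n * D \<omega>)\<^sup>2 \<partial>M)"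
        proof (rule integral_mono_AE)
          show "integrable M (\<lambda>\<omega>. (S n \<omega> - V \<omega>)\<^sup>2)" using L2_space_diff[OF L] by (rule L2_spaceD)
          show "integrable M (\<lambda>\<omega>. (K n * D \<omega>)\<^sup>2)" using L2_space_cmult[OF DL] by (rule L2_spaceD)
          show "AE \<omega> in M. (S n \<omega> - V \<omega>)\<^sup>2 \<le> (K n * D \<omega>)\<^sup>2"
            using le[of n]
          proof eventually_elim
            case (elim \<omega>)
            then have "\<bar>S n \<omega> - V \<omega>\<bar>\<^sup>2 \<le> (K n * D \<omega>)\<^sup>2" by (intro power_mono) auto
            then show ?case by simp
          qed
        qed
        also have "\<dots> = (K n)\<^sup>2 * (\<integral>\<omega>. (D \<omega>)\<^sup>2 \<partial>M)" by (simp add: power_mult_distrib)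
        finally show "norm (\<integral>\<omega>. (S n \<omega> - V \<omega>)\<^sup>2 \<partial>M) \<le> (K n)\<^sup>2 * (\<integral>\<omega>. (D \<omega>)\<^sup>2 \<partial>M)" by simp
      qed
      have "(\<lambda>n. (K n)\<^sup>2 * (\<integral>\<omega>. (D \<omega>)\<^sup>2 \<partial>M)) \<longlonglongrightarrow> 0\<^sup>2 * (\<integral>\<omega>. (D \<omega>)\<^sup>2 \<partial>M)" by (intro tendsto_intros K0)
      then show "(\<lambda>n. (K n)\<^sup>2 * (\<integral>\<omega>. (D \<omega>)\<^sup>2 \<partial>M)) \<longlonglongrightarrow> 0" by simp
    qed
  qed
  \<comment> \<open>\<open>V\<close> shows that the choice in \<open>wick_series\<close> is not
    void, and two L^2 limits agree almost surely, so the S-transform passes to the chosen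
    one.\<close>
  have "L2_tendsto M S (wick_series M W c f)"
    unfolding wick_series_def X_def[symmetric] S_def[symmetric] by (rule someI[of _ V]) (rule SV)
  moreover from this have "wick_series M W c f \<in> borel_measurable M"
    by (auto simp: L2_tendsto_def L2_space_def)
  ultimately show ?thesis
    by (intro has_S_transform_cong_AE[OF V] L2_tendsto_AE_unique[OF SV])
qed

text \<open>Each multiplication multiplies S-transforms, provided the product exists in L^2. The
  mixture over all indices up to \<open>Suc m\<close> guarantees this at every stage.\<close>

lemma wick_analytic_has_S_transform:
  assumes f: "\<And>i. i \<in> {1..m} \<Longrightarrow> f i \<in> L2_01" and a: "\<And>i. i \<in> {1..m} \<Longrightarrow> borel_summable R (a i)"
    and R: "R > 0"
  shows "has_S_transform (wick_analytic M W m a f) (mix_S {1..m} a {} f)"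
  unfolding wick_analytic_def using f a
proof (induction m)
  case 0
  then show ?case using has_S_transform_one by (simp add: mix_S_def[abs_def])
next
  case (Suc m)
  have eq: "mix_S {1..Suc m} a {} f = (\<lambda>h. mix_S {1..m} a {} f h
      * power_series (a (Suc m)) (inner_01 (f (Suc m)) h))"
    by (auto simp: mix_S_def)
  have "has_S_transform (\<lambda>\<omega>. Re (wick_mixture R {1..Suc m} (mix_weight R {1..Suc m} a {}) f
      (\<lambda>i. wiener_integral M W (f i)) \<omega>)) (mix_S {1..Suc m} a {} f)"
    by (rule wick_mixture_has_S_transform(1)) (use Suc.prems R in \<open>auto intro!:
      is_wiener_integral_wiener_integral\<close>)
  then have ex: "has_S_transform (\<lambda>\<omega>. Re (wick_mixture R {1..Suc m} (mix_weight R {1..Suc m} a {})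
      f (\<lambda>i. wiener_integral M W (f i)) \<omega>))
     (\<lambda>h. mix_S {1..m} a {} f h * power_series (a (Suc m)) (inner_01 (f (Suc m)) h))" unfolding eq .
  have "has_S_transform (wick_series M W (a (Suc m)) (f (Suc m)))
      (\<lambda>h. power_series (a (Suc m)) (inner_01 (f (Suc m)) h))"
    by (rule wick_series_has_S_transform) (use Suc.prems in auto)
  from has_S_transform_wick_prod[OF Suc.IH this ex] Suc.prems
  show ?case unfolding eq by simp
qed

text \<open>Changing the coefficients of factor j yields the S-transform that also belongs to the
  weight z_j B_j(z_j) formed with the original coefficients. The latter form is the one produced by
  expanding the exponential.\<close>

lemma wick_analytic_partial_has_S_transform:
  assumes f: "\<And>i. i \<in> {1..m} \<Longrightarrow> f i \<in> L2_01" and a: "\<And>i. i \<in> {1..m} \<Longrightarrow> borel_summable R (a i)"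
    and R: "R > 0"
  shows "has_S_transform (wick_analytic_partial M W m a f j) (mix_S {1..m} a {j} f)"
proof -
  have "has_S_transform (wick_analytic M W m (a(j := deriv_coeffs (a j))) f)
      (mix_S {1..m} (a(j := deriv_coeffs (a j))) {} f)"
    by (rule wick_analytic_has_S_transform[OF f _ R]) (use a borel_summable_deriv in auto)
  moreover have "mix_S {1..m} (a(j := deriv_coeffs (a j))) {} f = mix_S {1..m} a {j} f"
    unfolding mix_S_def by (intro ext prod.cong) auto
  ultimately show ?thesis by (simp add: wick_analytic_partial_def deriv_coeffs_def)
qed

end

text \<open>If k! |a i k| \<le> D^k, then for R \<ge> 2 D the k-th term is at most 2^(-k). The claim
  covers all large R, so that a single radius can be used for two functionals.\<close>

lemma wick_analytic_coeffs_borel_summable: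
  assumes "wick_analytic_coeffs K a"
  shows "\<exists>R0>0. \<forall>R\<ge>R0. \<forall>i\<in>{1..K}. borel_summable R (a i)"
proof -
  obtain C where C: "\<And>i k. i \<in> {1..K} \<Longrightarrow> 1 \<le> k \<Longrightarrow> root k (fact k * \<bar>a i k\<bar>) \<le> C"
    using assms unfolding wick_analytic_coeffs_def bdd_above_def by blast
  define D where "D = max C 1"
  have "borel_summable R (a i)" if R: "R \<ge> 2 * D" and i: "i \<in> {1..K}" for R i
  proof -
    have D1: "D \<ge> 1" by (simp add: D_def)
    have R0: "R > 0" using R D1 by linarith
    have le: "\<bar>a i k\<bar> * fact k / R ^ k \<le> (1/2) ^ k" if k: "k \<ge> 1" for k
    proof -
      have "root k (fact k * \<bar>a i k\<bar>) \<le> D" using C[OF i k] by (simp add: D_def)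
      then have "root k (fact k * \<bar>a i k\<bar>) ^ k \<le> D ^ k"
        using k by (intro power_mono real_root_ge_zero) auto
      then have "\<bar>a i k\<bar> * fact k \<le> D ^ k" using k by (simp add: mult.commute)
      also have "\<dots> \<le> (R / 2) ^ k" using R D1 by (intro power_mono) auto
      finally have "\<bar>a i k\<bar> * fact k / R ^ k \<le> (R / 2) ^ k / R ^ k" using R0
          by (intro divide_right_mono) auto
      also have "\<dots> = (1/2) ^ k" using R0 by (simp add: power_divide)
      finally show ?thesis .
    qed
    have "summable (\<lambda>k. \<bar>a i k\<bar> * fact k / R ^ k)"
      \<comment> \<open>The comparison starts at 1 because the growth condition does not involve the
        coefficient of degree 0.\<close>
      by (rule summable_comparison_test'[where g="\<lambda>k. (1/2) ^ k" and N=1])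
         (use le R0 in \<open>auto simp: summable_geometric abs_mult\<close>)
    then show ?thesis using R0 by (simp add: borel_summable_def)
  qed
  moreover have "2 * D > 0" by (simp add: D_def)
  ultimately show ?thesis by blast
qed

subsection \<open>Averaging over the grid\<close>

definition grid_cell :: "nat \<Rightarrow> nat \<Rightarrow> real \<Rightarrow> real" where
  "grid_cell n k = indicator {real k / real n<..real (Suc k) / real n}"

definition grid_steps :: "nat \<Rightarrow> (real \<Rightarrow> real) \<Rightarrow> (real \<times> real \<times> real) list" where
  "grid_steps n f = map (\<lambda>k. (real n * inner_01 f (grid_cell n k), real k / real n, real (Suc k)
    / real n)) [0..<n]"

text \<open>The orthogonal projection of f onto the functions constant on the cells. Being a step
  function, it has a Wiener integral made of finitely many increments of W.\<close>

definition grid_average :: "nat \<Rightarrow> (real \<Rightarrow> real) \<Rightarrow> real \<Rightarrow> real" where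
  "grid_average n f = step_fun (grid_steps n f)"

lemma is_step_grid_steps: "n > 0 \<Longrightarrow> is_step (grid_steps n f)"
  by (auto simp: grid_steps_def is_step_def divide_right_mono)

lemma grid_average_eq:
  "grid_average n f s = (\<Sum>k<n. (real n * inner_01 f (grid_cell n k)) * grid_cell n k s)"
  unfolding grid_average_def grid_steps_def step_fun_def grid_cell_def map_map o_def split_def
    fst_conv snd_conv
  by (subst interv_sum_list_conv_sum_set_nat) (simp add: lessThan_atLeast0)

lemma grid_cell_L2: "grid_cell n k \<in> L2_01"
  by (rule L2_space_bounded[OF finite_measure_unit measurable_unit_borel, of _ 1])
     (auto simp: grid_cell_def indicator_def[abs_def])

lemma grid_average_L2: "grid_average n f \<in> L2_01"
  unfolding grid_average_def by (rule step_fun_L2)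

lemma grid_cell_mult:
  assumes "n > 0"
  shows "grid_cell n k s * grid_cell n l s = of_bool (k = l) * grid_cell n k s"
proof (cases "k = l")
  case False
  have *: "real (Suc i) / real n \<le> real j / real n" if "i < j" for i j
    using that assms by (intro divide_right_mono) auto
  show ?thesis using False *[of k l] *[of l k]
    by (cases k l rule: linorder_cases) (auto simp: grid_cell_def indicator_def)
qed (auto simp: grid_cell_def indicator_def)

lemma inner_grid_cell:
  assumes "k < n"
  shows "inner_01 (grid_cell n k) (grid_cell n l) = of_bool (k = l) / real n"
proof -
  have n: "n > 0" using assms by simp
  have "has_bochner_integral unit_interval_measure (grid_cell n k) (real (Suc k) / real n - real k
      / real n)"
    unfolding grid_cell_def using assms by (intro integral_indicator_unit) (auto simp: field_simps)
  moreover have "real (Suc k) / real n - real k / real n = 1 / real n"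
    by (simp add: diff_divide_distrib[symmetric])
  ultimately have "(\<integral>s. grid_cell n k s \<partial>unit_interval_measure) = 1 / real n"
    by (simp add: has_bochner_integral_iff)
  then show ?thesis unfolding inner_01_def grid_cell_mult[OF n] by simp
qed

lemma inner_grid_average_cell:
  assumes "l < n"
  shows "inner_01 (grid_average n f) (grid_cell n l) = inner_01 f (grid_cell n l)"
proof -
  have "inner_01 (grid_average n f) (grid_cell n l)
    = (\<Sum>k<n. (real n * inner_01 f (grid_cell n k)) * inner_01 (grid_cell n k) (grid_cell n l))"
    unfolding grid_average_eq[abs_def] by (rule inner_sum_left) (auto intro: grid_cell_L2)
  also have "\<dots> = (\<Sum>k<n. if k = l then inner_01 f (grid_cell n l) else 0)"
    by (intro sum.cong) (auto simp: inner_grid_cell)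
  also have "\<dots> = inner_01 f (grid_cell n l)" using assms by simp
  finally show ?thesis .
qed

lemma inner_sum_right:
  assumes "\<And>i. i \<in> A \<Longrightarrow> u i \<in> L2_01" "h \<in> L2_01"
  shows "inner_01 h (\<lambda>s. \<Sum>i\<in>A. c i * u i s) = (\<Sum>i\<in>A. c i * inner_01 h (u i))"
  using inner_sum_left[OF assms] by (simp add: inner_commute)

text \<open>The sum is symmetric in f and g, which expresses that the projection is self-adjoint;
  the second part is its idempotence.\<close>

lemma inner_grid_average_average:
  assumes "f \<in> L2_01"
  shows "inner_01 f (grid_average n g) = (\<Sum>k<n. real n * inner_01 f (grid_cell n k)
      * inner_01 g (grid_cell n k))"
    and "inner_01 (grid_average n f) (grid_average n g) = inner_01 f (grid_average n g)"
proof -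
  show 1: "inner_01 f (grid_average n g) = (\<Sum>k<n. real n * inner_01 f (grid_cell n k)
      * inner_01 g (grid_cell n k))"
    unfolding grid_average_eq[abs_def]
    by (subst inner_sum_right) (auto intro: grid_cell_L2 assms sum.cong simp: mult_ac)
  have "inner_01 (grid_average n f) (grid_average n g)
    = (\<Sum>k<n. (real n * inner_01 g (grid_cell n k)) * inner_01 (grid_average n f) (grid_cell n k))"
    unfolding grid_average_eq[of n g, abs_def]
    by (subst inner_sum_right) (auto intro: grid_cell_L2 grid_average_L2)
  then show "inner_01 (grid_average n f) (grid_average n g) = inner_01 f (grid_average n g)"
    by (simp add: 1 inner_grid_average_cell mult_ac)
qed

lemma indicator_eq_sum_grid_cell:
  assumes "n > 0"
  shows "indicator {0<..real j / real n} s = (\<Sum>k<j. grid_cell n k s)"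
proof (induction j)
  case 0
  then show ?case by simp
next
  case (Suc j)
  have "0 \<le> real j / real n" "real j / real n \<le> real (Suc j) / real n"
    using assms by (auto intro!: divide_right_mono simp del: of_nat_Suc)
  moreover have "indicator {0<..q} s = indicator {0<..p} s + (indicator {p<..q} s :: real)"
    if "0 \<le> p" "p \<le> q" for p q :: real
    using that by (auto simp: indicator_def)
  ultimately have "indicator {0<..real (Suc j) / real n} s
    = indicator {0<..real j / real n} s + grid_cell n j s"
    unfolding grid_cell_def by blast
  then show ?case using Suc by simp
qed

text \<open>Step functions jumping only at grid points are combinations of cells, hence fixed by the
  projection. Their Wick exponentials are the ones that test equality on the sigma-algebra of the
  grid.\<close>

lemma inner_grid_average_grid_step:
  assumes n: "n > 0" and f: "f \<in> L2_01" and S: "S \<subseteq> (\<lambda>k. real k / real n) ` {1..n}"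
  shows "inner_01 (grid_average n f) (\<lambda>r. \<Sum>s\<in>S. c s * indicator {0<..s} r)
    = inner_01 f (\<lambda>r. \<Sum>s\<in>S. c s * indicator {0<..s} r)"
proof -
  have IL: "indicator {0<..s} \<in> L2_01" for s :: real
    by (rule L2_space_bounded[OF finite_measure_unit measurable_unit_borel, of _ 1])
      (auto simp: indicator_def[abs_def])
  have "inner_01 (grid_average n f) (indicator {0<..s}) = inner_01 f (indicator {0<..s})"
      if "s \<in> S" for s
  proof -
    have "s \<in> (\<lambda>k. real k / real n) ` {1..n}" using S that by (rule subsetD)
    then obtain j where j: "s = real j / real n" "j \<le> n" by auto
    have e: "indicator {0<..s} = (\<lambda>r. \<Sum>k<j. 1 * grid_cell n k r)"
      using indicator_eq_sum_grid_cell[OF n, of j] by (auto simp: j)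
    show ?thesis unfolding e
      using j(2) by (simp only: inner_sum_right[OF grid_cell_L2 f]
        inner_sum_right[OF grid_cell_L2 grid_average_L2])
        (auto intro!: sum.cong simp: inner_grid_average_cell)
  qed
  then show ?thesis
    by (simp add: inner_sum_right[OF IL f] inner_sum_right[OF IL grid_average_L2])
qed

section \<open>Conditional expectation with respect to the grid\<close>

context brownian
begin

text \<open>\<open>W\<close> vanishes at time \<open>0\<close> only almost surely, and \<open>W 0\<close> is not measurable with respect to the
  grid; hence the value at time \<open>0\<close> is replaced by \<open>0\<close>.\<close>

definition grid_wiener :: "nat \<Rightarrow> (real \<Rightarrow> real) \<Rightarrow> 'a \<Rightarrow> real" where
  "grid_wiener n f = step_integral (\<lambda>t \<omega>. if t = 0 then 0 else W t \<omega>) (grid_steps n f)"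

definition grid_sigma :: "nat \<Rightarrow> 'a measure" where
  "grid_sigma n = sigma_gen_by M W ((\<lambda>k. real k / real n) ` {1..n})"

lemma grid_points: "n > 0 \<Longrightarrow> (\<lambda>k. real k / real n) ` {1..n} \<subseteq> {0..1}"
  by auto

lemma grid_wiener_measurable:
  assumes n: "n > 0"
  shows "grid_wiener n f \<in> borel_measurable (grid_sigma n)"
proof -
  define V where "V = (\<lambda>t \<omega>. if t = 0 then 0 else W t \<omega>)"
  have V: "V (real k / real n) \<in> borel_measurable (grid_sigma n)" if "k \<le> n" for k
  proof (cases "k = 0")
    case False
    then have "W (real k / real n) \<in> borel_measurable (grid_sigma n)"
      unfolding grid_sigma_def using that by (intro measurable_sigma_gen_by) auto
    then show ?thesis using False n by (simp add: V_def)
  qed (simp add: V_def)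
  have "grid_wiener n f = (\<lambda>\<omega>. \<Sum>k\<in>{0..<n}. real n * inner_01 f (grid_cell n k)
      * (V (real (Suc k) / real n) \<omega> - V (real k / real n) \<omega>))"
    unfolding grid_wiener_def grid_steps_def step_integral_def map_map o_def split_def fst_conv
      snd_conv V_def
    by (subst interv_sum_list_conv_sum_set_nat) simp
  also have "\<dots> \<in> borel_measurable (grid_sigma n)"
    by (intro borel_measurable_sum borel_measurable_times borel_measurable_diff V
      borel_measurable_const) auto
  finally show ?thesis .
qed

lemma subalgebra_grid_sigma: "n > 0 \<Longrightarrow> subalgebra M (grid_sigma n)"
  unfolding grid_sigma_def by (rule subalgebra_sigma_gen_by) (use grid_points W_measurable in blast)

lemma is_wiener_integral_grid_wiener:
  assumes n: "n > 0"
  shows "is_wiener_integral M W (grid_average n f) (grid_wiener n f)"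
  unfolding grid_average_def
proof (rule is_wiener_integral_cong_AE[OF is_wiener_integral_step[OF is_step_grid_steps[OF n]]])
  show "grid_wiener n f \<in> borel_measurable M"
    using measurable_from_subalg[OF subalgebra_grid_sigma[OF n] grid_wiener_measurable[OF n]] .
  show "AE \<omega> in M. step_integral W (grid_steps n f) \<omega> = grid_wiener n f \<omega>"
    using brownian_motionD(3)[OF bm]
  proof eventually_elim
    case (elim \<omega>)
    then have "(if t = 0 then 0 else W t \<omega>) = W t \<omega>" for t by simp
    then show ?case by (simp add: grid_wiener_def step_integral_def)
  qed
qed

text \<open>The averaged mixture is measurable for the grid, and its S-transform agrees with that of
  \<open>Y\<close> at all step functions on the grid. By \<open>wick_exp_unique_sigma\<close> both
  have the same integrals over the sets of the grid sigma-algebra, which characterizes the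
  conditional expectation.\<close>

lemma grid_approx_eq_mixture:
  assumes n: "n > 0" and f: "\<And>i. i \<in> A \<Longrightarrow> f i \<in> L2_01" and Y: "has_S_transform Y (mix_S A a {} f)"
    and A: "finite A" and R: "R > 0" and a: "\<And>i. i \<in> A \<Longrightarrow> borel_summable R (a i)"
  shows "AE \<omega> in M. complex_of_real (grid_approx M W n Y \<omega>)
    = wick_mixture R A (mix_weight R A a {}) (\<lambda>i. grid_average n (f i)) (\<lambda>i. grid_wiener n (f i)) \<omega>"
    and "grid_approx M W n Y \<in> L2_space M"
proof -
  define T where "T = (\<lambda>k. real k / real n) ` {1..n}"
  define \<Phi> where "\<Phi> = wick_mixture R A (mix_weight R A a {}) (\<lambda>i. grid_average n (f i))
      (\<lambda>i. grid_wiener n (f i))"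
  have X: "is_wiener_integral M W (grid_average n (f i)) (grid_wiener n (f i))" for i
    by (rule is_wiener_integral_grid_wiener[OF n])
  have S: "has_S_transform (\<lambda>\<omega>. Re (\<Phi> \<omega>)) (mix_S A a {} (\<lambda>i. grid_average n (f i)))"
    and Im: "AE \<omega> in M. Im (\<Phi> \<omega>) = 0"
    unfolding \<Phi>_def using A R a X by (intro wick_mixture_has_S_transform; simp)+
  have L: "(\<lambda>\<omega>. Re (\<Phi> \<omega>)) \<in> L2_space M" "Y \<in> L2_space M" using S Y
      by (auto simp: has_S_transform_def)
  have one: "(\<lambda>_. 1) \<in> L2_space M" using L2_space_bounded[OF finite_measure_axioms, of "\<lambda>_. 1" 1]
      by simp
  have i: "integrable M (\<lambda>\<omega>. Re (\<Phi> \<omega>))" "integrable M Y"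
    using L2_mult_integrable[OF L(1) one] L2_mult_integrable[OF L(2) one] by simp_all
  note sub = subalgebra_grid_sigma[OF n]
  interpret C: finite_measure_subalgebra M "grid_sigma n"
    by unfold_locales (rule sub)
  have m: "(\<lambda>\<omega>. Re (\<Phi> \<omega>)) \<in> borel_measurable (grid_sigma n)"
  proof -
    have "\<Phi> \<in> borel_measurable (grid_sigma n)"
      unfolding \<Phi>_def
      by (rule wick_mixture_measurable[OF bounded_weight_mix_weight[OF A a]])
        (auto intro: grid_wiener_measurable[OF n])
    then show ?thesis by simp
  qed
  have ce: "AE \<omega> in M. grid_approx M W n Y \<omega> = Re (\<Phi> \<omega>)"
    unfolding grid_approx_def grid_sigma_def[symmetric]
  proof (rule C.real_cond_exp_charact[OF _ i(2) i(1) m])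
    fix E assume E: "E \<in> sets (grid_sigma n)"
    then have EM: "E \<in> sets M" using sub by (auto simp: subalgebra_def)
    have "(\<integral>\<omega>\<in>E. Y \<omega> - Re (\<Phi> \<omega>) \<partial>M) = 0"
    proof (rule wick_exp_unique_sigma[OF grid_points[OF n]])
      show "(\<lambda>\<omega>. Y \<omega> - Re (\<Phi> \<omega>)) \<in> L2_space M" using L by (intro L2_space_diff)
      show "E \<in> sets (sigma_gen_by M W ((\<lambda>k. real k / real n) ` {1..n}))" using E
          by (simp add: grid_sigma_def)
      fix S' c assume S': "finite S'" "S' \<subseteq> (\<lambda>k. real k / real n) ` {1..n}"
      define h where "h = (\<lambda>r. \<Sum>s\<in>S'. c s * indicator {0<..s} r :: real)"
      have h: "h \<in> L2_01" unfolding h_def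
        using S' grid_points[OF n]
          by (intro is_wiener_integral_L2(1)[OF is_wiener_integral_brownian]) auto
      have "mix_S A a {} (\<lambda>i. grid_average n (f i)) h = mix_S A a {} f h"
        unfolding mix_S_def h_def using f S'
        by (intro prod.cong refl) (simp only: inner_grid_average_grid_step[OF n])
      moreover have "(\<integral>\<omega>. (Y \<omega> - Re (\<Phi> \<omega>)) * wick_exp M W h \<omega> \<partial>M)
         = (\<integral>\<omega>. Y \<omega> * wick_exp M W h \<omega> \<partial>M) - (\<integral>\<omega>. Re (\<Phi> \<omega>) * wick_exp M W h \<omega> \<partial>M)"
        unfolding left_diff_distrib
        by (intro Bochner_Integration.integral_diff L2_mult_integrable L wick_exp_L2 h)
      ultimately show "(\<integral>\<omega>. (Y \<omega> - Re (\<Phi> \<omega>)) * wick_exp M W h \<omega> \<partial>M) = 0"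
        using S Y h by (simp add: has_S_transform_def)
    qed
    moreover have "set_integrable M E Y" "set_integrable M E (\<lambda>\<omega>. Re (\<Phi> \<omega>))"
      unfolding set_integrable_def using i integrable_mult_indicator[OF EM] by blast+
    ultimately show "(\<integral>\<omega>\<in>E. Y \<omega> \<partial>M) = (\<integral>\<omega>\<in>E. Re (\<Phi> \<omega>) \<partial>M)"
      by (simp add: set_integral_diff)
  qed
  show "AE \<omega> in M. complex_of_real (grid_approx M W n Y \<omega>) = \<Phi> \<omega>"
    using ce Im by eventually_elim (simp add: complex_eq_iff)
  have gm: "grid_approx M W n Y \<in> borel_measurable M"
    unfolding grid_approx_def by simp
  have "AE \<omega> in M. Re (\<Phi> \<omega>) = grid_approx M W n Y \<omega>" using ce by eventually_elim simp
  from has_S_transform_cong_AE[OF S gm this] show "grid_approx M W n Y \<in> L2_space M"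
    by (simp add: has_S_transform_def)
qed

end

subsection \<open>Approximation by averages of functions with derivative of bounded variation\<close>

lemma bounded_variation_bounded:
  assumes "bounded_variation_01 q"
  shows "\<exists>K. \<forall>s\<in>{0..1}. \<bar>q s\<bar> \<le> K"
proof -
  obtain B where B: "\<And>n (t :: nat \<Rightarrow> real). 0 \<le> t 0 \<Longrightarrow> t n \<le> 1 \<Longrightarrow> (\<forall>i<n. t i \<le> t (Suc i)) \<Longrightarrow>
        (\<Sum>i<n. \<bar>q (t (Suc i)) - q (t i)\<bar>) \<le> B"
    using assms unfolding bounded_variation_01_def by blast
  have "\<bar>q s\<bar> \<le> \<bar>q 0\<bar> + B" if "s \<in> {0..1}" for s
    \<comment> \<open>The partition consisting of the two points 0 and s.\<close>
    using B[of "\<lambda>i. if i = 0 then 0 else s" 1] that by auto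
  then show ?thesis by blast
qed

text \<open>A function of bounded variation need not attain its supremum on a cell, but values above
  half of a positive supremum do occur. If the supremum is not positive, any point serves.\<close>

lemma obtain_near_max:
  fixes q :: "'b \<Rightarrow> real"
  assumes "S \<noteq> {}" "\<And>s. s \<in> S \<Longrightarrow> 0 \<le> q s" "\<And>s. s \<in> S \<Longrightarrow> q s \<le> K"
  shows "\<exists>s\<in>S. \<forall>t\<in>S. q t \<le> 2 * q s"
proof -
  define m where "m = (SUP s\<in>S. q s)"
  have bdd: "bdd_above (q ` S)" using assms(3) by (rule bdd_aboveI2)
  have le: "q t \<le> m" if "t \<in> S" for t unfolding m_def by (rule cSUP_upper[OF that bdd])
  show ?thesis
  proof (cases "m \<le> 0")
    case True
    obtain s where "s \<in> S" using assms(1) by blast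
    moreover have "q t \<le> 2 * q s" if "t \<in> S" for t
      using le[OF that] True assms(2)[OF \<open>s \<in> S\<close>] by linarith
    ultimately show ?thesis by blast
  next
    case False
    then have "m / 2 < (SUP s\<in>S. q s)" by (simp add: m_def[symmetric])
    then obtain s where s: "s \<in> S" "m / 2 < q s" using less_cSUP_iff[OF assms(1) bdd] by blast
    moreover have "q t \<le> 2 * q s" if "t \<in> S" for t using le[OF that] s(2) by linarith
    ultimately show ?thesis by blast
  qed
qed

text \<open>Refine the partition by points at which the oscillation over each cell is attained up to a
  factor \<open>2\<close>.\<close>

lemma bounded_variation_oscillation:
  assumes "bounded_variation_01 q"
  shows "\<exists>V. \<forall>n>0. \<exists>osc. (\<Sum>k<n. osc k) \<le> V \<and>
    (\<forall>k<n. \<forall>s\<in>{real k / real n..real (Suc k) / real n}. \<bar>q s - q (real k / real n)\<bar> \<le> osc k)"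
proof -
  obtain B where B: "\<And>n (t :: nat \<Rightarrow> real). 0 \<le> t 0 \<Longrightarrow> t n \<le> 1 \<Longrightarrow> (\<forall>i<n. t i \<le> t (Suc i)) \<Longrightarrow>
        (\<Sum>i<n. \<bar>q (t (Suc i)) - q (t i)\<bar>) \<le> B"
    using assms unfolding bounded_variation_01_def by blast
  obtain K where K: "\<And>s. s \<in> {0..1} \<Longrightarrow> \<bar>q s\<bar> \<le> K" using bounded_variation_bounded[OF assms] by blast
  have "\<exists>osc. (\<Sum>k<n. osc k) \<le> 2 * B \<and>
    (\<forall>k<n. \<forall>s\<in>{real k / real n..real (Suc k) / real n}. \<bar>q s - q (real k / real n)\<bar> \<le> osc
      k)" if n: "n > 0" for n
  proof -
    define C where "C k = {real k / real n..real (Suc k) / real n}" for k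
    have C01: "C k \<subseteq> {0..1}" if "k < n" for k
    proof -
      have "0 \<le> real k / real n" by simp
      moreover have "real (Suc k) / real n \<le> 1" using that n by (simp add: divide_le_eq)
      ultimately show ?thesis unfolding C_def by auto
    qed
    have aC: "real k / real n \<in> C k" for k unfolding C_def using n
        by (auto intro!: divide_right_mono)
    have "\<exists>s\<in>C k. \<forall>t\<in>C k. \<bar>q t - q (real k / real n)\<bar> \<le> 2 * \<bar>q s - q (real k / real n)\<bar>"
        if "k < n" for k
    proof (rule obtain_near_max[where K="2 * K"])
      show "C k \<noteq> {}" using aC by blast
      fix s assume "s \<in> C k"
      then have "\<bar>q s\<bar> \<le> K" "\<bar>q (real k / real n)\<bar> \<le> K" using C01[OF that] aC K by blast+
      then show "\<bar>q s - q (real k / real n)\<bar> \<le> 2 * K" by linarith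
    qed simp
    then obtain s where s: "\<And>k. k < n \<Longrightarrow> s k \<in> C k"
      "\<And>k t. k < n \<Longrightarrow> t \<in> C k \<Longrightarrow> \<bar>q t - q (real k / real n)\<bar> \<le> 2 * \<bar>q (s k) - q (real k / real n)\<bar>"
      by metis
    \<comment> \<open>Grid points stand at the even positions and the point \<open>s k\<close> of
      cell k at position 2k+1. Of the 2n increments only those from k/n to \<open>s k\<close> are
      kept.\<close>
    define t where "t i = (if even i then real (i div 2) / real n else s (i div 2))" for i
    have te: "t (2 * k) = real k / real n" and to: "t (Suc (2 * k)) = s k"
        and te': "t (Suc (Suc (2 * k))) = real (Suc k) / real n" for k
      by (simp_all add: t_def)
    have "(\<Sum>i<2 * n. \<bar>q (t (Suc i)) - q (t i)\<bar>) \<le> B"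
    proof (rule B)
      show "0 \<le> t 0" "t (2 * n) \<le> 1" using te[of 0] te[of n] n by simp_all
      show "\<forall>i<2 * n. t i \<le> t (Suc i)"
      proof (intro allI impI)
        fix i assume i: "i < 2 * n"
        show "t i \<le> t (Suc i)"
        proof (cases "even i")
          case True
          then obtain k where k: "i = 2 * k" by blast
          then have "s k \<in> C k" using i by (intro s) simp
          then show ?thesis unfolding k te to C_def by simp
        next
          case False
          then obtain k where k: "i = Suc (2 * k)" by (metis oddE Suc_eq_plus1)
          then have "s k \<in> C k" using i by (intro s) simp
          then show ?thesis unfolding k te' to C_def by simp
        qed
      qed
    qed
    moreover have "(\<Sum>k<m. \<bar>q (s k) - q (real k / real n)\<bar>)
      \<le> (\<Sum>i<2 * m. \<bar>q (t (Suc i)) - q (t i)\<bar>)" for m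
    proof (induction m)
      case (Suc m)
      have "(\<Sum>i<2 * Suc m. \<bar>q (t (Suc i)) - q (t i)\<bar>)
        = (\<Sum>i<2 * m. \<bar>q (t (Suc i)) - q (t i)\<bar>) + \<bar>q (s m) - q (real m / real n)\<bar> + \<bar>q
          (real (Suc m) / real n) - q (s m)\<bar>"
        by (simp only: mult_Suc_right numeral_2_eq_2 add_Suc add_0 sum.lessThan_Suc
          te[unfolded numeral_2_eq_2] to[unfolded numeral_2_eq_2] te'[unfolded numeral_2_eq_2])
      then show ?case using Suc by simp
    qed simp
    ultimately have "(\<Sum>k<n. \<bar>q (s k) - q (real k / real n)\<bar>) \<le> B" by (meson order_trans)
    then have "(\<Sum>k<n. 2 * \<bar>q (s k) - q (real k / real n)\<bar>) \<le> 2 * B" by (simp flip: sum_distrib_left)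
    then show ?thesis using s(2) unfolding C_def
        by (intro exI[of _ "\<lambda>k. 2 * \<bar>q (s k) - q (real k / real n)\<bar>"]) auto
  qed
  then show ?thesis by blast
qed

text \<open>Unlike L^2, this class is closed under products, so that products of two functions can
  again be paired with cells.\<close>

definition bounded_measurable_01 :: "(real \<Rightarrow> real) \<Rightarrow> bool" where
  "bounded_measurable_01 u \<longleftrightarrow> u \<in> borel_measurable unit_interval_measure
    \<and> (\<exists>B. \<forall>s\<in>{0..1}. \<bar>u s\<bar> \<le> B)"

lemma bounded_measurable_01_const: "bounded_measurable_01 (\<lambda>_. c)"
  by (auto simp: bounded_measurable_01_def)

lemma bounded_measurable_01_add:
  assumes "bounded_measurable_01 u" "bounded_measurable_01 v"
  shows "bounded_measurable_01 (\<lambda>s. u s + v s)"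
proof -
  obtain B B' where "\<And>s. s \<in> {0..1} \<Longrightarrow> \<bar>u s\<bar> \<le> B" "\<And>s. s \<in> {0..1} \<Longrightarrow> \<bar>v s\<bar> \<le> B'"
    using assms unfolding bounded_measurable_01_def by blast
  then have "\<forall>s\<in>{0..1}. \<bar>u s + v s\<bar> \<le> B + B'"
      by (intro ballI order_trans[OF abs_triangle_ineq] add_mono) auto
  then show ?thesis using assms unfolding bounded_measurable_01_def by auto
qed

lemma bounded_measurable_01_mult:
  assumes "bounded_measurable_01 u" "bounded_measurable_01 v"
  shows "bounded_measurable_01 (\<lambda>s. u s * v s)"
proof -
  obtain B B' where *: "\<And>s. s \<in> {0..1} \<Longrightarrow> \<bar>u s\<bar> \<le> B" "\<And>s. s \<in> {0..1} \<Longrightarrow> \<bar>v s\<bar> \<le> B'"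
    using assms unfolding bounded_measurable_01_def by blast
  have "\<forall>s\<in>{0..1}. \<bar>u s * v s\<bar> \<le> B * B'"
  proof
    fix s :: real assume "s \<in> {0..1}"
    from *[OF this] show "\<bar>u s * v s\<bar> \<le> B * B'" unfolding abs_mult by (intro mult_mono) auto
  qed
  then show ?thesis using assms unfolding bounded_measurable_01_def by auto
qed

lemma bounded_measurable_01_cmult: "bounded_measurable_01 u \<Longrightarrow> bounded_measurable_01 (\<lambda>s. c * u s)"
  by (rule bounded_measurable_01_mult[OF bounded_measurable_01_const])

lemma bounded_measurable_01_diff:
  "bounded_measurable_01 u \<Longrightarrow> bounded_measurable_01 v \<Longrightarrow> bounded_measurable_01 (\<lambda>s. u s - v s)"
  using bounded_measurable_01_add[OF _ bounded_measurable_01_cmult[of v "-1"], of u] by simp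

lemma bounded_measurable_01_L2:
  assumes "bounded_measurable_01 u" shows "u \<in> L2_01"
proof -
  obtain B where "\<forall>s\<in>{0..1}. \<bar>u s\<bar> \<le> B" using assms by (auto simp: bounded_measurable_01_def)
  then show ?thesis
    using assms by (intro L2_space_bounded[OF finite_measure_unit, where B=B])
      (auto simp: bounded_measurable_01_def)
qed

lemmas bounded_measurable_01_intros = bounded_measurable_01_const bounded_measurable_01_add
  bounded_measurable_01_mult bounded_measurable_01_diff

lemma bounded_measurable_01_continuous:
  assumes "continuous_on {0..1} f" shows "bounded_measurable_01 f"
proof -
  have "f \<in> borel_measurable unit_interval_measure"
    using assms by (intro continuous_imp_measurable_on_sets_lebesgue) auto
  moreover have "bounded (f ` {0..1})" using assms
    by (intro compact_imp_bounded compact_continuous_image) auto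
  ultimately show ?thesis unfolding bounded_measurable_01_def bounded_iff by simp
qed

lemma bounded_measurable_01_derivative:
  assumes f: "has_BV_derivative f f'"
  shows "bounded_measurable_01 f" "bounded_measurable_01 f'"
proof -
  have der: "\<And>x. x \<in> {0..1} \<Longrightarrow> (f has_real_derivative f' x) (at x within {0..1})"
    and bv: "bounded_variation_01 f'" using f by (auto simp: has_BV_derivative_def)
  have cont: "continuous_on {0..1} f"
    unfolding continuous_on_eq_continuous_within using der DERIV_continuous by blast
  then show "bounded_measurable_01 f" by (rule bounded_measurable_01_continuous)
  \<comment> \<open>Forward difference quotients, whose pointwise limit shows that f' is measurable.
    The minimum keeps the argument inside [0,1]; at 1 there is no forward quotient, and the limit is
    put in directly.\<close>
  define D where "D n x = (if x < 1 then real (Suc n)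
      * (f (min 1 (x + 1 / real (Suc n))) - f x) else f' 1)" for n and x :: real
  have D: "D n \<in> borel_measurable unit_interval_measure" for n
  proof -
    have c1: "continuous_on {0..1} (\<lambda>x. f (min 1 (x + 1 / real (Suc n))))"
      by (rule continuous_on_compose2[OF cont]) (auto intro!: continuous_intros)
    have [measurable]: "f \<in> borel_measurable unit_interval_measure"
      "(\<lambda>x. f (min 1 (x + 1 / real (Suc n)))) \<in> borel_measurable unit_interval_measure"
      using cont c1 by (auto intro!: continuous_imp_measurable_on_sets_lebesgue)
    have [measurable]: "(\<lambda>x::real. x) \<in> borel_measurable unit_interval_measure"
        by (rule measurable_unit_borel) simp
    show ?thesis unfolding D_def by measurable
  qed
  have "f' \<in> borel_measurable unit_interval_measure"
  proof (rule borel_measurable_LIMSEQ_real[OF _ D])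
    fix x assume "x \<in> space unit_interval_measure"
    then have x: "x \<in> {0..1}" by simp
    show "(\<lambda>n. D n x) \<longlonglongrightarrow> f' x"
    proof (cases "x < 1")
      case False
      then show ?thesis using x by (simp add: D_def)
    next
      case True
      have lim: "((\<lambda>y. (f y - f x) / (y - x)) \<longlongrightarrow> f' x) (at x within {0..1})"
        using der[OF x] by (simp add: has_field_derivative_iff)
      have "filterlim (\<lambda>n. min 1 (x + 1 / real (Suc n))) (at x within {0..1}) sequentially"
        unfolding filterlim_at
      proof (intro conjI always_eventually allI)
        have "(\<lambda>n. min 1 (x + 1 / real (Suc n))) \<longlonglongrightarrow> min 1 (x + 0)"
          by (intro tendsto_intros LIMSEQ_Suc[OF lim_1_over_n])
        then show "(\<lambda>n. min 1 (x + 1 / real (Suc n))) \<longlonglongrightarrow> x" using True by simp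
        fix n
        show "min 1 (x + 1 / real (Suc n)) \<in> {0..1}" "min 1 (x + 1 / real (Suc n)) \<noteq> x"
          using x True by (auto simp: min_def)
      qed
      from filterlim_compose[OF lim this]
      have *: "(\<lambda>n. (f (min 1 (x + 1 / real (Suc n))) - f x) / (min 1 (x + 1 / real (Suc n)) - x))
          \<longlonglongrightarrow> f' x" .
      have "(\<lambda>n. x + 1 / real (Suc n)) \<longlonglongrightarrow> x + 0"
        by (intro tendsto_intros LIMSEQ_Suc[OF lim_1_over_n])
      then have "\<forall>\<^sub>F n in sequentially. x + 1 / real (Suc n) < 1" using True
          by (intro order_tendstoD(2)[where y=x]) auto
      then have "\<forall>\<^sub>F n in sequentially. (f (min 1 (x + 1 / real (Suc n))) - f x)
          / (min 1 (x + 1 / real (Suc n)) - x) = D n x"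
      proof eventually_elim
        case (elim n)
        then have "min 1 (x + 1 / real (Suc n)) = x + 1 / real (Suc n)" by simp
        then show ?case using True
            by (simp only: D_def if_True add_diff_cancel_left')
            (simp add: field_simps del: of_nat_Suc)
      qed
      with * show ?thesis by (rule Lim_transform_eventually)
    qed
  qed
  then show "bounded_measurable_01 f'"
    using bounded_variation_bounded[OF bv] by (simp add: bounded_measurable_01_def)
qed

section \<open>Moments and covariances on a single cell\<close>

lemma inner_lin_left:
  assumes "u \<in> L2_01" "v \<in> L2_01" "h \<in> L2_01"
  shows "inner_01 (\<lambda>s. a * u s + b * v s) h = a * inner_01 u h + b * inner_01 v h"
  unfolding inner_01_def
  using L2_mult_integrable[OF assms(1,3)] L2_mult_integrable[OF assms(2,3)]
  by (simp add: distrib_right mult.assoc)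

lemma integral_grid_cell_power:
  assumes k: "k < n"
  shows "inner_01 (\<lambda>s. (s - real k / real n) ^ p) (grid_cell n k)
      = (1 / real n) ^ Suc p / real (Suc p)"
proof -
  define a b where "a = real k / real n" and "b = real (Suc k) / real n"
  have ab: "0 \<le> a" "a \<le> b" "b \<le> 1" "b - a = 1 / real n"
    using k by (auto simp: a_def b_def divide_le_eq divide_right_mono
      diff_divide_distrib[symmetric])
  have "inner_01 (\<lambda>s. (s - a) ^ p) (grid_cell n k)
    = (\<integral>s. indicator {0..1} s *\<^sub>R ((s - a) ^ p * indicator {a<..b} s) \<partial>lebesgue)"
    unfolding inner_01_def grid_cell_def a_def[symmetric] b_def[symmetric]
    by (subst integral_restrict_space) (auto simp: set_lebesgue_integral_def)
  also have "\<dots> = (\<integral>s. indicator {0..1} s *\<^sub>R ((s - a) ^ p * indicator {a<..b} s) \<partial>lborel)"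
    by (rule integral_completion) measurable
  also have "\<dots> = (\<integral>s. indicator {a..b} s *\<^sub>R (s - a) ^ p \<partial>lborel)"
    by (rule integral_discrete_difference[of "{a}"]) (use ab in \<open>auto simp: indicator_def\<close>)
  also have "\<dots> = (b - a) ^ Suc p / real (Suc p) - (a - a) ^ Suc p / real (Suc p)"
  proof (rule integral_FTC_atLeastAtMost[OF ab(2)])
    fix x
    have "((\<lambda>s. (s - a) ^ Suc p / real (Suc p)) has_real_derivative (x
        - a) ^ p) (at x within {a..b})"
      by (auto intro!: derivative_eq_intros simp del: power_Suc of_nat_Suc)
    then show "((\<lambda>s. (s - a) ^ Suc p / real (Suc p)) has_vector_derivative (x
        - a) ^ p) (at x within {a..b})"
      by (simp only: has_real_derivative_iff_has_vector_derivative)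
  qed (auto intro!: continuous_intros)
  finally have "inner_01 (\<lambda>s. (s - a) ^ p) (grid_cell n k) = (b - a) ^ Suc p / real (Suc p)"
    by (simp del: of_nat_Suc)
  then show ?thesis unfolding ab(4) unfolding a_def .
qed

lemma inner_grid_cell_bound:
  assumes k: "k < n" and u: "u \<in> L2_01" and B: "\<And>s. s \<in> {real k / real n..real (Suc k) / real n}
    \<Longrightarrow> \<bar>u s\<bar> \<le> B"
  shows "\<bar>inner_01 u (grid_cell n k)\<bar> \<le> B / real n"
proof -
  have i: "integrable unit_interval_measure (\<lambda>s. B * grid_cell n k s)"
    using L2_mult_integrable[OF bounded_measurable_01_L2[OF bounded_measurable_01_const]
      grid_cell_L2] .
  have "norm (inner_01 u (grid_cell n k)) \<le> (\<integral>s. B * grid_cell n k s \<partial>unit_interval_measure)"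
    unfolding inner_01_def
  proof (rule norm_integral_le[OF L2_mult_integrable[OF u grid_cell_L2] i])
    fix s show "norm (u s * grid_cell n k s) \<le> B * grid_cell n k s"
      using B[of s] by (auto simp: grid_cell_def indicator_def)
  qed
  also have "\<dots> = B * inner_01 (\<lambda>s. (s - real k / real n) ^ 0) (grid_cell n k)"
      by (simp add: inner_01_def)
  also have "\<dots> = B / real n" unfolding integral_grid_cell_power[OF k] by simp
  finally show ?thesis by simp
qed

text \<open>1/n times the covariance of u and v under the uniform distribution on the cell. Hence it
  ignores additive constants.\<close>

definition cell_cov :: "nat \<Rightarrow> nat \<Rightarrow> (real \<Rightarrow> real) \<Rightarrow> (real \<Rightarrow> real) \<Rightarrow> real" where
  "cell_cov n k u v = inner_01 (\<lambda>s. u s * v s) (grid_cell n k)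
     - real n * inner_01 u (grid_cell n k) * inner_01 v (grid_cell n k)"

lemma cell_cov_commute: "cell_cov n k u v = cell_cov n k v u"
  by (simp add: cell_cov_def mult_ac)

lemma cell_cov_lin:
  assumes "bounded_measurable_01 u" "bounded_measurable_01 v" "bounded_measurable_01 w"
  shows "cell_cov n k (\<lambda>s. a * u s + b * v s) w = a * cell_cov n k u w + b * cell_cov n k v w"
proof -
  have "inner_01 (\<lambda>s. (a * u s + b * v s) * w s) (grid_cell n k)
     = inner_01 (\<lambda>s. a * (u s * w s) + b * (v s * w s)) (grid_cell n k)"
    by (simp add: algebra_simps)
  also have "\<dots> = a * inner_01 (\<lambda>s. u s * w s) (grid_cell n k) + b
      * inner_01 (\<lambda>s. v s * w s) (grid_cell n k)"
    using assms by (intro inner_lin_left bounded_measurable_01_L2 bounded_measurable_01_mult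
      grid_cell_L2)
  finally show ?thesis unfolding cell_cov_def
    using inner_lin_left[OF bounded_measurable_01_L2[OF assms(1)]
      bounded_measurable_01_L2[OF assms(2)] grid_cell_L2]
    by (simp add: algebra_simps)
qed

lemma cell_cov_const:
  assumes "k < n" "bounded_measurable_01 w"
  shows "cell_cov n k (\<lambda>s. 1) w = 0"
proof -
  have "inner_01 (\<lambda>s. 1) (grid_cell n k) = 1 / real n"
      using integral_grid_cell_power[OF assms(1), of 0] by simp
  then show ?thesis using assms(1) by (simp add: cell_cov_def)
qed

lemma cell_cov_bound:
  assumes k: "k < n" and u: "bounded_measurable_01 u"
    "\<And>s. s \<in> {real k / real n..real (Suc k) / real n} \<Longrightarrow> \<bar>u s\<bar> \<le> B"
    and v: "bounded_measurable_01 v" "\<And>s. s \<in> {real k / real n..real (Suc k) / real n} \<Longrightarrow> \<bar>v s\<bar> \<le> C"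
  shows "\<bar>cell_cov n k u v\<bar> \<le> 2 * B * C / real n"
proof -
  have n: "real n > 0" using k by simp
  have "real k / real n \<in> {real k / real n..real (Suc k) / real n}" using n
      by (simp add: divide_right_mono)
  then have BC: "B \<ge> 0" "C \<ge> 0" using u(2) v(2) abs_ge_zero order_trans by blast+
  have 1: "\<bar>inner_01 (\<lambda>s. u s * v s) (grid_cell n k)\<bar> \<le> (B * C) / real n"
    using u v BC by (intro inner_grid_cell_bound[OF k] bounded_measurable_01_L2
      bounded_measurable_01_mult)
      (auto simp: abs_mult intro!: mult_mono)
  have "\<bar>real n * inner_01 u (grid_cell n k) * inner_01 v (grid_cell n k)\<bar>
      = real n * \<bar>inner_01 u (grid_cell n k)\<bar> * \<bar>inner_01 v
        (grid_cell n k)\<bar>" by (simp add: abs_mult)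
  also have "\<dots> \<le> real n * (B / real n) * (C / real n)"
    using u v BC n by (intro mult_mono inner_grid_cell_bound[OF k] bounded_measurable_01_L2) auto
  also have "\<dots> = B * C / real n" using n by simp
  finally show ?thesis using 1 unfolding cell_cov_def by (simp add: mult.assoc)
qed

text \<open>On the cell with left end a, write f = f(a) + f'(a) L + r with L(s) = s - a. Constants
  drop out of covariances, and the variance of L is 1/(12 n^2), so the leading term is f'(a) g'(a) /
  (12 n^3). The remainder is at most p/n in size, as follows from the oscillation of f'; the same
  holds for g with q. The mixed terms contribute 2 M p and (2 + 4) M q, whence the constant
  6.\<close>

lemma cell_cov_derivative:
  assumes k: "k < n" and f: "has_BV_derivative f f'" and g: "has_BV_derivative g g'"
    and M: "\<And>s. s \<in> {0..1} \<Longrightarrow> \<bar>f' s\<bar> \<le> M" "\<And>s. s \<in> {0..1} \<Longrightarrow> \<bar>g' s\<bar> \<le> M"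
    and p: "\<And>s. s \<in> {real k / real n..real (Suc k) / real n} \<Longrightarrow> \<bar>f' s - f' (real k / real n)\<bar> \<le> p"
    and q: "\<And>s. s \<in> {real k / real n..real (Suc k) / real n} \<Longrightarrow> \<bar>g' s - g' (real k / real n)\<bar> \<le> q"
  shows "\<bar>cell_cov n k f g - f' (real k / real n) * g' (real k / real n) / (12 * real n ^ 3)\<bar>
    \<le> 6 * M * (p + q) / real n ^ 3"
proof -
  define a h where "a = real k / real n" and "h = 1 / real n"
  define I where "I = {a..a + h}"
  have n: "real n > 0" using k by simp
  have h: "h > 0" using n by (simp add: h_def)
  have I: "{real k / real n..real (Suc k) / real n} = I"
      by (simp add: I_def a_def h_def add_divide_distrib add.commute)
  have I01: "I \<subseteq> {0..1}"
  proof -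
    have "a + h \<le> 1" using k n by (simp add: a_def h_def divide_le_eq flip: add_divide_distrib)
    moreover have "0 \<le> a" by (simp add: a_def)
    ultimately show ?thesis by (auto simp: I_def)
  qed
  have aI: "a \<in> I" using h by (simp add: I_def)
  define L where "L s = s - a" for s
  have bL: "bounded_measurable_01 L" unfolding L_def
      by (intro bounded_measurable_01_continuous continuous_intros)
  have Lb: "\<bar>L s\<bar> \<le> h" if "s \<in> I" for s using that by (auto simp: L_def I_def)
  have decomp: "\<bar>w s - w a - w' a * L s\<bar> \<le> r * h"
    if w: "has_BV_derivative w w'" and r: "\<And>s. s \<in> I \<Longrightarrow> \<bar>w' s - w' a\<bar> \<le> r" and s: "s \<in> I"
      for w w' r s
  proof -
    have r0: "r \<ge> 0" using r[OF aI] by simp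
    \<comment> \<open>Mean value inequality for w(s) - w'(a) s, whose derivative on the cell is at
      most r in absolute value.\<close>
    have "norm ((w s - w' a * s) - (w a - w' a * a)) \<le> r * norm (s - a)"
    proof (rule field_differentiable_bound[where S=I and f'="\<lambda>x. w' x - w' a"])
      show "convex I" by (simp add: I_def)
      fix z assume z: "z \<in> I"
      have "(w has_real_derivative w' z) (at z within I)"
        using w z I01 unfolding has_BV_derivative_def by (blast intro: DERIV_subset)
      then show "((\<lambda>s. w s - w' a * s) has_real_derivative w' z - w' a) (at z within I)"
        by (auto intro!: derivative_eq_intros)
      show "norm (w' z - w' a) \<le> r" using r[OF z] by simp
    qed (use s aI in auto)
    also have "\<dots> \<le> r * h" using Lb[OF s] r0 by (intro mult_left_mono) (auto simp: L_def)
    finally show ?thesis by (simp add: L_def algebra_simps)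
  qed
  have pI: "\<bar>f' s - f' a\<bar> \<le> p" if "s \<in> I" for s
    using p[of s] that unfolding I a_def by blast
  have qI: "\<bar>g' s - g' a\<bar> \<le> q" if "s \<in> I" for s
    using q[of s] that unfolding I a_def by blast
  define r where "r s = f s - f a - f' a * L s" for s
  define \<rho> where "\<rho> s = g s - g a - g' a * L s" for s
  note bf = bounded_measurable_01_derivative(1)[OF f]
      and bg = bounded_measurable_01_derivative(1)[OF g]
  have br: "bounded_measurable_01 r" unfolding r_def[abs_def]
      by (intro bounded_measurable_01_intros bf bL)
  have b\<rho>: "bounded_measurable_01 \<rho>" unfolding \<rho>_def[abs_def]
      by (intro bounded_measurable_01_intros bg bL)
  note b1 = bounded_measurable_01_const[of 1]
  have rb: "\<bar>r s\<bar> \<le> p * h" if "s \<in> I" for s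
    unfolding r_def by (rule decomp[OF f pI that])
  have \<rho>b: "\<bar>\<rho> s\<bar> \<le> q * h" if "s \<in> I" for s
    unfolding \<rho>_def by (rule decomp[OF g qI that])
  have split: "cell_cov n k w v = w' * cell_cov n k L v + cell_cov n k e v"
    if w: "\<And>s. w s = c * 1 + 1 * (w' * L s + 1 * e s)" and e: "bounded_measurable_01 e"
      and v: "bounded_measurable_01 v" for w v w' e c
  proof -
    have "cell_cov n k w v = cell_cov n k (\<lambda>s. c * 1 + 1 * (w' * L s + 1 * e s)) v"
      using w by (intro arg_cong[where f="\<lambda>u. cell_cov n k u v"] ext)
    also have "\<dots> = c * cell_cov n k (\<lambda>s. 1) v + 1 * cell_cov n k (\<lambda>s. w' * L s + 1 * e s) v"
      by (rule cell_cov_lin[OF b1 _ v]) (intro bounded_measurable_01_intros bL e)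
    also have "\<dots> = w' * cell_cov n k L v + cell_cov n k e v"
      using cell_cov_lin[OF bL e v, of n k w' 1] by (simp add: cell_cov_const[OF k v])
    finally show ?thesis .
  qed
  have f_split: "cell_cov n k f v = f' a * cell_cov n k L v + cell_cov n k r v"
      if "bounded_measurable_01 v" for v
    by (rule split[OF _ br that, of f "f a"]) (simp add: r_def)
  have g_split: "cell_cov n k v g = g' a * cell_cov n k v L + cell_cov n k v \<rho>"
      if "bounded_measurable_01 v" for v
    using split[OF _ b\<rho> that, of g "g a" "g' a"] by (simp add: \<rho>_def cell_cov_commute[of n k v])
  have LL: "cell_cov n k L L = 1 / (12 * real n ^ 3)"
  proof -
    have J2: "inner_01 (\<lambda>s. L s * L s) (grid_cell n k) = (1 / real n) ^ 3 / 3"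
      using integral_grid_cell_power[OF k, of 2]
        by (simp add: L_def a_def power2_eq_square numeral_3_eq_3)
    have J1: "inner_01 L (grid_cell n k) = (1 / real n) ^ 2 / 2"
      using integral_grid_cell_power[OF k, of 1]
        by (simp add: L_def[abs_def] a_def power2_eq_square)
    show ?thesis unfolding cell_cov_def J1 J2
      using n by (simp add: power2_eq_square power3_eq_cube field_simps)
  qed
  have "cell_cov n k f g = f' a * g' a * cell_cov n k L L + f' a * cell_cov n k L \<rho>
      + cell_cov n k r g"
    unfolding f_split[OF bg] g_split[OF bL] by (simp add: algebra_simps)
  then have eq: "cell_cov n k f g - f' a * g' a / (12 * real n ^ 3)
     = f' a * cell_cov n k L \<rho> + g' a * cell_cov n k r L + cell_cov n k r \<rho>"
    unfolding LL g_split[OF br] by simp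
  have p0: "p \<ge> 0" "q \<ge> 0" using p[of a] q[of a] aI unfolding I by auto
  have M': "\<bar>f' a\<bar> \<le> M" "\<bar>g' a\<bar> \<le> M" using M aI I01 by blast+
  have M0: "M \<ge> 0" using M'(1) by linarith
  \<comment> \<open>A cruder bound for r that does not involve p. It makes the estimate of the
    product of the two remainders linear in q instead of containing p q.\<close>
  have rb2: "\<bar>r s\<bar> \<le> (2 * M) * h" if "s \<in> I" for s
    unfolding r_def
  proof (rule decomp[OF f _ that])
    fix s assume "s \<in> I"
    then have "\<bar>f' s\<bar> \<le> M" using M I01 by blast
    then show "\<bar>f' s - f' a\<bar> \<le> 2 * M" using M'(1) by linarith
  qed
  have e1: "\<bar>cell_cov n k L \<rho>\<bar> \<le> 2 * h * (q * h) / real n"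
    by (rule cell_cov_bound[OF k bL _ b\<rho>]) (simp_all only: I Lb \<rho>b)
  have e2: "\<bar>cell_cov n k r L\<bar> \<le> 2 * (p * h) * h / real n"
    by (rule cell_cov_bound[OF k br _ bL]) (simp_all only: I Lb rb)
  have e3: "\<bar>cell_cov n k r \<rho>\<bar> \<le> 2 * (2 * M * h) * (q * h) / real n"
    by (rule cell_cov_bound[OF k br _ b\<rho>]) (simp_all only: I rb2 \<rho>b)
  have "\<bar>f' a * cell_cov n k L \<rho> + g' a * cell_cov n k r L + cell_cov n k r \<rho>\<bar>
    \<le> \<bar>f' a\<bar> * \<bar>cell_cov n k L \<rho>\<bar> + \<bar>g' a\<bar> * \<bar>cell_cov n k r L\<bar> + \<bar>cell_cov n k r \<rho>\<bar>"
    unfolding abs_mult[symmetric] by linarith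
  also have "\<dots> \<le> M * (2 * h * (q * h) / real n) + M * (2 * (p * h) * h / real n) + 2 * (2 * M * h)
      * (q * h) / real n"
    by (intro add_mono mult_mono e1 e2 e3 M' M0) auto
  also have "\<dots> = (2 * M * p + 6 * M * q) / real n ^ 3"
    using n by (simp add: h_def power3_eq_cube field_simps)
  also have "\<dots> \<le> 6 * M * (p + q) / real n ^ 3"
    using n M0 p0 by (intro divide_right_mono) (auto simp: algebra_simps)
  finally show ?thesis unfolding a_def[symmetric] eq .
qed

text \<open>The cells add up to 1 off the null point 0, so \<langle>f, g\<rangle> splits over the
  cells, and the pairing with the average removes the product of the means in each of them.\<close>

lemma inner_sub_grid_average:
  assumes n: "n > 0" and f: "bounded_measurable_01 f" and g: "bounded_measurable_01 g"
  shows "inner_01 f g - inner_01 f (grid_average n g) = (\<Sum>k<n. cell_cov n k f g)"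
proof -
  note fL = bounded_measurable_01_L2[OF f]
      and fgL = bounded_measurable_01_L2[OF bounded_measurable_01_mult[OF f g]]
  have "inner_01 f g = inner_01 (\<lambda>s. f s * g s) (\<lambda>s. \<Sum>k<n. 1 * grid_cell n k s)"
    unfolding inner_01_def
  proof (rule integral_cong_AE)
    show "AE s in unit_interval_measure. f s * g s = f s * g s * (\<Sum>k<n. 1 * grid_cell n k s)"
      using AE_unit_pos
    proof eventually_elim
      case (elim s)
      have "(\<Sum>k<n. grid_cell n k s) = 1"
        unfolding indicator_eq_sum_grid_cell[OF n, of n, symmetric] using n elim by simp
      then show ?case by simp
    qed
    have "grid_cell n k \<in> borel_measurable unit_interval_measure" for k
      using grid_cell_L2 by (rule L2_spaceD)
    then show "(\<lambda>s. f s * g s * (\<Sum>k<n. 1 * grid_cell n k s))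
        \<in> borel_measurable unit_interval_measure"
      by (intro borel_measurable_times borel_measurable_sum L2_spaceD(1)[OF fgL]
        borel_measurable_const)
  qed (rule L2_spaceD(1)[OF fgL])
  also have "\<dots> = (\<Sum>k<n. inner_01 (\<lambda>s. f s * g s) (grid_cell n k))"
    by (subst inner_sum_right[OF grid_cell_L2 fgL]) simp
  finally show ?thesis
    by (simp add: inner_grid_average_average(1)[OF fL] cell_cov_def sum_subtractf)
qed

text \<open>Each cell has two errors, both controlled by the oscillations of f' and g' on it: the
  linearization, with constant 6, and the replacement of the integral of f' g' by a left-end Riemann
  sum, with constant 1 and divided by 12. Together they stay below 7. As the oscillations have sums
  bounded in n, the total error is of order 1/n.\<close>

lemma grid_average_error_limit:
  assumes f: "has_BV_derivative f f'" and g: "has_BV_derivative g g'"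
  shows "(\<lambda>n. (real n)\<^sup>2 * (inner_01 f g - inner_01 f (grid_average n g))) \<longlonglongrightarrow> inner_01 f' g' / 12"
proof -
  note bf = bounded_measurable_01_derivative[OF f] and bg = bounded_measurable_01_derivative[OF g]
  have bvf: "bounded_variation_01 f'" and bvg: "bounded_variation_01 g'" using f g
      by (auto simp: has_BV_derivative_def)
  obtain M1 M2 where M12: "\<And>s. s \<in> {0..1} \<Longrightarrow> \<bar>f' s\<bar> \<le> M1" "\<And>s. s \<in> {0..1} \<Longrightarrow> \<bar>g' s\<bar> \<le> M2"
    using bounded_variation_bounded[OF bvf] bounded_variation_bounded[OF bvg] by blast
  define M where "M = max M1 M2"
  have M: "\<And>s. s \<in> {0..1} \<Longrightarrow> \<bar>f' s\<bar> \<le> M" "\<And>s. s \<in> {0..1} \<Longrightarrow> \<bar>g' s\<bar> \<le> M"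
    using M12 unfolding M_def by (auto intro: le_max_iff_disj[THEN iffD2])
  have M0: "M \<ge> 0" using M(1)[of 0] by simp
  obtain V1 where V1: "\<And>n. n > 0 \<Longrightarrow> \<exists>osc. (\<Sum>k<n. osc k) \<le> V1 \<and>
    (\<forall>k<n. \<forall>s\<in>{real k / real n..real (Suc k) / real n}. \<bar>f' s - f' (real k / real n)\<bar> \<le> osc k)"
    using bounded_variation_oscillation[OF bvf] by blast
  obtain V2 where V2: "\<And>n. n > 0 \<Longrightarrow> \<exists>osc. (\<Sum>k<n. osc k) \<le> V2 \<and>
    (\<forall>k<n. \<forall>s\<in>{real k / real n..real (Suc k) / real n}. \<bar>g' s - g' (real k / real n)\<bar> \<le> osc k)"
    using bounded_variation_oscillation[OF bvg] by blast
  have main: "\<bar>(real n)\<^sup>2 * (inner_01 f g - inner_01 f (grid_average n g)) - inner_01 f' g' / 12\<bar>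
      \<le> 7 * M * (V1 + V2) / real n"
    if n: "n > 0" for n
  proof -
    obtain p where p: "(\<Sum>k<n. p k) \<le> V1"
      "\<And>k s. k < n \<Longrightarrow> s \<in> {real k / real n..real (Suc k) / real n} \<Longrightarrow> \<bar>f' s - f' (real k / real n)\<bar>
        \<le> p k"
      using V1[OF n] by blast
    obtain q where q: "(\<Sum>k<n. q k) \<le> V2"
      "\<And>k s. k < n \<Longrightarrow> s \<in> {real k / real n..real (Suc k) / real n} \<Longrightarrow> \<bar>g' s - g' (real k / real n)\<bar>
        \<le> q k"
      using V2[OF n] by blast
    define c where "c k = f' (real k / real n) * g' (real k / real n)" for k
    have rn: "real n > 0" using n by simp
    have cov: "\<bar>cell_cov n k f g - c k / (12 * real n ^ 3)\<bar> \<le> 6 * M * (p k + q k) / real n ^ 3"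
        if "k < n" for k
      unfolding c_def mult.assoc[symmetric]
        by (rule cell_cov_derivative[OF that f g M]) (use p q that in auto)
    have riem: "\<bar>c k / real n - inner_01 (\<lambda>s. f' s * g' s) (grid_cell n k)\<bar>
        \<le> M * (p k + q k) / real n" if k: "k < n" for k
    proof -
      have "inner_01 (\<lambda>s. c k * 1 + (-1) * (f' s * g' s)) (grid_cell n k)
         = c k * inner_01 (\<lambda>s. 1) (grid_cell n k) + (-1) * inner_01 (\<lambda>s. f' s * g' s)
           (grid_cell n k)"
        by (intro inner_lin_left bounded_measurable_01_L2 bounded_measurable_01_intros bf bg
          grid_cell_L2)
      moreover have "inner_01 (\<lambda>s. 1) (grid_cell n k) = 1 / real n"
        using integral_grid_cell_power[OF k, of 0] by simp
      moreover have "\<bar>inner_01 (\<lambda>s. c k * 1 + (-1) * (f' s * g' s)) (grid_cell n k)\<bar>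
        \<le> (M * (p k + q k)) / real n"
      proof (rule inner_grid_cell_bound[OF k])
        show "(\<lambda>s. c k * 1 + (-1) * (f' s * g' s)) \<in> L2_01"
          by (intro bounded_measurable_01_L2 bounded_measurable_01_intros bf bg)
        fix s assume s: "s \<in> {real k / real n..real (Suc k) / real n}"
        have sub: "{real k / real n..real (Suc k) / real n} \<subseteq> {0..1}"
          using k rn by (auto simp: divide_le_eq intro: order_trans[OF divide_nonneg_nonneg]
            order_trans)
        define a where "a = real k / real n"
        have "\<bar>f' a * (g' s - g' a)\<bar> \<le> M * q k"
          unfolding abs_mult using q(2)[OF k s] M(1)[of a] sub k rn M0
          by (intro mult_mono) (auto simp: a_def)
        moreover have "\<bar>g' s * (f' s - f' a)\<bar> \<le> M * p k"
          unfolding abs_mult using p(2)[OF k s] M(2)[OF subsetD[OF sub s]] M0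
          by (intro mult_mono) (simp_all add: a_def)
        moreover have "c k * 1 + (-1) * (f' s * g' s)
          = - (f' a * (g' s - g' a)) - g' s * (f' s - f' a)"
          by (simp add: c_def a_def algebra_simps)
        ultimately show "\<bar>c k * 1 + (-1) * (f' s * g' s)\<bar> \<le> M * (p k + q k)"
          unfolding distrib_left by linarith
      qed
      ultimately show ?thesis by (simp only:) simp
    qed
    \<comment> \<open>The covariance decomposition is applied to the derivatives themselves; the
      terms with the cell means occur on both sides and cancel.\<close>
    have one: "inner_01 f' g' = (\<Sum>k<n. inner_01 (\<lambda>s. f' s * g' s) (grid_cell n k))"
      using inner_sub_grid_average[OF n bf(2) bg(2)]
        inner_grid_average_average(1)[OF bounded_measurable_01_L2[OF bf(2)], of n g']
      by (simp add: cell_cov_def sum_subtractf)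
    define S where "S = (\<lambda>k. (real n)\<^sup>2 * (cell_cov n k f g - c k / (12 * real n ^ 3))
            + (c k / real n - inner_01 (\<lambda>s. f' s * g' s) (grid_cell n k)) / 12)"
    have eq: "(real n)\<^sup>2 * (inner_01 f g - inner_01 f (grid_average n g)) - inner_01 f' g' / 12
       = (\<Sum>k<n. S k)"
    proof -
      have "(real n)\<^sup>2 * (cell_cov n k f g - c k / (12 * real n ^ 3))
          + (c k / real n - inner_01 (\<lambda>s. f' s * g' s) (grid_cell n k)) / 12
        = (real n)\<^sup>2 * cell_cov n k f g - inner_01 (\<lambda>s. f' s * g' s) (grid_cell n k) / 12" for k
        using rn by (simp add: power2_eq_square power3_eq_cube field_simps)
      then show ?thesis
        unfolding inner_sub_grid_average[OF n bf(1) bg(1)] one S_def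
        by (simp add: sum_subtractf sum_distrib_left sum_divide_distrib)
    qed
    have "\<bar>\<Sum>k<n. S k\<bar> \<le> (\<Sum>k<n. \<bar>S k\<bar>)" by (rule sum_abs)
    also have "\<dots> \<le> (\<Sum>k<n. 7 * M / real n * (p k + q k))"
    proof (rule sum_mono)
      fix k assume "k \<in> {..<n}"
      then have k: "k < n" by simp
      have "\<bar>(real n)\<^sup>2 * (cell_cov n k f g - c k / (12 * real n ^ 3))\<bar>
          = (real n)\<^sup>2 * \<bar>cell_cov n k f g - c k / (12 * real n ^ 3)\<bar>"
        by (simp only: abs_mult abs_power2)
      also have "\<dots> \<le> (real n)\<^sup>2 * (6 * M * (p k + q k) / real n ^ 3)"
        by (intro mult_left_mono cov k) simp
      also have "\<dots> = 6 * (M / real n * (p k + q k))" using rn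
          by (simp add: power2_eq_square power3_eq_cube)
      finally have A: "\<bar>(real n)\<^sup>2 * (cell_cov n k f g - c k / (12 * real n ^ 3))\<bar>
          \<le> 6 * (M / real n * (p k + q k))" .
      have B: "\<bar>c k / real n - inner_01 (\<lambda>s. f' s * g' s) (grid_cell n k)\<bar>
          \<le> M / real n * (p k + q k)"
        using riem[OF k] by simp
      show "\<bar>S k\<bar> \<le> 7 * M / real n * (p k + q k)"
      proof -
        have "7 * M / real n * (p k + q k) = 7 * (M / real n * (p k + q k))" by simp
        moreover have "\<bar>x + y / 12\<bar> \<le> 7 * z" if "\<bar>x\<bar> \<le> 6 * z" "\<bar>y\<bar> \<le> z" for x y z :: real
          using that by linarith
        from this[OF A B] have "\<bar>S k\<bar> \<le> 7 * (M / real n * (p k + q k))" by (simp only: S_def)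
        ultimately show ?thesis by (simp only:)
      qed
    qed
    also have "\<dots> = 7 * M / real n * ((\<Sum>k<n. p k) + (\<Sum>k<n. q k))"
      by (simp only: sum_distrib_left[symmetric] sum.distrib)
    also have "\<dots> \<le> 7 * M / real n * (V1 + V2)"
      using p(1) q(1) M0 rn by (intro mult_left_mono add_mono) auto
    finally show ?thesis unfolding eq by simp
  qed
  have "(\<lambda>n. (real n)\<^sup>2 * (inner_01 f g - inner_01 f (grid_average n g)) - inner_01 f' g' / 12) \<longlonglongrightarrow> 0"
  proof (rule Lim_null_comparison)
    show "\<forall>\<^sub>F n in sequentially. norm ((real n)\<^sup>2 * (inner_01 f g - inner_01 f (grid_average n g))
        - inner_01 f' g' / 12)
        \<le> 7 * M * (V1 + V2) / real n"
      using main by (intro eventually_sequentiallyI[of 1]) simp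
    show "(\<lambda>n. 7 * M * (V1 + V2) / real n) \<longlonglongrightarrow> 0" by (rule lim_const_over_n)
  qed
  then show ?thesis by (simp add: LIM_zero_iff)
qed

subsection \<open>The limit\<close>

definition mix_form :: "real \<Rightarrow> nat set \<Rightarrow> (nat \<Rightarrow> nat \<Rightarrow> real) \<Rightarrow> (nat \<Rightarrow> real) \<Rightarrow> (nat \<Rightarrow> real) \<Rightarrow>
  complex" where
  "mix_form R A q t s = (\<Sum>i\<in>A. \<Sum>j\<in>A. circ_pt R (t i) * circ_pt R (s j) * of_real (q i j))"

text \<open>The expectation of a product of two mixtures, seen as a function of the matrix q of
  inner products alone. Averaging the functions changes only q, and differentiating the functionals
  changes only the weights.\<close>

definition mix_pairing :: "real \<Rightarrow> nat set \<Rightarrow> ((nat \<Rightarrow> real) \<Rightarrow> complex) \<Rightarrow> ((nat \<Rightarrow> real) \<Rightarrow> complex) \<Rightarrow>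
  (nat \<Rightarrow> nat \<Rightarrow> real) \<Rightarrow> complex" where
  "mix_pairing R A \<beta> \<gamma> q = (\<integral>t. \<beta> t * (\<integral>s. \<gamma> s * exp (mix_form R A q t s) \<partial>torus A) \<partial>torus A)"

lemma norm_mix_form_le:
  assumes "R > 0"
  shows "norm (mix_form R A q t s) \<le> (\<Sum>i\<in>A. \<Sum>j\<in>A. R * R * \<bar>q i j\<bar>)"
  unfolding mix_form_def using assms by (intro sum_norm_le) (simp add: norm_mult)

lemma mix_form_measurable:
  "(\<lambda>p. mix_form R A q (fst p) (snd p)) \<in> borel_measurable (torus A \<Otimes>\<^sub>M torus A)"
proof -
  have [measurable]: "i \<in> A \<Longrightarrow> (\<lambda>t. circ_pt R (t i)) \<in> borel_measurable (torus A)" for i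
    by (rule torus_component_measurable[OF circ_pt_measurable])
  show ?thesis unfolding mix_form_def by measurable
qed

lemma mix_integrable:
  assumes \<beta>: "bounded_weight A \<beta> K" and \<gamma>: "bounded_weight A \<gamma> L"
    and h: "(\<lambda>p. h (fst p) (snd p)) \<in> borel_measurable (torus A \<Otimes>\<^sub>M torus A)"
      "\<And>t s. norm (h t s) \<le> C"
  shows "integrable (torus A \<Otimes>\<^sub>M torus A) (\<lambda>p. \<beta> (fst p) * (\<gamma> (snd p) * h (fst p) (snd p)))"
    and "\<And>t s. norm (\<beta> t * (\<gamma> s * h t s)) \<le> K * (L * C)"
proof -
  interpret T: prob_space "torus A" by (rule prob_space_torus)
  interpret P: pair_prob_space "torus A" "torus A" ..
  have [measurable]: "\<beta> \<in> borel_measurable (torus A)" "\<gamma> \<in> borel_measurable (torus A)"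
    using \<beta> \<gamma> by (auto simp: bounded_weight_def)
  note [measurable] = h(1)
  have KL: "K \<ge> 0" "L \<ge> 0" using \<beta> \<gamma> norm_ge_zero order_trans unfolding bounded_weight_def by blast+
  have C: "C \<ge> 0" using h(2) norm_ge_zero order_trans by blast
  show b: "norm (\<beta> t * (\<gamma> s * h t s)) \<le> K * (L * C)" for t s
    unfolding norm_mult using \<beta> \<gamma> h(2) KL C by (intro mult_mono) (auto simp: bounded_weight_def)
  show "integrable (torus A \<Otimes>\<^sub>M torus A) (\<lambda>p. \<beta> (fst p) * (\<gamma> (snd p) * h (fst p) (snd p)))"
    by (rule P.P.integrable_const_bound[where B="K * (L * C)"]) (use b in auto)
qed

lemma mix_iterated_integral:
  assumes \<beta>: "bounded_weight A \<beta> K" and \<gamma>: "bounded_weight A \<gamma> L"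
    and h: "(\<lambda>p. h (fst p) (snd p)) \<in> borel_measurable (torus A \<Otimes>\<^sub>M torus A)"
      "\<And>t s. norm (h t s) \<le> C"
  shows "(\<integral>t. \<beta> t * (\<integral>s. \<gamma> s * h t s \<partial>torus A) \<partial>torus A)
    = (\<integral>p. \<beta> (fst p) * (\<gamma> (snd p) * h (fst p) (snd p)) \<partial>(torus A \<Otimes>\<^sub>M torus A))"
proof -
  interpret T: prob_space "torus A" by (rule prob_space_torus)
  interpret P: pair_prob_space "torus A" "torus A" ..
  show ?thesis
    using P.integral_fst'[OF mix_integrable(1)[OF \<beta> \<gamma> h]] by simp
qed

section \<open>Expanding the pairing in the matrix of inner products\<close>

lemma exp_difference_bound:
  fixes w :: complex
  shows "norm (1 - exp (- w)) \<le> norm w * exp (norm w)"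
    and "norm (1 - exp (- w) - w) \<le> (norm w)\<^sup>2 * exp (norm w)"
proof -
  have e: "exp \<bar>Re (- w)\<bar> \<le> exp (norm w)" using abs_Re_le_cmod[of w] by simp
  have "norm (exp (- w) - 1) \<le> exp \<bar>Re (- w)\<bar> * norm w"
    using Taylor_exp[of "- w" 0] by simp
  also have "\<dots> \<le> exp (norm w) * norm w" using e by (intro mult_right_mono) auto
  finally show "norm (1 - exp (- w)) \<le> norm w * exp (norm w)"
      by (simp add: norm_minus_commute mult.commute)
  have "norm (exp (- w) - (1 + (- w))) \<le> exp \<bar>Re (- w)\<bar> * (norm w)\<^sup>2"
    using Taylor_exp[of "- w" 1] by (simp add: power2_eq_square)
  also have "\<dots> \<le> exp (norm w) * (norm w)\<^sup>2" using e by (intro mult_right_mono) auto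
  finally have "norm (exp (- w) - (1 + (- w))) \<le> (norm w)\<^sup>2 * exp (norm w)"
      by (simp add: mult.commute)
  moreover have "exp (- w) - (1 + (- w)) = - (1 - exp (- w) - w)" by simp
  ultimately show "norm (1 - exp (- w) - w) \<le> (norm w)\<^sup>2 * exp (norm w)"
    by (simp only: norm_minus_cancel)
qed

text \<open>The hypothesis makes w of order 1/n^2. The remainder of 1 - exp (-w) after the linear
  term is quadratic in w and therefore negligible even after multiplication by n^2.\<close>

lemma tendsto_scaled_exp_difference:
  fixes w :: "nat \<Rightarrow> complex"
  assumes "(\<lambda>n. of_nat n ^ 2 * w n) \<longlonglongrightarrow> d"
  shows "(\<lambda>n. of_nat n ^ 2 * (1 - exp (- w n))) \<longlonglongrightarrow> d"
proof -
  have w0: "w \<longlonglongrightarrow> 0"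
  proof (rule Lim_null_comparison)
    show "\<forall>\<^sub>F n in sequentially. norm (w n) \<le> norm (of_nat n ^ 2 * w n) * (1 / real n)"
    proof (rule eventually_sequentiallyI[of 1])
      fix n :: nat assume n: "1 \<le> n"
      then have "norm (w n) \<le> real n * norm (w n)"
          using mult_right_mono[of 1 "real n" "norm (w n)"] by simp
      also have "\<dots> = norm (of_nat n ^ 2 * w n) * (1 / real n)"
        using n by (simp add: norm_mult norm_power power2_eq_square)
      finally show "norm (w n) \<le> norm (of_nat n ^ 2 * w n) * (1 / real n)" .
    qed
    have "(\<lambda>n. norm (of_nat n ^ 2 * w n) * (1 / real n)) \<longlonglongrightarrow> norm d * 0"
      by (intro tendsto_intros assms lim_1_over_n)
    then show "(\<lambda>n. norm (of_nat n ^ 2 * w n) * (1 / real n)) \<longlonglongrightarrow> 0" by simp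
  qed
  have "(\<lambda>n. of_nat n ^ 2 * (1 - exp (- w n) - w n)) \<longlonglongrightarrow> 0"
  proof (rule Lim_null_comparison)
    show "\<forall>\<^sub>F n in sequentially. norm (of_nat n ^ 2 * (1 - exp (- w n) - w n))
        \<le> norm (of_nat n ^ 2 * w n) * (norm (w n) * exp (norm (w n)))"
    proof (intro always_eventually allI)
      fix n
      have "norm (of_nat n ^ 2 * (1 - exp (- w n) - w n))
          \<le> norm (of_nat n ^ 2 :: complex) * ((norm (w n))\<^sup>2 * exp (norm (w n)))"
        unfolding norm_mult[of "of_nat n ^ 2"] by (intro mult_left_mono exp_difference_bound) auto
      then show "norm (of_nat n ^ 2 * (1 - exp (- w n) - w n))
          \<le> norm (of_nat n ^ 2 * w n) * (norm (w n) * exp (norm (w n)))"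
        by (simp add: norm_mult power2_eq_square mult_ac)
    qed
    have "(\<lambda>n. norm (of_nat n ^ 2 * w n) * (norm (w n) * exp (norm (w n))))
        \<longlonglongrightarrow> norm d * (norm (0::complex) * exp (norm (0::complex)))"
      by (intro tendsto_intros assms w0)
    then show "(\<lambda>n. norm (of_nat n ^ 2 * w n) * (norm (w n) * exp (norm (w n)))) \<longlonglongrightarrow> 0" by simp
  qed
  from tendsto_add[OF this assms] show ?thesis by (simp add: algebra_simps)
qed

text \<open>A directional derivative of the pairing at q, computed under the integral over the
  product of the two tori. The derivative of the exponential brings down \<Sum> d i j z_i w_j, and
  each z_i and w_j is moved into the adjacent weight.\<close>

lemma mix_pairing_limit:
  assumes A: "finite A" and R: "R > 0" and \<beta>: "bounded_weight A \<beta> K" and \<gamma>: "bounded_weight A \<gamma> L"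
    and lim: "\<And>i j. i \<in> A \<Longrightarrow> j \<in> A \<Longrightarrow> (\<lambda>n. (real n)\<^sup>2 * (q i j - r n i j)) \<longlonglongrightarrow> d i j"
  shows "(\<lambda>n. of_nat n ^ 2 * (mix_pairing R A \<beta> \<gamma> q - mix_pairing R A \<beta> \<gamma> (r n)))
    \<longlonglongrightarrow> (\<Sum>i\<in>A. \<Sum>j\<in>A. of_real (d i j) * mix_pairing R A (\<lambda>t. circ_pt R (t i) * \<beta> t)
      (\<lambda>s. circ_pt R (s j) * \<gamma> s) q)"
proof -
  interpret T: prob_space "torus A" by (rule prob_space_torus)
  interpret P: pair_prob_space "torus A" "torus A" ..
  define TT where "TT = torus A \<Otimes>\<^sub>M torus A"
  have [measurable]: "i \<in> A \<Longrightarrow> (\<lambda>t. circ_pt R (t i)) \<in> borel_measurable (torus A)" for i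
    by (rule torus_component_measurable[OF circ_pt_measurable])
  have [measurable]: "\<beta> \<in> borel_measurable (torus A)" "\<gamma> \<in> borel_measurable (torus A)"
    using \<beta> \<gamma> by (auto simp: bounded_weight_def)
  note [measurable] = mix_form_measurable
  define w where "w n t s = mix_form R A (\<lambda>i j. q i j - r n i j) t s" for n t s
  have w_eq: "w n t s = mix_form R A q t s - mix_form R A (r n) t s" for n t s
    by (simp add: w_def mix_form_def sum_subtractf algebra_simps)
  define D where "D n = (\<Sum>i\<in>A. \<Sum>j\<in>A. R * R * \<bar>(real n)\<^sup>2 * (q i j - r n i j)\<bar>)" for n
  have "D \<longlonglongrightarrow> (\<Sum>i\<in>A. \<Sum>j\<in>A. R * R * \<bar>d i j\<bar>)"
    unfolding D_def by (intro tendsto_intros lim)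
  \<comment> \<open>A convergent sequence is bounded; this gives one bound on n^2 |w| for all n and
    all points of the tori, hence the dominating constant.\<close>
  then have "Bseq D" by (intro convergent_imp_Bseq convergentI)
  then obtain B where B: "\<And>n. \<bar>D n\<bar> \<le> B" unfolding Bseq_def by auto
  have B0: "B \<ge> 0" using B[of 0] by linarith
  have nw: "(real n)\<^sup>2 * norm (w n t s) \<le> B" for n t s
  proof -
    have "(real n)\<^sup>2 * norm (w n t s) \<le> (real n)\<^sup>2 * (\<Sum>i\<in>A. \<Sum>j\<in>A. R * R * \<bar>q i j - r n i j\<bar>)"
      unfolding w_def by (intro mult_left_mono norm_mix_form_le R) simp
    also have "\<dots> = D n" by (simp add: D_def sum_distrib_left abs_mult mult_ac)
    finally show ?thesis using B[of n] by linarith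
  qed
  define E where "E = (\<Sum>i\<in>A. \<Sum>j\<in>A. R * R * \<bar>q i j\<bar>)"
  have exp_b: "norm (exp (mix_form R A x t s)) \<le> exp (\<Sum>i\<in>A. \<Sum>j\<in>A. R * R * \<bar>x i j\<bar>)" for x t s
    using norm_exp[of "mix_form R A x t s"] norm_mix_form_le[OF R, of A x t s]
      by (meson exp_le_cancel_iff order_trans)
  define H where "H n t s = of_nat n ^ 2 * (exp (mix_form R A q t s)
      - exp (mix_form R A (r n) t s))" for n t s
  define H' where "H' t s = exp (mix_form R A q t s) * mix_form R A d t s" for t s
  have H_eq: "H n t s = exp (mix_form R A q t s) * (of_nat n ^ 2 * (1 - exp (- w n t s)))" for n t s
  proof -
    have "exp (mix_form R A (r n) t s) = exp (mix_form R A q t s) * exp (- w n t s)"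
      by (simp add: w_eq flip: exp_add)
    then show ?thesis by (simp add: H_def algebra_simps)
  qed
  have Hm: "(\<lambda>p. H n (fst p) (snd p)) \<in> borel_measurable TT" for n
    unfolding H_def TT_def by measurable
  have H'm: "(\<lambda>p. H' (fst p) (snd p)) \<in> borel_measurable TT"
    unfolding H'_def TT_def by measurable
  have Hb: "norm (H n t s) \<le> exp E * (B * exp B)" for n t s
  \<comment> \<open>For n \<ge> 1 the bound on n^2 |w| also bounds |w| in the exponent; at n = 0 the
    factor n^2 makes \<open>H\<close> vanish.\<close>
  proof (cases "n = 0")
    case True
    then show ?thesis using B0 by (simp add: H_def)
  next
    case False
    have "norm (w n t s) \<le> (real n)\<^sup>2 * norm (w n t s)"
      using False mult_right_mono[of 1 "(real n)\<^sup>2" "norm (w n t s)"] by (simp add: one_le_power)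
    then have wB: "norm (w n t s) \<le> B" using nw[of n t s] by linarith
    have "norm (H n t s) = norm (exp (mix_form R A q t s))
        * ((real n)\<^sup>2 * norm (1 - exp (- w n t s)))"
      unfolding H_eq by (simp add: norm_mult norm_power)
    also have "\<dots> \<le> exp E * ((real n)\<^sup>2 * (norm (w n t s) * exp (norm (w n t s))))"
      unfolding E_def by (intro mult_mono exp_b mult_left_mono exp_difference_bound) auto
    also have "\<dots> = exp E * (((real n)\<^sup>2 * norm (w n t s)) * exp (norm (w n t s)))"
        by (simp add: mult.assoc)
    also have "\<dots> \<le> exp E * (B * exp B)"
      by (intro mult_left_mono mult_mono nw) (use wB B0 in auto)
    finally show ?thesis .
  qed
  have Hlim: "(\<lambda>n. H n t s) \<longlonglongrightarrow> H' t s" for t s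
  proof -
    have "(\<lambda>n. of_nat n ^ 2 * w n t s) \<longlonglongrightarrow> mix_form R A d t s"
    proof -
      have "(\<lambda>n. \<Sum>i\<in>A. \<Sum>j\<in>A. circ_pt R (t i) * circ_pt R (s j)
          * of_real ((real n)\<^sup>2 * (q i j - r n i j)))
        \<longlonglongrightarrow> mix_form R A d t s"
        unfolding mix_form_def by (intro tendsto_intros lim)
      then show ?thesis by (simp add: w_def mix_form_def sum_distrib_left mult_ac)
    qed
    from tendsto_scaled_exp_difference[OF this] show ?thesis
      unfolding H_eq H'_def by (intro tendsto_intros)
  qed
  have lhs: "of_nat n ^ 2 * (mix_pairing R A \<beta> \<gamma> q - mix_pairing R A \<beta> \<gamma> (r n))
    = (\<integral>p. \<beta> (fst p) * (\<gamma> (snd p) * H n (fst p) (snd p)) \<partial>TT)" for n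
  proof -
    have em: "(\<lambda>p. exp (mix_form R A x (fst p) (snd p))) \<in> borel_measurable (torus A \<Otimes>\<^sub>M torus A)"
        for x
      by measurable
    note i = mix_integrable(1)[OF \<beta> \<gamma> em exp_b]
    have "mix_pairing R A \<beta> \<gamma> q - mix_pairing R A \<beta> \<gamma> (r n)
      = (\<integral>p. \<beta> (fst p) * (\<gamma> (snd p) * exp (mix_form R A q (fst p) (snd p)))
          - \<beta> (fst p) * (\<gamma> (snd p) * exp (mix_form R A (r n) (fst p) (snd p))) \<partial>TT)"
      unfolding mix_pairing_def mix_iterated_integral[OF \<beta> \<gamma> em exp_b] TT_def
      by (rule Bochner_Integration.integral_diff[symmetric, OF i i])
    then have "of_nat n ^ 2 * (mix_pairing R A \<beta> \<gamma> q - mix_pairing R A \<beta> \<gamma> (r n))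
      = (\<integral>p. of_nat n ^ 2 * (\<beta> (fst p) * (\<gamma> (snd p) * exp (mix_form R A q (fst p) (snd p)))
          - \<beta> (fst p) * (\<gamma> (snd p) * exp (mix_form R A (r n) (fst p) (snd p)))) \<partial>TT)"
      by (simp only: integral_mult_right_zero)
    then show ?thesis by (simp add: H_def algebra_simps)
  qed
  have "(\<lambda>n. \<integral>p. \<beta> (fst p) * (\<gamma> (snd p) * H n (fst p) (snd p)) \<partial>TT)
    \<longlonglongrightarrow> (\<integral>p. \<beta> (fst p) * (\<gamma> (snd p) * H' (fst p) (snd p)) \<partial>TT)"
  proof (rule integral_dominated_convergence)
    note [measurable] = Hm[unfolded TT_def] H'm[unfolded TT_def]
    show "(\<lambda>p. \<beta> (fst p) * (\<gamma> (snd p) * H' (fst p) (snd p))) \<in> borel_measurable TT"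
      unfolding TT_def by measurable
    show "(\<lambda>p. \<beta> (fst p) * (\<gamma> (snd p) * H n (fst p) (snd p))) \<in> borel_measurable TT" for n
      unfolding TT_def by measurable
    show "integrable TT (\<lambda>p. K * (L * (exp E * (B * exp B))))"
      unfolding TT_def by simp
    show "AE p in TT. (\<lambda>n. \<beta> (fst p) * (\<gamma> (snd p) * H n (fst p) (snd p)))
        \<longlonglongrightarrow> \<beta> (fst p) * (\<gamma> (snd p) * H' (fst p) (snd p))"
      by (intro AE_I2 tendsto_intros Hlim)
    show "AE p in TT. norm (\<beta> (fst p) * (\<gamma> (snd p) * H n (fst p) (snd p)))
        \<le> K * (L * (exp E * (B * exp B)))" for n
      by (intro AE_I2 mix_integrable(2)[OF \<beta> \<gamma> Hm[unfolded TT_def] Hb])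
  qed
  moreover have "(\<integral>p. \<beta> (fst p) * (\<gamma> (snd p) * H' (fst p) (snd p)) \<partial>TT)
    = (\<Sum>i\<in>A. \<Sum>j\<in>A. of_real (d i j) * mix_pairing R A (\<lambda>t. circ_pt R (t i) * \<beta> t)
      (\<lambda>s. circ_pt R (s j) * \<gamma> s) q)"
  proof -
    have w1: "bounded_weight A (\<lambda>t. circ_pt R (t i) * \<beta> t) (R * K)" if "i \<in> A" for i
      using that \<beta> R unfolding bounded_weight_def by (auto simp: norm_mult)
    have w2: "bounded_weight A (\<lambda>t. circ_pt R (t i) * \<gamma> t) (R * L)" if "i \<in> A" for i
      using that \<gamma> R unfolding bounded_weight_def by (auto simp: norm_mult)
    have em: "(\<lambda>p. exp (mix_form R A q (fst p) (snd p))) \<in> borel_measurable (torus A \<Otimes>\<^sub>M torus A)"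
      by measurable
    define G where "G i j p = of_real (d i j) * (circ_pt R (fst p i) * \<beta> (fst p)
        * (circ_pt R (snd p j) * \<gamma> (snd p) * exp (mix_form R A q (fst p) (snd p))))" for i j p
    have int: "integrable TT (G i j)" if "i \<in> A" "j \<in> A" for i j
      unfolding G_def TT_def using mix_integrable(1)[OF w1[OF that(1)] w2[OF that(2)] em exp_b]
      by (intro integrable_mult_right)
    have "(\<integral>p. \<beta> (fst p) * (\<gamma> (snd p) * H' (fst p) (snd p)) \<partial>TT) = (\<integral>p. (\<Sum>i\<in>A. \<Sum>j\<in>A. G i j p) \<partial>TT)"
      by (intro Bochner_Integration.integral_cong refl)
         (simp add: H'_def G_def mix_form_def[of R A d] sum_distrib_left sum_distrib_right mult_ac)
    also have "\<dots> = (\<Sum>i\<in>A. \<Sum>j\<in>A. integral\<^sup>L TT (G i j))"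
      by (simp add: int)
    also have "\<dots> = (\<Sum>i\<in>A. \<Sum>j\<in>A. of_real (d i j) * mix_pairing R A (\<lambda>t. circ_pt R (t i)
        * \<beta> t) (\<lambda>s. circ_pt R (s j) * \<gamma> s) q)"
    proof (intro sum.cong refl)
      fix i j assume ij: "i \<in> A" "j \<in> A"
      show "integral\<^sup>L TT (G i j) = of_real (d i j)
          * mix_pairing R A (\<lambda>t. circ_pt R (t i) * \<beta> t) (\<lambda>s. circ_pt R (s j) * \<gamma> s) q"
        unfolding G_def integral_mult_right_zero mix_pairing_def
          mix_iterated_integral[OF w1[OF ij(1)] w2[OF ij(2)] em exp_b] TT_def ..
    qed
    finally show ?thesis .
  qed
  ultimately show ?thesis unfolding lhs by simp
qed

section \<open>From pairings of mixtures to expectations of the functionals\<close>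

lemma mix_weight_single:
  assumes "finite A" "j \<in> A"
  shows "mix_weight R A a {j} t = circ_pt R (t j) * mix_weight R A a {} t"
proof -
  have "mix_weight R A a {j} t = (\<Prod>i\<in>A. if i = j then circ_pt R (t j) else 1)
      * mix_weight R A a {} t"
    unfolding mix_weight_def prod.distrib[symmetric] by (intro prod.cong) auto
  then show ?thesis using assms by simp
qed

lemma (in brownian) mixture_pairing_real:
  assumes A: "finite A" and R: "R > 0" and \<beta>: "bounded_weight A \<beta> K" and \<gamma>: "bounded_weight A \<gamma> L"
    and X: "\<And>i. i \<in> A \<Longrightarrow> is_wiener_integral M W (u i) (X i)"
    and X': "\<And>i. i \<in> A \<Longrightarrow> is_wiener_integral M W (v i) (X' i)"
    and Y: "AE \<omega> in M. complex_of_real (Y \<omega>) = wick_mixture R A \<beta> u X \<omega>" "Y \<in> borel_measurable M"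
    and Y': "AE \<omega> in M. complex_of_real (Y' \<omega>) = wick_mixture R A \<gamma> v X' \<omega>"
      "Y' \<in> borel_measurable M"
  shows "complex_of_real (\<integral>\<omega>. Y \<omega> * Y' \<omega> \<partial>M) = mix_pairing R A \<beta> \<gamma> (\<lambda>i j. inner_01 (u i) (v j))"
proof -
  have [measurable]: "i \<in> A \<Longrightarrow> X i \<in> borel_measurable M" "i \<in> A \<Longrightarrow> X' i \<in> borel_measurable M" for i
    using X X' is_wiener_integral_L2(2) L2_spaceD(1) by blast+
  have [measurable]: "wick_mixture R A \<beta> u X \<in> borel_measurable M"
      "wick_mixture R A \<gamma> v X' \<in> borel_measurable M"
    by (rule wick_mixture_measurable[OF \<beta>], simp) (rule wick_mixture_measurable[OF \<gamma>], simp)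
  note [measurable] = Y(2) Y'(2)
  have "complex_of_real (\<integral>\<omega>. Y \<omega> * Y' \<omega> \<partial>M) = (\<integral>\<omega>. complex_of_real (Y \<omega> * Y' \<omega>) \<partial>M)"
    by (rule integral_complex_of_real[symmetric])
  also have "\<dots> = (\<integral>\<omega>. wick_mixture R A \<beta> u X \<omega> * wick_mixture R A \<gamma> v X' \<omega> \<partial>M)"
  proof (rule integral_cong_AE)
    show "AE \<omega> in M. complex_of_real (Y \<omega> * Y' \<omega>) = wick_mixture R A \<beta> u X \<omega>
        * wick_mixture R A \<gamma> v X' \<omega>"
      using Y(1) Y'(1) by eventually_elim (simp only: of_real_mult)
  qed measurable
  also have "\<dots> = mix_pairing R A \<beta> \<gamma> (\<lambda>i j. inner_01 (u i) (v j))"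
    unfolding mix_pairing_def mix_form_def by (rule wick_mixture_pairing[OF A X A X' \<beta> \<gamma> R])
  finally show ?thesis .
qed

theorem theorem14:
  fixes M :: "'a measure" and W :: "real \<Rightarrow> 'a \<Rightarrow> real"
    and m :: nat
    and f f' g g' :: "nat \<Rightarrow> real \<Rightarrow> real"
    and a b :: "nat \<Rightarrow> nat \<Rightarrow> real"
    and F G :: "'a \<Rightarrow> real"
  assumes "brownian_motion M W"
    and "\<And>i. i \<in> {1..m} \<Longrightarrow> has_BV_derivative (f i) (f' i)"
    and "\<And>i. i \<in> {1..m} \<Longrightarrow> has_BV_derivative (g i) (g' i)"
    and "wick_analytic_coeffs m a" and "F = wick_analytic M W m a f"
    and "wick_analytic_coeffs m b" and "G = wick_analytic M W m b g"
  shows "(\<lambda>n. (real n)\<^sup>2 *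
            (\<integral>\<omega>. (F \<omega> - grid_approx M W n F \<omega>) * (G \<omega> - grid_approx M W n G \<omega>) \<partial>M))
         \<longlonglongrightarrow> 1 / 12 * (\<Sum>i=1..m. \<Sum>j=1..m. inner_01 (f' i) (g' j) *
            (\<integral>\<omega>. wick_analytic_partial M W m a f i \<omega> * wick_analytic_partial M W m b g j \<omega> \<partial>M))"
proof -
  interpret brownian M W using assms(1) by unfold_locales
  define A where "A = {1..m}"
  have A: "finite A" by (simp add: A_def)
  obtain R1 R2 where R12: "R1 > 0" "R2 > 0" "\<And>R i. R \<ge> R1 \<Longrightarrow> i \<in> {1..m} \<Longrightarrow> borel_summable R (a i)"
    "\<And>R i. R \<ge> R2 \<Longrightarrow> i \<in> {1..m} \<Longrightarrow> borel_summable R (b i)"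
    using wick_analytic_coeffs_borel_summable[OF assms(4)]
      wick_analytic_coeffs_borel_summable[OF assms(6)] by metis
  define R where "R = max R1 R2"
  have R: "R > 0" using R12 by (simp add: R_def)
  have a: "\<And>i. i \<in> A \<Longrightarrow> borel_summable R (a i)" and b: "\<And>i. i \<in> A \<Longrightarrow> borel_summable R (b i)"
    using R12(3,4) by (auto simp: A_def R_def)
  have f: "\<And>i. i \<in> A \<Longrightarrow> f i \<in> L2_01" and g: "\<And>i. i \<in> A \<Longrightarrow> g i \<in> L2_01"
    using assms(2,3) by (auto simp: A_def has_BV_derivative_def)
  define \<beta> where "\<beta> = mix_weight R A a"
  define \<gamma> where "\<gamma> = mix_weight R A b"
  have w\<beta>: "bounded_weight A (\<beta> J) (mix_bound R A a J)"
      and w\<gamma>: "bounded_weight A (\<gamma> J) (mix_bound R A b J)" for J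
    unfolding \<beta>_def \<gamma>_def using A a b by (auto intro!: bounded_weight_mix_weight)
  have If: "is_wiener_integral M W (f i) (wiener_integral M W (f i))" if "i \<in> A" for i
    by (rule is_wiener_integral_wiener_integral[OF f[OF that]])
  have Ig: "is_wiener_integral M W (g i) (wiener_integral M W (g i))" if "i \<in> A" for i
    by (rule is_wiener_integral_wiener_integral[OF g[OF that]])
  have SF: "has_S_transform F (mix_S A a {} f)"
    unfolding assms(5) A_def by (rule wick_analytic_has_S_transform[OF f a R]) (simp_all add: A_def)
  have SG: "has_S_transform G (mix_S A b {} g)"
    unfolding assms(7) A_def by (rule wick_analytic_has_S_transform[OF g b R]) (simp_all add: A_def)
  have Sp: "has_S_transform (wick_analytic_partial M W m a f j) (mix_S A a {j} f)" for j
    \<comment> \<open>The singleton {j} marks the differentiated factor, so its mixture carries the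
      weight of F times z_j.\<close>
    unfolding A_def by (rule wick_analytic_partial_has_S_transform[OF f a R]) (simp_all add: A_def)
  have Sp': "has_S_transform (wick_analytic_partial M W m b g j) (mix_S A b {j} g)" for j
    unfolding A_def by (rule wick_analytic_partial_has_S_transform[OF g b R]) (simp_all add: A_def)
  have L2: "F \<in> L2_space M" "G \<in> L2_space M" using SF SG by (auto simp: has_S_transform_def)
  have Lp: "wick_analytic_partial M W m a f j \<in> borel_measurable M"
      "wick_analytic_partial M W m b g j \<in> borel_measurable M" for j
    using Sp Sp' by (auto simp: has_S_transform_def L2_space_def)
  have rF: "AE \<omega> in M. complex_of_real (F \<omega>)
      = wick_mixture R A (\<beta> {}) f (\<lambda>i. wiener_integral M W (f i)) \<omega>"
    unfolding \<beta>_def by (rule AE_eq_wick_mixture[OF SF A R a If])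
  have rG: "AE \<omega> in M. complex_of_real (G \<omega>)
      = wick_mixture R A (\<gamma> {}) g (\<lambda>i. wiener_integral M W (g i)) \<omega>"
    unfolding \<gamma>_def by (rule AE_eq_wick_mixture[OF SG A R b Ig])
  \<comment> \<open>Matrices of inner products before (\<open>q\<close>) and after
    (\<open>r n\<close>) averaging. Averaging either family or both gives the same matrix, so the
    four expectations of the expanded product take only two values and three of them combine into
    one subtracted term.\<close>
  define q where "q = (\<lambda>i j. inner_01 (f i) (g j))"
  define r where "r n = (\<lambda>i j. inner_01 (f i) (grid_average n (g j)))" for n
  have partial: "complex_of_real (\<integral>\<omega>. wick_analytic_partial M W m a f i \<omega>
      * wick_analytic_partial M W m b g j \<omega> \<partial>M)
    = mix_pairing R A (\<lambda>t. circ_pt R (t i) * \<beta> {} t) (\<lambda>s. circ_pt R (s j) * \<gamma> {} s) q" if ij: "i \<in>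
      A" "j \<in> A" for i j
  proof -
    have 1: "AE \<omega> in M. complex_of_real (wick_analytic_partial M W m a f i \<omega>)
        = wick_mixture R A (\<beta> {i}) f (\<lambda>i. wiener_integral M W (f i)) \<omega>"
      unfolding \<beta>_def by (rule AE_eq_wick_mixture[OF Sp A R a If])
    have 2: "AE \<omega> in M. complex_of_real (wick_analytic_partial M W m b g j \<omega>)
        = wick_mixture R A (\<gamma> {j}) g (\<lambda>i. wiener_integral M W (g i)) \<omega>"
      unfolding \<gamma>_def by (rule AE_eq_wick_mixture[OF Sp' A R b Ig])
    have "complex_of_real (\<integral>\<omega>. wick_analytic_partial M W m a f i \<omega>
        * wick_analytic_partial M W m b g j \<omega> \<partial>M)
      = mix_pairing R A (\<beta> {i}) (\<gamma> {j}) q"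
      unfolding q_def by (rule mixture_pairing_real[OF A R w\<beta> w\<gamma> If Ig 1 Lp(1) 2 Lp(2)])
    also have "\<beta> {i} = (\<lambda>t. circ_pt R (t i) * \<beta> {} t)" unfolding \<beta>_def
        by (intro ext mix_weight_single A ij)
    also have "\<gamma> {j} = (\<lambda>s. circ_pt R (s j) * \<gamma> {} s)" unfolding \<gamma>_def
        by (intro ext mix_weight_single A ij)
    finally show ?thesis .
  qed
  have main: "complex_of_real (\<integral>\<omega>. (F \<omega> - grid_approx M W n F \<omega>) * (G \<omega> - grid_approx M W n G \<omega>) \<partial>M)
    = mix_pairing R A (\<beta> {}) (\<gamma> {}) q - mix_pairing R A (\<beta> {}) (\<gamma> {}) (r n)" if n: "n > 0" for n
  proof -
    define F' where "F' = grid_approx M W n F"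
    define G' where "G' = grid_approx M W n G"
    have Iaf: "is_wiener_integral M W (grid_average n (f i)) (grid_wiener n (f i))"
      and Iag: "is_wiener_integral M W (grid_average n (g i)) (grid_wiener n (g i))" for i
      by (rule is_wiener_integral_grid_wiener[OF n])+
    have rF': "AE \<omega> in M. complex_of_real (F' \<omega>)
        = wick_mixture R A (\<beta> {}) (\<lambda>i. grid_average n (f i)) (\<lambda>i. grid_wiener n (f i)) \<omega>"
      and LF': "F' \<in> L2_space M"
      unfolding F'_def \<beta>_def using grid_approx_eq_mixture[OF n f SF A R a] by auto
    have rG': "AE \<omega> in M. complex_of_real (G' \<omega>)
        = wick_mixture R A (\<gamma> {}) (\<lambda>i. grid_average n (g i)) (\<lambda>i. grid_wiener n (g i)) \<omega>"
      and LG': "G' \<in> L2_space M"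
      unfolding G'_def \<gamma>_def using grid_approx_eq_mixture[OF n g SG A R b] by auto
    note meas = L2_spaceD(1)[OF L2(1)] L2_spaceD(1)[OF L2(2)] L2_spaceD(1)[OF LF']
        L2_spaceD(1)[OF LG']
    define P where "P = mix_pairing R A (\<beta> {}) (\<gamma> {})"
    have e1: "complex_of_real (\<integral>\<omega>. F \<omega> * G \<omega> \<partial>M) = P q"
      unfolding q_def P_def by (rule mixture_pairing_real[OF A R w\<beta> w\<gamma> If Ig rF meas(1) rG meas(2)])
    have e2: "complex_of_real (\<integral>\<omega>. F \<omega> * G' \<omega> \<partial>M) = P (r n)"
      unfolding r_def P_def by (rule mixture_pairing_real[OF A R w\<beta> w\<gamma> If Iag rF meas(1) rG'
        meas(4)])
    have cong: "P x = P y" if "\<And>i j. i \<in> A \<Longrightarrow> j \<in> A \<Longrightarrow> x i j = y i j" for x y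
    proof -
      have "mix_form R A x = mix_form R A y" unfolding mix_form_def using that
          by (intro ext sum.cong) auto
      then show ?thesis by (simp add: P_def mix_pairing_def)
    qed
    have "complex_of_real (\<integral>\<omega>. F' \<omega> * G \<omega> \<partial>M) = P (\<lambda>i j. inner_01 (grid_average n (f i)) (g j))"
      unfolding P_def by (rule mixture_pairing_real[OF A R w\<beta> w\<gamma> Iaf Ig rF' meas(3) rG meas(2)])
    also have "\<dots> = P (r n)"
    proof (rule cong)
      fix i j assume ij: "i \<in> A" "j \<in> A"
      show "inner_01 (grid_average n (f i)) (g j) = r n i j"
        unfolding r_def inner_commute[of "grid_average n (f i)"]
          inner_grid_average_average(1)[OF f[OF ij(1)]]
          inner_grid_average_average(1)[OF g[OF ij(2)]] by (simp add: mult_ac)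
    qed
    finally have e3: "complex_of_real (\<integral>\<omega>. F' \<omega> * G \<omega> \<partial>M) = P (r n)" .
    have "complex_of_real (\<integral>\<omega>. F' \<omega> * G' \<omega> \<partial>M)
        = P (\<lambda>i j. inner_01 (grid_average n (f i)) (grid_average n (g j)))"
      unfolding P_def by (rule mixture_pairing_real[OF A R w\<beta> w\<gamma> Iaf Iag rF' meas(3) rG' meas(4)])
    also have "\<dots> = P (r n)"
      by (rule cong) (simp add: r_def inner_grid_average_average(2)[OF f])
    finally have e4: "complex_of_real (\<integral>\<omega>. F' \<omega> * G' \<omega> \<partial>M) = P (r n)" .
    have "(\<integral>\<omega>. (F \<omega> - F' \<omega>) * (G \<omega> - G' \<omega>) \<partial>M) = (\<integral>\<omega>. F \<omega> * G \<omega> - F \<omega> * G' \<omega>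
        - (F' \<omega> * G \<omega> - F' \<omega> * G' \<omega>) \<partial>M)"
      by (simp add: algebra_simps)
    also have "\<dots> = (\<integral>\<omega>. F \<omega> * G \<omega> \<partial>M) - (\<integral>\<omega>. F \<omega> * G' \<omega> \<partial>M)
        - ((\<integral>\<omega>. F' \<omega> * G \<omega> \<partial>M) - (\<integral>\<omega>. F' \<omega> * G' \<omega> \<partial>M))"
      using L2_mult_integrable[OF L2(1) L2(2)] L2_mult_integrable[OF L2(1) LG']
        L2_mult_integrable[OF LF' L2(2)] L2_mult_integrable[OF LF' LG'] by simp
    finally show ?thesis unfolding F'_def[symmetric] G'_def[symmetric] P_def[symmetric]
        by (simp add: e1 e2 e3 e4)
  qed
  have "(\<lambda>n. of_nat n ^ 2 * (mix_pairing R A (\<beta> {}) (\<gamma> {}) q - mix_pairing R A (\<beta> {}) (\<gamma> {}) (r n)))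
    \<longlonglongrightarrow> (\<Sum>i\<in>A. \<Sum>j\<in>A. of_real (inner_01 (f' i) (g' j) / 12) * mix_pairing R A
      (\<lambda>t. circ_pt R (t i) * \<beta> {} t) (\<lambda>s. circ_pt R (s j) * \<gamma> {} s) q)"
    unfolding r_def q_def using assms(2,3)
    by (intro mix_pairing_limit[OF A R w\<beta> w\<gamma>] grid_average_error_limit) (auto simp: A_def)
  also have "(\<Sum>i\<in>A. \<Sum>j\<in>A. of_real (inner_01 (f' i) (g' j) / 12)
      * mix_pairing R A (\<lambda>t. circ_pt R (t i) * \<beta> {} t) (\<lambda>s. circ_pt R (s j) * \<gamma> {} s) q)
    = complex_of_real (1 / 12 * (\<Sum>i\<in>A. \<Sum>j\<in>A. inner_01 (f' i) (g' j) *
            (\<integral>\<omega>. wick_analytic_partial M W m a f i \<omega> * wick_analytic_partial M W m b g j \<omega> \<partial>M)))"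
  proof -
    have "(\<Sum>i\<in>A. \<Sum>j\<in>A. of_real (inner_01 (f' i) (g' j) / 12)
        * mix_pairing R A (\<lambda>t. circ_pt R (t i) * \<beta> {} t) (\<lambda>s. circ_pt R (s j) * \<gamma> {} s) q)
      = (\<Sum>i\<in>A. \<Sum>j\<in>A. complex_of_real (inner_01 (f' i) (g' j) / 12 *
        (\<integral>\<omega>. wick_analytic_partial M W m a f i \<omega> * wick_analytic_partial M W m b g j \<omega> \<partial>M)))"
      by (intro sum.cong refl) (simp only: partial[symmetric] of_real_mult)
    then show ?thesis by (simp add: sum_distrib_left)
  qed
  finally have lim: "(\<lambda>n. of_nat n ^ 2 * (mix_pairing R A (\<beta> {}) (\<gamma> {}) q
      - mix_pairing R A (\<beta> {}) (\<gamma> {}) (r n)))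
    \<longlonglongrightarrow> complex_of_real (1 / 12 * (\<Sum>i\<in>A. \<Sum>j\<in>A. inner_01 (f' i) (g' j) *
            (\<integral>\<omega>. wick_analytic_partial M W m a f i \<omega> * wick_analytic_partial M W m b g j \<omega> \<partial>M)))" .
  \<comment> \<open>The pairings are complex, so the limit is established for the embedded reals and
    pulled back at the end. The identity \<open>main\<close> is available from n = 1 on.\<close>
  have "(\<lambda>n. complex_of_real ((real n)\<^sup>2 *
            (\<integral>\<omega>. (F \<omega> - grid_approx M W n F \<omega>) * (G \<omega> - grid_approx M W n G \<omega>) \<partial>M)))
    \<longlonglongrightarrow> complex_of_real (1 / 12 * (\<Sum>i\<in>A. \<Sum>j\<in>A. inner_01 (f' i) (g' j) *
            (\<integral>\<omega>. wick_analytic_partial M W m a f i \<omega> * wick_analytic_partial M W m b g j \<omega> \<partial>M)))"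
  proof (rule Lim_transform_eventually[OF lim])
    show "\<forall>\<^sub>F n in sequentially. of_nat n ^ 2 * (mix_pairing R A (\<beta> {}) (\<gamma> {}) q
        - mix_pairing R A (\<beta> {}) (\<gamma> {}) (r n))
      = complex_of_real ((real n)\<^sup>2 * (\<integral>\<omega>. (F \<omega> - grid_approx M W n F \<omega>) *
        (G \<omega> - grid_approx M W n G \<omega>) \<partial>M))"
      by (rule eventually_sequentiallyI[of 1]) (simp add: main)
  qed
  then show ?thesis unfolding tendsto_of_real_iff A_def .
qed

end
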